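(* Let $\Bbbk$ be a field with $\mathrm{char}(\Bbbk)=0$ and let $\mathfrak g$ be a non-abelian Lie algebra over $\Bbbk$ of dimension $\le 3$. Then $PS(\mathfrak g)$ is strongly Poisson cancellative.
   Context: A Poisson algebra is a commutative $\Bbbk$-algebra with a $\Bbbk$-bilinear bracket $\{-,-\}$ that is a Lie bracket and a biderivation; isomorphisms preserve products and brackets. For a Lie algebra $\mathfrak g$ with basis $x_1,\dots,x_n$, $PS(\mathfrak g)$ denotes the symmetric algebra $S(\mathfrak g)=\Bbbk[x_1,\dots,x_n]$ with the Kostant-Kirillov Poisson bracket determined by $\{x_i,x_j\}=[x_i,x_j]$. For a Poisson algebra $A$, $A[t_1,\dots,t_n]$ denotes the polynomial extension with the bracket extending that of $A$ and with all $t_i$ Poisson central. $A$ is strongly Poisson cancellative if for every $n\ge1$ and every Poisson algebra $B$, a Poisson isomorphism $A[t_1,\dots,t_n]\cong B[s_1,\dots,s_n]$ implies $A\cong B$ as Poisson algebras. *)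

theory Defs
  imports Complex_Main "HOL-Library.Poly_Mapping"
begin

section \<open>Poisson algebras\<close>

text \<open>
  A Poisson algebra over \<open>'k\<close> lives on a carrier inside a commutative ring type, whose ring
  operations (and unit) it shares. Every nonzero commutative algebra arises this way, already
  with carrier \<open>UNIV\<close>; the zero algebra does not, since \<open>0 \<noteq> 1\<close> in \<open>comm_ring_1\<close>.
\<close>

record ('k, 'a) palg =
  pcarrier :: "'a set"
  pscale :: "'k \<Rightarrow> 'a \<Rightarrow> 'a"
  pbracket :: "'a \<Rightarrow> 'a \<Rightarrow> 'a"

locale poisson_algebra =
  fixes A :: "('k::field, 'a::comm_ring_1) palg"
  assumes zero_closed: "0 \<in> pcarrier A"
    and one_closed: "1 \<in> pcarrier A"
    and add_closed: "\<lbrakk>x \<in> pcarrier A; y \<in> pcarrier A\<rbrakk> \<Longrightarrow> x + y \<in> pcarrier A"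
    and uminus_closed: "x \<in> pcarrier A \<Longrightarrow> - x \<in> pcarrier A"
    and mult_closed: "\<lbrakk>x \<in> pcarrier A; y \<in> pcarrier A\<rbrakk> \<Longrightarrow> x * y \<in> pcarrier A"
    and scale_closed: "x \<in> pcarrier A \<Longrightarrow> pscale A c x \<in> pcarrier A"
    and scale_add_right: "\<lbrakk>x \<in> pcarrier A; y \<in> pcarrier A\<rbrakk>
          \<Longrightarrow> pscale A c (x + y) = pscale A c x + pscale A c y"
    and scale_add_left: "x \<in> pcarrier A \<Longrightarrow> pscale A (c + d) x = pscale A c x + pscale A d x"
    and scale_scale: "x \<in> pcarrier A \<Longrightarrow> pscale A c (pscale A d x) = pscale A (c * d) x"
    and scale_one: "x \<in> pcarrier A \<Longrightarrow> pscale A 1 x = x"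
    and scale_mult: "\<lbrakk>x \<in> pcarrier A; y \<in> pcarrier A\<rbrakk>
          \<Longrightarrow> pscale A c x * y = pscale A c (x * y)"
    and bracket_closed: "\<lbrakk>x \<in> pcarrier A; y \<in> pcarrier A\<rbrakk> \<Longrightarrow> pbracket A x y \<in> pcarrier A"
    and bracket_add_left: "\<lbrakk>x \<in> pcarrier A; y \<in> pcarrier A; z \<in> pcarrier A\<rbrakk>
          \<Longrightarrow> pbracket A (x + y) z = pbracket A x z + pbracket A y z"
    and bracket_add_right: "\<lbrakk>x \<in> pcarrier A; y \<in> pcarrier A; z \<in> pcarrier A\<rbrakk>
          \<Longrightarrow> pbracket A x (y + z) = pbracket A x y + pbracket A x z"
    and bracket_scale_left: "\<lbrakk>x \<in> pcarrier A; y \<in> pcarrier A\<rbrakk>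
          \<Longrightarrow> pbracket A (pscale A c x) y = pscale A c (pbracket A x y)"
    and bracket_scale_right: "\<lbrakk>x \<in> pcarrier A; y \<in> pcarrier A\<rbrakk>
          \<Longrightarrow> pbracket A x (pscale A c y) = pscale A c (pbracket A x y)"
    and bracket_self: "x \<in> pcarrier A \<Longrightarrow> pbracket A x x = 0"
    and bracket_jacobi: "\<lbrakk>x \<in> pcarrier A; y \<in> pcarrier A; z \<in> pcarrier A\<rbrakk>
          \<Longrightarrow> pbracket A x (pbracket A y z) + pbracket A y (pbracket A z x)
              + pbracket A z (pbracket A x y) = 0"
    and bracket_mult_left: "\<lbrakk>x \<in> pcarrier A; y \<in> pcarrier A; z \<in> pcarrier A\<rbrakk>
          \<Longrightarrow> pbracket A (x * y) z = x * pbracket A y z + pbracket A x z * y"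
    and bracket_mult_right: "\<lbrakk>x \<in> pcarrier A; y \<in> pcarrier A; z \<in> pcarrier A\<rbrakk>
          \<Longrightarrow> pbracket A x (y * z) = y * pbracket A x z + pbracket A x y * z"

definition poisson_iso ::
  "('k::field, 'a::comm_ring_1) palg \<Rightarrow> ('k, 'b::comm_ring_1) palg \<Rightarrow> ('a \<Rightarrow> 'b) \<Rightarrow> bool" where
  "poisson_iso A B \<phi> \<longleftrightarrow>
     bij_betw \<phi> (pcarrier A) (pcarrier B) \<and>
     \<phi> 1 = 1 \<and>
     (\<forall>x\<in>pcarrier A. \<forall>c. \<phi> (pscale A c x) = pscale B c (\<phi> x)) \<and>
     (\<forall>x\<in>pcarrier A. \<forall>y\<in>pcarrier A.
        \<phi> (x + y) = \<phi> x + \<phi> y \<and>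
        \<phi> (x * y) = \<phi> x * \<phi> y \<and>
        \<phi> (pbracket A x y) = pbracket B (\<phi> x) (\<phi> y))"

definition poisson_isomorphic ::
  "('k::field, 'a::comm_ring_1) palg \<Rightarrow> ('k, 'b::comm_ring_1) palg \<Rightarrow> bool" where
  "poisson_isomorphic A B \<longleftrightarrow> (\<exists>\<phi>. poisson_iso A B \<phi>)"


section \<open>Polynomials in finitely many variables\<close>

text \<open>
  A polynomial maps exponent vectors \<open>nat \<Rightarrow>\<^sub>0 nat\<close> to coefficients; the variables
  are numbered from \<open>0\<close>.
\<close>

type_synonym 'a mpol = "(nat \<Rightarrow>\<^sub>0 nat) \<Rightarrow>\<^sub>0 'a"

definition pvar :: "nat \<Rightarrow> 'a::comm_ring_1 mpol" where
  "pvar i = Poly_Mapping.single (Poly_Mapping.single i 1) 1"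

definition pconst :: "'a::comm_ring_1 \<Rightarrow> 'a mpol" where
  "pconst a = Poly_Mapping.single 0 a"

definition mpols :: "'a::comm_ring_1 set \<Rightarrow> nat \<Rightarrow> 'a mpol set" where
  "mpols C n = {p. \<forall>m\<in>Poly_Mapping.keys p.
     Poly_Mapping.lookup p m \<in> C \<and> Poly_Mapping.keys m \<subseteq> {..<n}}"

definition pderiv_var :: "nat \<Rightarrow> 'a::comm_ring_1 mpol \<Rightarrow> 'a mpol" where
  "pderiv_var i p = (\<Sum>m\<in>Poly_Mapping.keys p.
     Poly_Mapping.single (m - Poly_Mapping.single i 1)
       (of_nat (Poly_Mapping.lookup m i) * Poly_Mapping.lookup p m))"


section \<open>Polynomial extensions\<close>

text \<open>
  \<open>A[t\<^sub>1, \<dots>, t\<^sub>n]\<close>: bilinearity, the Leibniz rule and centrality of the variables force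
  \<open>{a t\<^sup>\<alpha>, b t\<^sup>\<beta>} = {a, b} t\<^sup>\<alpha>\<^sup>+\<^sup>\<beta>\<close>.
\<close>

definition poisson_poly_ext ::
  "('k::field, 'a::comm_ring_1) palg \<Rightarrow> nat \<Rightarrow> ('k, 'a mpol) palg" where
  "poisson_poly_ext A n =
     \<lparr> pcarrier = mpols (pcarrier A) n,
       pscale = (\<lambda>c. Poly_Mapping.map (pscale A c)),
       pbracket = (\<lambda>p q. \<Sum>m\<in>Poly_Mapping.keys p. \<Sum>m'\<in>Poly_Mapping.keys q.
         Poly_Mapping.single (m + m')
           (pbracket A (Poly_Mapping.lookup p m) (Poly_Mapping.lookup q m'))) \<rparr>"

text \<open>
  HOL cannot quantify over types inside a definition, so the type in which the algebras \<open>B\<close>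
  live is a parameter; in a theorem it is a free, hence universally quantified, type variable.
  The zero algebra, which no \<open>B\<close> covers, is irrelevant: its polynomial extensions are zero, so
  they are not isomorphic to those of \<open>A\<close>.
\<close>

definition strongly_poisson_cancellative ::
  "'b::comm_ring_1 itself \<Rightarrow> ('k::field, 'a::comm_ring_1) palg \<Rightarrow> bool" where
  "strongly_poisson_cancellative (_ :: 'b itself) A \<longleftrightarrow>
     (\<forall>n\<ge>1. \<forall>B :: ('k, 'b) palg. poisson_algebra B \<longrightarrow>
        poisson_isomorphic (poisson_poly_ext A n) (poisson_poly_ext B n) \<longrightarrow>
        poisson_isomorphic A B)"


section \<open>Lie algebras and their Poisson symmetric algebras\<close>

locale lie_algebra = vector_space scale
  for scale :: "'k::field \<Rightarrow> 'g::ab_group_add \<Rightarrow> 'g" +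
  fixes lbr :: "'g \<Rightarrow> 'g \<Rightarrow> 'g"
  assumes linear_left: "Vector_Spaces.linear scale scale (\<lambda>x. lbr x y)"
    and linear_right: "Vector_Spaces.linear scale scale (lbr x)"
    and lbr_self: "lbr x x = 0"
    and jacobi: "lbr x (lbr y z) + lbr y (lbr z x) + lbr z (lbr x y) = 0"

definition lie_basis :: "('k::field \<Rightarrow> 'g::ab_group_add \<Rightarrow> 'g) \<Rightarrow> 'g list \<Rightarrow> bool" where
  "lie_basis scale xs \<longleftrightarrow> distinct xs \<and> \<not> module.dependent scale (set xs) \<and>
     module.span scale (set xs) = UNIV"

text \<open>The linear embedding of \<open>\<gg>\<close> into \<open>S(\<gg>)\<close>, with \<open>xs ! i\<close> sent to the \<open>i\<close>-th variable.\<close>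

definition lie_to_sym ::
  "('k::field \<Rightarrow> 'g::ab_group_add \<Rightarrow> 'g) \<Rightarrow> 'g list \<Rightarrow> 'g \<Rightarrow> 'k mpol" where
  "lie_to_sym scale xs v = (\<Sum>i<length xs.
     pconst (module.representation scale (set xs) v (xs ! i)) * pvar i)"

text \<open>
  The bracket of \<open>PS(\<gg>)\<close> is the only biderivation with \<open>{x\<^sub>i, x\<^sub>j} = [x\<^sub>i, x\<^sub>j]\<close>, namely
  \<open>{p, q} = (\<Sum>i j. \<partial>p/\<partial>x\<^sub>i * \<partial>q/\<partial>x\<^sub>j * [x\<^sub>i, x\<^sub>j])\<close>.
\<close>

definition PS ::
  "('k::field \<Rightarrow> 'g::ab_group_add \<Rightarrow> 'g) \<Rightarrow> ('g \<Rightarrow> 'g \<Rightarrow> 'g) \<Rightarrow> 'g list \<Rightarrow> ('k, 'k mpol) palg" where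
  "PS scale lbr xs =
     \<lparr> pcarrier = mpols UNIV (length xs),
       pscale = (\<lambda>c p. pconst c * p),
       pbracket = (\<lambda>p q. \<Sum>i<length xs. \<Sum>j<length xs.
         pderiv_var i p * pderiv_var j q * lie_to_sym scale xs (lbr (xs ! i) (xs ! j))) \<rparr>"


section \<open>The brackets on generators\<close>

lemma pderiv_var_pvar: "pderiv_var i (pvar j :: 'a::comm_ring_1 mpol) = (if i = j then 1 else 0)"
  by (auto simp: pderiv_var_def pvar_def lookup_single when_def)

lemma PS_bracket_pvar:
  assumes "i < length xs" "j < length xs"
  shows "pbracket (PS scale lbr xs) (pvar i) (pvar j) = lie_to_sym scale xs (lbr (xs ! i) (xs ! j))"
proof -
  have "pbracket (PS scale lbr xs) (pvar i) (pvar j) =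
    (\<Sum>a<length xs. \<Sum>b<length xs. if a = i then if b = j
       then lie_to_sym scale xs (lbr (xs ! a) (xs ! b)) else 0 else 0)"
    unfolding PS_def by (auto simp: pderiv_var_pvar intro!: sum.cong)
  also have "\<dots> = (\<Sum>a<length xs. if a = i then
       lie_to_sym scale xs (lbr (xs ! a) (xs ! j)) else 0)"
    using assms by (intro sum.cong) auto
  finally show ?thesis using assms by simp
qed

lemma (in vector_space) lie_to_sym_basis:
  assumes "lie_basis scale xs" "i < length xs"
  shows "lie_to_sym scale xs (xs ! i) = pvar i"
proof -
  have "representation (set xs) (xs ! i) (xs ! j) = (if j = i then 1 else 0)"
    if "j < length xs" for j
    using assms that unfolding lie_basis_def
    by (subst representation_basis) (auto simp: nth_eq_iff_index_eq)
  then have "lie_to_sym scale xs (xs ! i) = (\<Sum>j<length xs. if j = i then pvar j else 0)"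
    unfolding lie_to_sym_def by (intro sum.cong) (auto simp: pconst_def single_zero single_one)
  then show ?thesis using assms by simp
qed

context poisson_algebra
begin

lemma bracket_zero_left: "x \<in> pcarrier A \<Longrightarrow> pbracket A 0 x = 0"
  using bracket_add_left[of 0 0 x] zero_closed by simp

lemma bracket_zero_right: "x \<in> pcarrier A \<Longrightarrow> pbracket A x 0 = 0"
  using bracket_add_right[of x 0 0] zero_closed by simp

lemma bracket_one_left: "x \<in> pcarrier A \<Longrightarrow> pbracket A 1 x = 0"
  using bracket_mult_left[of 1 1 x] one_closed by simp

lemma poly_ext_bracket_pconst:
  assumes "a \<in> pcarrier A" "b \<in> pcarrier A"
  shows "pbracket (poisson_poly_ext A n) (pconst a) (pconst b) = pconst (pbracket A a b)"
  using assms by (auto simp: poisson_poly_ext_def pconst_def bracket_zero_left bracket_zero_right)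

lemma poly_ext_pvar_central:
  assumes "p \<in> pcarrier (poisson_poly_ext A n)"
  shows "pbracket (poisson_poly_ext A n) (pvar i) p = 0"
  using assms by (auto simp: poisson_poly_ext_def pvar_def mpols_def bracket_one_left)

end

end

theory Submission
  imports Defs "Jordan_Normal_Form.Determinant"
begin

text \<open>
  Let \<open>\<phi>: A[t\<^sub>1, \<dots>, t\<^sub>m] \<rightarrow> B[s\<^sub>1, \<dots>, s\<^sub>m]\<close> be a Poisson isomorphism, \<open>A = PS(\<gg>)\<close>, and let \<open>\<psi>\<close> be \<open>\<phi>\<close>
  followed by \<open>s = 0\<close>. In characteristic zero a surjective homomorphism \<open>A \<rightarrow> B\<close> is injective, by a
  Jacobian argument, so it suffices to find a surjective Poisson homomorphism. Pull back the
  \<open>\<partial>/\<partial>s\<^sub>i\<close> to locally nilpotent derivations \<open>E\<^sub>i\<close> of \<open>A[t\<^sub>1, \<dots>, t\<^sub>m]\<close>. If they vanish on the centre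
  of \<open>A\<close>, then \<open>\<psi>\<close> is surjective on \<open>A\<close>.

  Since \<open>dim \<gg> \<le> 3\<close> and \<open>\<gg>\<close> is not abelian, the Poisson centre of \<open>A\<close> has transcendence degree at most
  one. Suppose that it contains a homogeneous \<open>f\<close> of positive degree. If \<open>f\<close> vanishes at all the
  characters of \<open>A\<close>, then so do the coefficients of \<open>\<phi> f\<close>, and this forces some power of such a
  coefficient, which the \<open>E\<^sub>i\<close> kill, to be a multiple of \<open>f\<close>; since kernels of locally nilpotent
  derivations are factorially closed, \<open>E\<^sub>i f = 0\<close>. Otherwise \<open>\<gg> = \<hh> \<oplus> k v\<close> with \<open>v\<close> central, and
  the theorem of Abhyankar, Eakin and Heinzer that the affine line is cancellative shows
  that the centre of \<open>B\<close> is some \<open>k[w]\<close>; correcting \<open>\<psi>\<close> so that it maps \<open>v\<close> to \<open>w\<close> makes it surjective.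
\<close>

abbreviation "lookup \<equiv> Poly_Mapping.lookup"
abbreviation "single \<equiv> Poly_Mapping.single"
abbreviation "keys \<equiv> Poly_Mapping.keys"

section \<open>Polynomials over a subring\<close>

locale subring_set =
  fixes C :: "'a::comm_ring_1 set"
  assumes zero: "0 \<in> C" and one: "1 \<in> C"
    and add: "x \<in> C \<Longrightarrow> y \<in> C \<Longrightarrow> x + y \<in> C"
    and mult: "x \<in> C \<Longrightarrow> y \<in> C \<Longrightarrow> x * y \<in> C"
    and uminus: "x \<in> C \<Longrightarrow> - x \<in> C"
begin

lemma diff: "x \<in> C \<Longrightarrow> y \<in> C \<Longrightarrow> x - y \<in> C"
  using add[of x "- y"] uminus[of y] by simp

lemma sum: "(\<And>i. i \<in> I \<Longrightarrow> f i \<in> C) \<Longrightarrow> sum f I \<in> C"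
  by (induction I rule: infinite_finite_induct) (auto simp: zero add)

lemma prod: "(\<And>i. i \<in> I \<Longrightarrow> f i \<in> C) \<Longrightarrow> prod f I \<in> C"
  by (induction I rule: infinite_finite_induct) (auto simp: one mult)

lemma power: "x \<in> C \<Longrightarrow> x ^ k \<in> C"
  by (induction k) (auto simp: one mult)

lemma of_nat: "of_nat k \<in> C"
  by (induction k) (auto simp: zero one add)

end

lemma subring_set_UNIV: "subring_set UNIV"
  by unfold_locales auto

lemma sum_monomials: "(\<Sum>m\<in>keys p. single m (lookup p m)) = p"
  by (rule poly_mapping_eqI)
    (auto simp: lookup_sum lookup_single when_def in_keys_iff)

lemma sum_monomials_mult:
  "p * q = (\<Sum>m\<in>keys p. \<Sum>m'\<in>keys q. single (m + m') (lookup p m * lookup q m'))"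
  (is "_ = ?r")
proof -
  have "p * q = (\<Sum>m\<in>keys p. single m (lookup p m)) * (\<Sum>m\<in>keys q. single m (lookup q m))"
    by (simp add: sum_monomials)
  also have "\<dots> = ?r"
    by (simp add: sum_product mult_single)
  finally show ?thesis .
qed

lemma lookup_pconst: "lookup (pconst c) m = (if m = 0 then c else 0)"
  by (simp add: pconst_def lookup_single when_def)

lemma lookup_pconst_mult: "lookup (pconst c * p) m = c * lookup p m"
proof -
  have "pconst c * p = (\<Sum>m\<in>keys p. single m (c * lookup p m))"
    by (subst sum_monomials[of p, symmetric]) (simp add: pconst_def sum_distrib_left mult_single)
  then show ?thesis
    by (auto simp: lookup_sum lookup_single when_def in_keys_iff)
qed

lemma pconst_0 [simp]: "pconst 0 = 0"
  and pconst_1 [simp]: "pconst 1 = 1"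
  and pconst_add: "pconst (a + b) = pconst a + pconst b"
  and pconst_uminus: "pconst (- a) = - pconst a"
  and pconst_mult: "pconst (a * b) = pconst a * pconst b"
  by (simp_all add: pconst_def single_add single_uminus mult_single)

lemma pconst_sum: "pconst (sum f I) = (\<Sum>i\<in>I. pconst (f i))"
  by (induction I rule: infinite_finite_induct) (auto simp: pconst_add)

lemma pconst_power: "pconst (a ^ k) = pconst a ^ k"
  by (induction k) (auto simp: pconst_mult)

lemma pconst_of_nat: "pconst (of_nat k) = of_nat k"
  by (induction k) (auto simp: pconst_add)

lemma pconst_eq_iff [simp]: "pconst a = pconst b \<longleftrightarrow> a = b"
  by (metis lookup_pconst)

lemma pconst_eq_0_iff [simp]: "pconst a = 0 \<longleftrightarrow> a = 0"
  by (metis pconst_0 pconst_eq_iff)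

lemma keys_add_nat: "keys (m + m' :: nat \<Rightarrow>\<^sub>0 nat) = keys m \<union> keys m'"
  by (auto simp: in_keys_iff lookup_add)

context subring_set
begin

lemma mpols_iff: "p \<in> mpols C n \<longleftrightarrow> (\<forall>m. lookup p m \<in> C) \<and> (\<forall>m\<in>keys p. keys m \<subseteq> {..<n})"
  unfolding mpols_def using zero by (auto simp: in_keys_iff; metis)

lemma single_mpols: "c \<in> C \<Longrightarrow> keys m \<subseteq> {..<n} \<Longrightarrow> single m c \<in> mpols C n"
  by (auto simp: mpols_def)

lemma lookup_mpols: "p \<in> mpols C n \<Longrightarrow> lookup p m \<in> C"
  by (simp add: mpols_iff)

lemma add_mpols: "p \<in> mpols C n \<Longrightarrow> q \<in> mpols C n \<Longrightarrow> p + q \<in> mpols C n"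
  using keys_add[of p q] by (simp add: mpols_iff lookup_add add) blast

lemma zero_mpols: "0 \<in> mpols C n"
  by (simp add: mpols_def)

lemma sum_mpols: "(\<And>i. i \<in> I \<Longrightarrow> f i \<in> mpols C n) \<Longrightarrow> sum f I \<in> mpols C n"
  by (induction I rule: infinite_finite_induct) (auto simp: zero_mpols add_mpols)

lemma mult_mpols: "p \<in> mpols C n \<Longrightarrow> q \<in> mpols C n \<Longrightarrow> p * q \<in> mpols C n"
  unfolding sum_monomials_mult[of p q]
  by (intro sum_mpols single_mpols mult lookup_mpols) (auto simp: mpols_def keys_add_nat)

lemma pconst_mpols: "c \<in> C \<Longrightarrow> pconst c \<in> mpols C n"
  unfolding pconst_def by (rule single_mpols) auto

lemma pvar_mpols: "i < n \<Longrightarrow> pvar i \<in> mpols C n"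
  unfolding pvar_def by (rule single_mpols) (auto simp: one)

lemma mpols_subring: "subring_set (mpols C n)"
proof
  show "- x \<in> mpols C n" if "x \<in> mpols C n" for x
    using that by (auto simp: mpols_iff uminus in_keys_iff)
  show "1 \<in> mpols C n" using pconst_mpols[OF one] by simp
qed (auto simp: zero_mpols add_mpols mult_mpols)

lemma mpols_induct [consumes 1, case_names const var add mult]:
  assumes "p \<in> mpols C n"
    and const: "\<And>c. c \<in> C \<Longrightarrow> P (pconst c)"
    and var: "\<And>i. i < n \<Longrightarrow> P (pvar i)"
    and padd: "\<And>p q. p \<in> mpols C n \<Longrightarrow> q \<in> mpols C n \<Longrightarrow> P p \<Longrightarrow> P q \<Longrightarrow> P (p + q)"
    and pmult: "\<And>p q. p \<in> mpols C n \<Longrightarrow> q \<in> mpols C n \<Longrightarrow> P p \<Longrightarrow> P q \<Longrightarrow> P (p * q)"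
  shows "P p"
proof -
  have mono: "P (single m c)" if "c \<in> C" "keys m \<subseteq> {..<n}" for m c
    using that
  proof (induction "\<Sum>i<n. lookup m i" arbitrary: m)
    case 0
    then have "lookup m i = 0" for i
      by (cases "i < n") (auto simp: in_keys_iff subset_iff)
    then have "m = 0" by (intro poly_mapping_eqI) auto
    with const[OF that(1)] show ?case by (simp add: pconst_def)
  next
    case (Suc k)
    then obtain i where i: "i < n" "lookup m i \<noteq> 0"
      by (metis lessThan_iff sum.neutral nat.distinct(1))
    define m' where "m' = m - single i 1"
    have m: "m = single i 1 + m'"
      using i by (intro poly_mapping_eqI) (auto simp: m'_def lookup_add lookup_minus lookup_single when_def)
    have "(\<Sum>i<n. lookup m i) = 1 + (\<Sum>i<n. lookup m' i)"
      using i unfolding m by (simp add: lookup_add sum.distrib lookup_single when_def)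
    moreover have km: "keys m' \<subseteq> {..<n}" using Suc.prems(2) unfolding m by (simp add: keys_add_nat)
    ultimately have "P (single m' c)" using Suc by auto
    then have "P (pvar i * single m' c)"
      using pmult[OF pvar_mpols single_mpols var] i km Suc.prems by blast
    then show ?case unfolding m by (simp add: pvar_def mult_single)
  qed
  have "F \<subseteq> keys p \<Longrightarrow> P (\<Sum>m\<in>F. single m (lookup p m))" if "finite F" for F
    using that
  proof (induction F)
    case empty
    then show ?case using const[OF zero] by simp
  next
    case (insert m F)
    have "single m (lookup p m) \<in> mpols C n" if "m \<in> keys p" for m
      using assms(1) that by (auto simp: mpols_def)
    moreover have "P (single m (lookup p m))"
      using insert.prems assms(1) by (intro mono) (auto simp: mpols_def)
    ultimately show ?case
      using insert by (auto intro!: padd sum_mpols)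
  qed
  from this[of "keys p"] show ?thesis by (simp add: sum_monomials)
qed

end

lemma mpols_mono: "C \<subseteq> D \<Longrightarrow> mpols C n \<subseteq> mpols D n"
  by (auto simp: mpols_def)

section \<open>Partial derivatives\<close>

lemma lookup_pderiv_var:
  "lookup (pderiv_var i p) m = of_nat (Suc (lookup m i)) * lookup p (m + single i 1)"
proof -
  have *: "m' - single i 1 = m \<longleftrightarrow> m' = m + single i 1" if "lookup m' i \<noteq> 0" for m' :: "nat \<Rightarrow>\<^sub>0 nat"
  proof
    show "m' = m + single i 1" if "m' - single i 1 = m"
      using \<open>lookup m' i \<noteq> 0\<close> that[symmetric]
      by (intro poly_mapping_eqI) (auto simp: lookup_add lookup_minus lookup_single when_def)
  qed auto
  have "lookup (pderiv_var i p) m = (\<Sum>m'\<in>keys p. if m' - single i 1 = m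
      then of_nat (lookup m' i) * lookup p m' else 0)"
    unfolding pderiv_var_def lookup_sum by (intro sum.cong) (auto simp: lookup_single when_def)
  also have "\<dots> = (\<Sum>m'\<in>keys p. if m' = m + single i 1
      then of_nat (lookup m' i) * lookup p m' else 0)"
    by (intro sum.cong refl) (metis (no_types, opaque_lifting) "*" mult_zero_left of_nat_0
        lookup_add lookup_single_eq add_is_0 zero_neq_one)
  also have "\<dots> = of_nat (Suc (lookup m i)) * lookup p (m + single i 1)"
    by (auto simp: lookup_add in_keys_iff algebra_simps)
  finally show ?thesis .
qed

lemma pderiv_var_add: "pderiv_var i (p + q) = pderiv_var i p + pderiv_var i q"
  by (rule poly_mapping_eqI) (simp add: lookup_pderiv_var lookup_add algebra_simps)

lemma pderiv_var_0 [simp]: "pderiv_var i 0 = 0"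
  by (rule poly_mapping_eqI) (simp add: lookup_pderiv_var)

lemma pderiv_var_uminus: "pderiv_var i (- p) = - pderiv_var i p"
  by (rule poly_mapping_eqI) (simp add: lookup_pderiv_var)

lemma pderiv_var_sum: "pderiv_var i (sum f I) = (\<Sum>j\<in>I. pderiv_var i (f j))"
  by (induction I rule: infinite_finite_induct) (auto simp: pderiv_var_add)

lemma pderiv_var_pconst [simp]: "pderiv_var i (pconst c) = 0"
  by (rule poly_mapping_eqI)
    (auto simp: lookup_pderiv_var lookup_pconst poly_mapping_eq_iff fun_eq_iff lookup_add lookup_single when_def)

lemma pderiv_var_single:
  "pderiv_var i (single m c) = single (m - single i 1) (of_nat (lookup m i) * c)"
  by (cases "c = 0") (auto simp: pderiv_var_def)

lemma pderiv_var_mult: "pderiv_var i (p * q) = p * pderiv_var i q + pderiv_var i p * (q :: 'a::comm_ring_1 mpol)"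
proof -
  have s: "pderiv_var i (single m c * single m' c') =
      single m c * pderiv_var i (single m' c') + pderiv_var i (single m c) * single m' (c' :: 'a)" for m m' c c'
  proof -
    have *: "m + m' - single i 1 = m + (m' - single i 1)" if "lookup m' i \<noteq> 0" for m m' :: "nat \<Rightarrow>\<^sub>0 nat"
      using that by (intro poly_mapping_eqI) (auto simp: lookup_add lookup_minus lookup_single when_def)
    have **: "m - single i 1 + m' = m + m' - single i 1" if "lookup m i \<noteq> 0"
      using *[of m m'] that by (metis add.commute *)
    have "single m c * pderiv_var i (single m' c') = single (m + m' - single i 1) (of_nat (lookup m' i) * (c * c'))"
      by (cases "lookup m' i = 0") (simp_all only: pderiv_var_single mult_single * of_nat_0 mult_zero_left mult_zero_right single_zero mult.left_commute not_False_eq_True)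
    moreover have "pderiv_var i (single m c) * single m' c' = single (m + m' - single i 1) (of_nat (lookup m i) * (c * c'))"
      by (cases "lookup m i = 0") (simp_all only: pderiv_var_single mult_single ** of_nat_0 mult_zero_left mult_zero_right single_zero mult.assoc not_False_eq_True)
    ultimately show ?thesis
      by (simp add: pderiv_var_single mult_single lookup_add distrib_right add.commute flip: single_add)
  qed
  have "pderiv_var i (p * q) = (\<Sum>m\<in>keys p. \<Sum>m'\<in>keys q. pderiv_var i (single m (lookup p m) * single m' (lookup q m')))"
    by (simp add: sum_monomials_mult[of p q] pderiv_var_sum mult_single)
  also have "\<dots> = (\<Sum>m\<in>keys p. \<Sum>m'\<in>keys q. single m (lookup p m) * pderiv_var i (single m' (lookup q m')))
     + (\<Sum>m\<in>keys p. \<Sum>m'\<in>keys q. pderiv_var i (single m (lookup p m)) * single m' (lookup q m'))"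
    by (simp add: s sum.distrib)
  also have "\<dots> = p * pderiv_var i q + pderiv_var i p * q"
    unfolding sum_product[symmetric] pderiv_var_sum[symmetric] sum_monomials ..
  finally show ?thesis .
qed

lemma pderiv_var_pconst_mult: "pderiv_var i (pconst c * p) = pconst c * pderiv_var i p"
  by (simp add: pderiv_var_mult)

lemma pderiv_var_commute: "pderiv_var i (pderiv_var j p) = pderiv_var j (pderiv_var i p)"
  by (rule poly_mapping_eqI)
    (auto simp: lookup_pderiv_var lookup_add lookup_single when_def ac_simps)

lemma (in subring_set) pderiv_var_mpols: "p \<in> mpols C n \<Longrightarrow> pderiv_var i p \<in> mpols C n"
  unfolding pderiv_var_def
  by (intro sum_mpols single_mpols mult of_nat lookup_mpols)
    (auto simp: mpols_def in_keys_iff lookup_minus subset_iff)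

lemma lookup_pderiv_var_funpow:
  "\<exists>a. lookup ((pderiv_var i ^^ k) p) m = a * lookup p (m + single i k)"
proof (induction k arbitrary: m)
  case 0
  show ?case by (intro exI[of _ 1]) simp
next
  case (Suc k)
  from Suc[of "m + single i 1"] obtain a where
    "lookup ((pderiv_var i ^^ k) p) (m + single i 1) = a * lookup p (m + single i 1 + single i k)" by blast
  then show ?case
    by (intro exI[of _ "of_nat (Suc (lookup m i)) * a"])
      (simp add: lookup_pderiv_var add.assoc mult.assoc flip: single_add)
qed

lemma pderiv_var_nilpotent: "\<exists>k. (pderiv_var i ^^ k) p = 0"
proof -
  define k where "k = Suc (\<Sum>m\<in>keys p. lookup m i)"
  have "lookup p (m + single i k) = 0" for m
  proof (rule ccontr)
    assume "lookup p (m + single i k) \<noteq> 0"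
    then have "m + single i k \<in> keys p" by (simp add: in_keys_iff)
    then have "lookup (m + single i k) i \<le> (\<Sum>m\<in>keys p. lookup m i)"
      by (intro member_le_sum) auto
    then show False by (simp add: k_def lookup_add)
  qed
  then have "(pderiv_var i ^^ k) p = 0"
    by (intro poly_mapping_eqI) (metis lookup_pderiv_var_funpow mult_zero_right lookup_zero)
  then show ?thesis ..
qed

lemma pderiv_var_eq_0D:
  assumes "p \<in> mpols C n" "\<And>i. i < n \<Longrightarrow> pderiv_var i p = 0"
    and torsion: "\<And>k c. c \<in> C \<Longrightarrow> of_nat (Suc k) * c = 0 \<Longrightarrow> c = 0"
  shows "p = pconst (lookup p 0)"
proof (rule poly_mapping_eqI)
  fix m
  have "lookup p m = 0" if "m \<noteq> 0"
  proof (rule ccontr)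
    assume "lookup p m \<noteq> 0"
    then have m: "m \<in> keys p" by (simp add: in_keys_iff)
    from \<open>m \<noteq> 0\<close> obtain i where i: "lookup m i \<noteq> 0" by (metis poly_mapping_eqI lookup_zero)
    with m assms(1) have "i < n" by (auto simp: mpols_def in_keys_iff subset_iff)
    have "m - single i 1 + single i 1 = m"
      using i by (intro poly_mapping_eqI) (auto simp: lookup_add lookup_minus lookup_single when_def)
    then have "of_nat (Suc (lookup (m - single i 1) i)) * lookup p m = 0"
      using lookup_pderiv_var[of i p "m - single i 1"] assms(2)[OF \<open>i < n\<close>] by simp
    moreover have "lookup p m \<in> C" using m assms(1) by (auto simp: mpols_def)
    ultimately show False using torsion \<open>lookup p m \<noteq> 0\<close> by blast
  qed
  then show "lookup p m = lookup (pconst (lookup p 0)) m" by (auto simp: lookup_pconst)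
qed

section \<open>Derivations\<close>

locale derivation = subring_set S for S :: "'r::comm_ring_1 set" +
  fixes d :: "'r \<Rightarrow> 'r"
  assumes d_closed: "x \<in> S \<Longrightarrow> d x \<in> S"
    and d_add: "x \<in> S \<Longrightarrow> y \<in> S \<Longrightarrow> d (x + y) = d x + d y"
    and d_mult: "x \<in> S \<Longrightarrow> y \<in> S \<Longrightarrow> d (x * y) = x * d y + d x * y"
begin

lemma d_zero: "d 0 = 0"
  using d_add[OF zero zero] by simp

lemma d_one: "d 1 = 0"
  using d_mult[OF one one] by simp

lemma d_uminus: "x \<in> S \<Longrightarrow> d (- x) = - d x"
  using d_add[of x "- x"] by (simp add: uminus d_zero add_eq_0_iff)

lemma d_diff: "x \<in> S \<Longrightarrow> y \<in> S \<Longrightarrow> d (x - y) = d x - d y"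
  using d_add[of x "- y"] by (simp add: uminus d_uminus)

lemma d_sum: "(\<And>i. i \<in> I \<Longrightarrow> f i \<in> S) \<Longrightarrow> d (sum f I) = (\<Sum>i\<in>I. d (f i))"
  by (induction I rule: infinite_finite_induct) (auto simp: d_zero d_add sum)

lemma d_power: "x \<in> S \<Longrightarrow> d (x ^ Suc k) = of_nat (Suc k) * x ^ k * d x"
  by (induction k) (simp_all add: d_mult mult power algebra_simps)

lemma funpow_closed: "x \<in> S \<Longrightarrow> (d ^^ k) x \<in> S"
  by (induction k) (auto simp: d_closed)

lemma funpow_zero: "(d ^^ k) 0 = 0"
  by (induction k) (auto simp: d_zero)

lemma funpow_add: "x \<in> S \<Longrightarrow> y \<in> S \<Longrightarrow> (d ^^ k) (x + y) = (d ^^ k) x + (d ^^ k) y"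
  by (induction k) (auto simp: d_add funpow_closed)

lemma funpow_vanish_mono: "(d ^^ k) x = 0 \<Longrightarrow> k \<le> l \<Longrightarrow> (d ^^ l) x = 0"
  by (metis le_add_diff_inverse2 funpow_add funpow_zero comp_apply Nat.funpow_add)

lemma funpow_mult_top:
  assumes "x \<in> S" "y \<in> S" "(d ^^ Suc i) x = 0" "(d ^^ Suc j) y = 0"
  shows "\<exists>c>0. (d ^^ (i + j)) (x * y) = of_nat c * ((d ^^ i) x * (d ^^ j) y)"
  using assms
proof (induction "i + j" arbitrary: i j x y)
  case 0
  then show ?case by (auto intro!: exI[of _ 1])
next
  case (Suc n)
  have 1: "\<exists>c. (d ^^ n) (x * d y) = of_nat c * ((d ^^ i) x * (d ^^ j) y) \<and> (j > 0 \<longrightarrow> c > 0)"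
  proof (cases j)
    case 0
    with Suc.prems have "d y = 0" by simp
    then show ?thesis using 0 by (intro exI[of _ 0]) (simp add: funpow_zero)
  next
    case (Suc j')
    then show ?thesis
      using Suc.hyps(1)[of i j' x "d y"] Suc.prems Suc.hyps(2) by (auto simp: d_closed funpow_swap1)
  qed
  have 2: "\<exists>c. (d ^^ n) (d x * y) = of_nat c * ((d ^^ i) x * (d ^^ j) y) \<and> (i > 0 \<longrightarrow> c > 0)"
  proof (cases i)
    case 0
    with Suc.prems have "d x = 0" by simp
    then show ?thesis using 0 by (intro exI[of _ 0]) (simp add: funpow_zero)
  next
    case (Suc i')
    then show ?thesis
      using Suc.hyps(1)[of i' j "d x" y] Suc.prems Suc.hyps(2) by (auto simp: d_closed funpow_swap1)
  qed
  from 1 2 obtain a b where ab: "(d ^^ n) (x * d y) = of_nat a * ((d ^^ i) x * (d ^^ j) y)"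
    "(d ^^ n) (d x * y) = of_nat b * ((d ^^ i) x * (d ^^ j) y)" "j > 0 \<longrightarrow> a > 0" "i > 0 \<longrightarrow> b > 0" by blast
  have "(d ^^ (i + j)) (x * y) = (d ^^ n) (x * d y + d x * y)"
    using Suc.prems by (simp add: Suc.hyps(2)[symmetric] funpow_Suc_right d_mult del: funpow.simps)
  also have "\<dots> = of_nat (a + b) * ((d ^^ i) x * (d ^^ j) y)"
    using Suc.prems ab by (simp add: funpow_add mult d_closed algebra_simps)
  finally show ?case using ab Suc.hyps(2) by (intro exI[of _ "a + b"]) auto
qed

end

locale locally_nilpotent = derivation S d for S :: "'r::{idom, ring_char_0} set" and d +
  assumes nilpotent: "x \<in> S \<Longrightarrow> \<exists>k. (d ^^ k) x = 0"
begin

definition ord :: "'r \<Rightarrow> nat" where "ord x = (LEAST k. (d ^^ k) x = 0)"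

lemma ord_vanish: "x \<in> S \<Longrightarrow> (d ^^ ord x) x = 0"
  unfolding ord_def by (rule LeastI_ex) (rule nilpotent)

lemma ord_le: "(d ^^ k) x = 0 \<Longrightarrow> ord x \<le> k"
  unfolding ord_def by (rule Least_le)

lemma ord_pos: "x \<in> S \<Longrightarrow> x \<noteq> 0 \<Longrightarrow> ord x > 0"
  using ord_vanish[of x] by (cases "ord x") auto

lemma ord_derivative: "x \<in> S \<Longrightarrow> d x \<noteq> 0 \<Longrightarrow> ord (d x) < ord x"
  using ord_vanish[of x] ord_le[of "ord x - 1" "d x"]
  by (cases "ord x") (auto simp: funpow_swap1 d_zero)

lemma ord_mult:
  assumes "x \<in> S" "y \<in> S" "x \<noteq> 0" "y \<noteq> 0"
  shows "ord x + ord y \<le> Suc (ord (x * y))"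
proof -
  obtain i j where ij: "ord x = Suc i" "ord y = Suc j"
    using ord_pos assms by (metis gr0_implies_Suc)
  then have "(d ^^ i) x \<noteq> 0" "(d ^^ j) y \<noteq> 0"
    using ord_le[of i x] ord_le[of j y] by auto
  with funpow_mult_top[of x y i j] ord_vanish[of x] ord_vanish[of y] assms ij
  have "(d ^^ (i + j)) (x * y) \<noteq> 0" by auto
  then have "\<not> ord (x * y) \<le> i + j"
    using ord_vanish[of "x * y"] assms funpow_vanish_mono by (blast intro: mult)
  with ij show ?thesis by simp
qed

lemma kernel_factorially_closed:
  assumes "x \<in> S" "y \<in> S" "x \<noteq> 0" "y \<noteq> 0" "d (x * y) = 0"
  shows "d x = 0"
proof -
  have "ord (x * y) \<le> 1" using assms(5) ord_le[of 1] by simp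
  with ord_mult[OF assms(1-4)] ord_pos[of y] assms have "ord x \<le> 1" by simp
  then show ?thesis using ord_derivative[of x] assms ord_pos[of "d x"] d_closed[of x] by force
qed

lemma eigenvector_in_kernel:
  assumes "x \<in> S" "h \<in> S" "d x = h * x"
  shows "d x = 0"
proof (rule ccontr)
  assume "d x \<noteq> 0"
  with assms have "h \<noteq> 0" "x \<noteq> 0" by auto
  with ord_mult[of h x] assms ord_derivative[of x] \<open>d x \<noteq> 0\<close> ord_pos[of h] show False by simp
qed

end

lemma (in subring_set) chain_rule:
  fixes \<Theta> E :: "'a mpol \<Rightarrow> 'r::comm_ring_1"
  assumes "p \<in> mpols C n"
    and "\<And>p q. p \<in> mpols C n \<Longrightarrow> q \<in> mpols C n \<Longrightarrow> \<Theta> (p + q) = \<Theta> p + \<Theta> q"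
    and "\<And>p q. p \<in> mpols C n \<Longrightarrow> q \<in> mpols C n \<Longrightarrow> \<Theta> (p * q) = \<Theta> p * \<Theta> q"
    and "\<Theta> 1 = 1"
    and "\<And>p q. p \<in> mpols C n \<Longrightarrow> q \<in> mpols C n \<Longrightarrow> E (p + q) = E p + E q"
    and "\<And>p q. p \<in> mpols C n \<Longrightarrow> q \<in> mpols C n \<Longrightarrow> E (p * q) = \<Theta> p * E q + E p * \<Theta> q"
    and "\<And>c. c \<in> C \<Longrightarrow> E (pconst c) = 0"
  shows "E p = (\<Sum>i<n. \<Theta> (pderiv_var i p) * E (pvar i))"
proof -
  have \<Theta>0: "\<Theta> 0 = 0" using assms(2)[OF zero_mpols zero_mpols] by simp
  show ?thesis
    using assms(1)
  proof (induction rule: mpols_induct)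
    case (const c)
    then show ?case by (simp add: assms \<Theta>0)
  next
    case (var i)
    have "(\<Sum>j<n. \<Theta> (pderiv_var j (pvar i)) * E (pvar j)) = (\<Sum>j<n. if j = i then E (pvar i) else 0)"
      by (intro sum.cong) (auto simp: pderiv_var_pvar \<Theta>0 assms)
    with var show ?case by simp
  next
    case (add p q)
    then show ?case
      by (simp add: assms pderiv_var_add pderiv_var_mpols distrib_right sum.distrib)
  next
    case (mult p q)
    then show ?case
      by (simp add: assms pderiv_var_mult pderiv_var_mpols mult_mpols algebra_simps sum.distrib
          sum_distrib_left sum_distrib_right)
  qed
qed

section \<open>Matrices\<close>

lemma right_inverse_kernel:
  fixes P Q :: "nat \<Rightarrow> nat \<Rightarrow> 'r::idom"
  assumes PQ: "\<And>i k. i < N \<Longrightarrow> k < N \<Longrightarrow> (\<Sum>j<N. P i j * Q j k) = (if i = k then 1 else 0)"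
    and v: "\<And>i. i < N \<Longrightarrow> (\<Sum>j<N. P i j * v j) = 0" and "j < N"
  shows "v j = 0"
proof (rule ccontr)
  assume "v j \<noteq> 0"
  define A where "A = mat N N (\<lambda>(i, j). P i j)"
  define B where "B = mat N N (\<lambda>(i, j). Q i j)"
  have "A * B = 1\<^sub>m N"
    by (rule eq_matI) (auto simp: A_def B_def scalar_prod_def PQ atLeast0LessThan)
  then have "det A * det B = 1"
    using det_mult[of A N B] by (auto simp: A_def B_def)
  then have "det A \<noteq> 0" by auto
  moreover have "A *\<^sub>v vec N v = 0\<^sub>v N"
    by (rule eq_vecI) (auto simp: A_def scalar_prod_def v atLeast0LessThan)
  moreover have "vec N v \<noteq> 0\<^sub>v N"
    using \<open>v j \<noteq> 0\<close> \<open>j < N\<close> by (metis index_vec index_zero_vec(1))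
  ultimately show False
    using det_0_iff_vec_prod_zero[of A N] vec_carrier[of N v] mat_carrier[of N N] unfolding A_def by blast
qed

lemma (in subring_set) det_mem:
  assumes "A \<in> carrier_mat n n" "\<And>i j. i < n \<Longrightarrow> j < n \<Longrightarrow> A $$ (i, j) \<in> C"
  shows "det A \<in> C"
  unfolding det_def using assms
  by (auto intro!: sum mult prod simp: zero one uminus sign_def dest: permutes_in_image)

text \<open>
  Take the rows of \<open>N\<close> completed by \<open>r\<close> and the rows of \<open>M\<close> completed by a unit vector: the first
  matrix times the transpose of the second is triangular.
\<close>
lemma (in subring_set) right_inverse_kernel_rank_one:
  fixes M N :: "nat \<Rightarrow> nat \<Rightarrow> 'a"
  assumes "\<And>i a. i < m \<Longrightarrow> a < Suc m \<Longrightarrow> M i a \<in> C"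
    and "\<And>i a. i < m \<Longrightarrow> a < Suc m \<Longrightarrow> N i a \<in> C"
    and NM: "\<And>i k. i < m \<Longrightarrow> k < m \<Longrightarrow> (\<Sum>a<Suc m. N k a * M i a) = (if k = i then 1 else 0)"
  obtains g c where "\<And>a. g a \<in> C" "\<And>a. c a \<in> C"
    "\<And>r b. (\<And>i. i < m \<Longrightarrow> (\<Sum>a<Suc m. r a * M i a) = 0) \<Longrightarrow> b < Suc m \<Longrightarrow>
       r b = (\<Sum>a<Suc m. g a * r a) * c b"
proof
  define W where "W r = mat (Suc m) (Suc m) (\<lambda>(i, a). if i = 0 then r a else N (i - 1) a)" for r
  define V where "V b = mat (Suc m) (Suc m) (\<lambda>(i, a). if i = 0 then (if a = b then 1 else 0) else M (i - 1) a)" for b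
  have WV [simp]: "W r \<in> carrier_mat (Suc m) (Suc m)" "V b \<in> carrier_mat (Suc m) (Suc m)" for r b
    by (auto simp: W_def V_def)
  define g where "g a = (if a < Suc m then cofactor (W (\<lambda>_. 0)) 0 a else 0)" for a
  define c where "c b = det (V b)" for b
  have del: "mat_delete (W r) 0 a = mat_delete (W (\<lambda>_. 0)) 0 a" for r a
    by (rule eq_matI) (auto simp: mat_delete_def W_def)
  show "g a \<in> C" for a
  proof (cases "a < Suc m")
    case True
    have "det (mat_delete (W (\<lambda>_. 0)) 0 a) \<in> C"
      by (rule det_mem[of _ m]) (use True assms(1,2) in \<open>auto simp: mat_delete_def W_def zero one\<close>)
    then show ?thesis
      using True by (auto simp: g_def cofactor_def intro!: mult power uminus one)
  qed (simp add: g_def zero)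
  show "c b \<in> C" for b
    unfolding c_def by (rule det_mem[of _ "Suc m"]) (use assms(1,2) in \<open>auto simp: V_def zero one\<close>)
  show "r b = (\<Sum>a<Suc m. g a * r a) * c b"
    if r: "\<And>i. i < m \<Longrightarrow> (\<Sum>a<Suc m. r a * M i a) = 0" and b: "b < Suc m" for r b
  proof -
    have "det (W r) = (\<Sum>a<Suc m. W r $$ (0, a) * cofactor (W r) 0 a)"
      by (rule laplace_expansion_row[of _ "Suc m"]) auto
    also have "\<dots> = (\<Sum>a<Suc m. g a * r a)"
      by (intro sum.cong) (auto simp: g_def cofactor_def del[of r], simp add: W_def)
    finally have detW: "det (W r) = (\<Sum>a<Suc m. g a * r a)" .
    define T where "T = W r * transpose_mat (V b)"
    have T: "T \<in> carrier_mat (Suc m) (Suc m)"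
      unfolding T_def by (intro mult_carrier_mat[of _ _ "Suc m"]) auto
    have Tij: "T $$ (i, j) = (\<Sum>a<Suc m. W r $$ (i, a) * V b $$ (j, a))" if "i < Suc m" "j < Suc m" for i j
      using that by (auto simp: T_def scalar_prod_def W_def V_def atLeast0LessThan intro!: sum.cong)
    have "T $$ (i, j) = 0" if "i < j" "j < Suc m" for i j
    proof (cases i)
      case 0
      then have "T $$ (i, j) = (\<Sum>a<Suc m. r a * M (j - 1) a)"
        using that by (subst Tij) (auto simp: W_def V_def intro!: sum.cong)
      with r[of "j - 1"] that show ?thesis by simp
    next
      case (Suc i')
      then have "T $$ (i, j) = (\<Sum>a<Suc m. N i' a * M (j - 1) a)"
        using that by (subst Tij) (auto simp: W_def V_def intro!: sum.cong)
      with NM[of "j - 1" i'] that Suc show ?thesis by auto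
    qed
    then have "det T = prod_list (diag_mat T)"
      by (rule det_lower_triangular) (use T in auto)
    also have "\<dots> = (\<Prod>i<Suc m. T $$ (i, i))"
      using T by (simp add: prod_list_diag_prod atLeast0LessThan)
    also have "\<dots> = T $$ (0, 0)"
    proof -
      have "T $$ (Suc i, Suc i) = 1" if "i < m" for i
      proof -
        have "T $$ (Suc i, Suc i) = (\<Sum>a<Suc m. N i a * M i a)"
          using that by (subst Tij) (auto simp: W_def V_def intro!: sum.cong)
        with NM[of i i] that show ?thesis by simp
      qed
      then show ?thesis by (subst prod.lessThan_Suc_shift) simp
    qed
    also have "\<dots> = (\<Sum>a<Suc m. if a = b then r a else 0)"
      unfolding Tij[OF zero_less_Suc zero_less_Suc] by (rule sum.cong) (auto simp: W_def V_def)
    also have "\<dots> = r b" using b by simp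
    finally have "det T = r b" .
    moreover have "det T = det (W r) * det (V b)"
      unfolding T_def using det_mult[of "W r" "Suc m" "transpose_mat (V b)"] det_transpose[of "V b" "Suc m"]
      by (simp del: det_transpose)
    ultimately show ?thesis by (simp add: detW c_def)
  qed
qed

section \<open>Cancellation for the affine line\<close>

text \<open>
  \<open>S\<close> plays the role of \<open>K[X\<^sub>0, \<dots>, X\<^sub>m] = Z[\<sigma>\<^sub>1, \<dots>, \<sigma>\<^sub>m]\<close>, and \<open>Z\<close> is shown to be generated by one
  element. On \<open>Z\<close> all the partial derivatives are multiples of the Jacobian derivation
  \<open>D f = det (\<partial>(f, \<sigma>)/\<partial>X)\<close>; since the \<open>E i\<close> are locally nilpotent, \<open>D\<close> maps \<open>Z\<close> to itself, and \<open>D\<close> is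
  locally nilpotent there because some partial derivative is a nonzero multiple of it.
\<close>

lemma one_dimensional_kernel_generated:
  fixes S K :: "'r::{idom, ring_char_0} set"
  assumes S: "subring_set S" and K: "subring_set K" "K \<subseteq> S"
    and K_inverse: "\<And>c. c \<in> K \<Longrightarrow> c \<noteq> 0 \<Longrightarrow> \<exists>c'\<in>K. c * c' = 1"
    and d: "\<And>a. a < Suc m \<Longrightarrow> locally_nilpotent S (d a)"
    and dK: "\<And>a c. a < Suc m \<Longrightarrow> c \<in> K \<Longrightarrow> d a c = 0"
    and d_kernel: "\<And>f. f \<in> S \<Longrightarrow> (\<And>a. a < Suc m \<Longrightarrow> d a f = 0) \<Longrightarrow> f \<in> K"
    and X: "\<And>a. a < Suc m \<Longrightarrow> X a \<in> S"
    and dX: "\<And>a b. a < Suc m \<Longrightarrow> b < Suc m \<Longrightarrow> d a (X b) = (if a = b then 1 else 0)"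
    and chain: "\<And>D f. derivation S D \<Longrightarrow> (\<And>c. c \<in> K \<Longrightarrow> D c = 0) \<Longrightarrow> f \<in> S \<Longrightarrow>
        D f = (\<Sum>a<Suc m. d a f * D (X a))"
    and E: "\<And>i. i < m \<Longrightarrow> locally_nilpotent S (E i)"
    and EK: "\<And>i c. i < m \<Longrightarrow> c \<in> K \<Longrightarrow> E i c = 0"
    and \<sigma>: "\<And>i. i < m \<Longrightarrow> \<sigma> i \<in> S"
    and E\<sigma>: "\<And>i k. i < m \<Longrightarrow> k < m \<Longrightarrow> E i (\<sigma> k) = (if k = i then 1 else 0)"
    and chain_\<sigma>: "\<And>D g. derivation S D \<Longrightarrow> (\<And>f. f \<in> S \<Longrightarrow> (\<And>i. i < m \<Longrightarrow> E i f = 0) \<Longrightarrow> D f = 0) \<Longrightarrow>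
        g \<in> S \<Longrightarrow> D g = (\<Sum>i<m. E i g * D (\<sigma> i))"
  defines "Z \<equiv> {f\<in>S. \<forall>i<m. E i f = 0}"
  obtains w where "w \<in> Z" "\<And>f. f \<in> Z \<Longrightarrow> \<exists>N q. (\<forall>i. q i \<in> K) \<and> f = (\<Sum>i<N. q i * w ^ i)"
proof -
  interpret S: subring_set S by (fact S)
  interpret K: subring_set K by (fact K)
  have der_d: "derivation S (d a)" if "a < Suc m" for a
    using d[OF that] by (simp add: locally_nilpotent_def)
  have der_E: "derivation S (E i)" if "i < m" for i
    using E[OF that] by (simp add: locally_nilpotent_def)
  note d_rules = derivation.d_closed[OF der_d] derivation.d_add[OF der_d] derivation.d_mult[OF der_d]
  note E_rules = derivation.d_closed[OF der_E] derivation.d_add[OF der_E] derivation.d_mult[OF der_E]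
  have ZS: "f \<in> S" if "f \<in> Z" for f using that by (simp add: Z_def)
  have KZ: "K \<subseteq> Z" using K(2) EK by (auto simp: Z_def)
  interpret Z: subring_set Z
  proof
    show "- x \<in> Z" if "x \<in> Z" for x
      using that by (auto simp: Z_def S.uminus derivation.d_uminus[OF der_E])
    show "0 \<in> Z" "1 \<in> Z" using KZ K.zero K.one by blast+
    show "x + y \<in> Z" "x * y \<in> Z" if "x \<in> Z" "y \<in> Z" for x y
      using that by (simp_all add: Z_def S.add S.mult E_rules)
  qed
  have NM: "(\<Sum>a<Suc m. d a (\<sigma> k) * E i (X a)) = (if k = i then 1 else 0)" if "i < m" "k < m" for i k
    using chain[OF der_E[OF that(1)] EK[OF that(1)] \<sigma>[OF that(2)]] E\<sigma>[OF that] by simp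
  obtain g c where g: "\<And>a. g a \<in> S" and c: "\<And>a. c a \<in> S"
    and gc: "\<And>r b. (\<And>i. i < m \<Longrightarrow> (\<Sum>a<Suc m. r a * E i (X a)) = 0) \<Longrightarrow> b < Suc m \<Longrightarrow>
       r b = (\<Sum>a<Suc m. g a * r a) * c b"
    by (rule S.right_inverse_kernel_rank_one[of m "\<lambda>i a. E i (X a)" "\<lambda>k a. d a (\<sigma> k)"])
      (use NM E_rules(1) d_rules(1) X \<sigma> in blast)+
  define D where "D f = (\<Sum>a<Suc m. g a * d a f)" for f
  have d_eq: "d b f = D f * c b" if "f \<in> Z" "b < Suc m" for f b
    unfolding D_def
  proof (rule gc[of "\<lambda>a. d a f"])
    show "(\<Sum>a<Suc m. d a f * E i (X a)) = 0" if "i < m" for i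
      using chain[OF der_E[OF that] EK[OF that], of f] \<open>f \<in> Z\<close> that by (auto simp: Z_def)
  qed (fact that)
  have der_D: "derivation S D"
  proof
    show "D x \<in> S" if "x \<in> S" for x
      unfolding D_def using that by (intro S.sum S.mult g d_rules) auto
    show "D (x + y) = D x + D y" if "x \<in> S" "y \<in> S" for x y
      unfolding D_def sum.distrib[symmetric] using that
      by (intro sum.cong refl) (simp add: d_rules distrib_left)
    show "D (x * y) = x * D y + D x * y" if "x \<in> S" "y \<in> S" for x y
      unfolding D_def sum_distrib_left sum_distrib_right sum.distrib[symmetric] using that
      by (intro sum.cong refl) (simp add: d_rules algebra_simps)
  qed
  interpret D: derivation S D by (fact der_D)
  have DK: "D x = 0" if "x \<in> K" for x
    unfolding D_def using that by (intro sum.neutral) (simp add: dK)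
  have DZ: "D f \<in> Z" if f: "f \<in> Z" for f
  proof -
    have "E i (D f) = 0" if i: "i < m" for i
    proof -
      interpret E: locally_nilpotent S "E i" by (rule E[OF i])
      define F where "F x = E i (D x) - D (E i x)" for x
      have der_F: "derivation S F"
      proof
        show "F x \<in> S" if "x \<in> S" for x
          unfolding F_def using that by (intro S.diff E.d_closed D.d_closed)
        show "F (x + y) = F x + F y" if "x \<in> S" "y \<in> S" for x y
          using that by (simp add: F_def E.d_add D.d_add E.d_closed D.d_closed)
        show "F (x * y) = x * F y + F x * y" if "x \<in> S" "y \<in> S" for x y
          using that by (simp add: F_def E.d_add D.d_add E.d_mult D.d_mult E.d_closed D.d_closed S.mult algebra_simps)
      qed
      have FK: "F x = 0" if "x \<in> K" for x
        using that i by (simp add: F_def DK EK E.d_zero D.d_zero)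
      have "E i (D f) = F f"
        using f i by (simp add: F_def Z_def D.d_zero)
      also have "\<dots> = (\<Sum>a<Suc m. d a f * F (X a))"
        by (rule chain[OF der_F FK ZS[OF f]])
      also have "\<dots> = (\<Sum>a<Suc m. c a * F (X a)) * D f"
        unfolding sum_distrib_right by (intro sum.cong refl) (simp add: d_eq[OF f])
      finally show ?thesis
        using f by (intro E.eigenvector_in_kernel[of _ "\<Sum>a<Suc m. c a * F (X a)"] S.sum S.mult c
            derivation.d_closed[OF der_F] X D.d_closed ZS) auto
    qed
    with f show ?thesis by (auto simp: Z_def D.d_closed)
  qed
  have D_kernel: "f \<in> K" if "f \<in> Z" "D f = 0" for f
    using that by (intro d_kernel ZS) (simp_all add: d_eq)
  obtain f0 b where f0: "f0 \<in> Z" and b: "b < Suc m" and nz: "d b f0 \<noteq> 0"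
  proof (rule ccontr)
    assume "\<not> thesis"
    with that have 0: "d b f = 0" if "f \<in> Z" "b < Suc m" for f b
      using \<open>f \<in> Z\<close> \<open>b < Suc m\<close> by blast
    define P where "P a j = (if j < m then E j (X a) else 0)" for a j
    define Q where "Q j b = (if j < m then d b (\<sigma> j) else 0)" for j b
    have "(\<Sum>j<Suc m. P a j * Q j b) = (if a = b then 1 else 0)" if "a < Suc m" "b < Suc m" for a b
    proof -
      have "d b (X a) = (\<Sum>i<m. E i (X a) * d b (\<sigma> i))"
        by (rule chain_\<sigma>[OF der_d[OF that(2)]]) (use that 0 X in \<open>auto simp: Z_def\<close>)
      also have "\<dots> = (\<Sum>j<Suc m. P a j * Q j b)" by (simp add: P_def Q_def)
      finally show ?thesis using dX[OF that(2,1)] by auto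
    qed
    then have "(if m = m then 1 else 0 :: 'r) = 0"
      by (rule right_inverse_kernel[where v = "\<lambda>j. if j = m then 1 else 0" and N = "Suc m"])
        (auto simp: P_def)
    then show False by simp
  qed
  interpret db: locally_nilpotent S "d b" by (rule d[OF b])
  have cb: "c b \<noteq> 0" and Df0: "D f0 \<noteq> 0"
    using nz d_eq[OF f0 b] by auto
  have ord_D: "db.ord (D f) < db.ord f" if f: "f \<in> Z" "D f \<noteq> 0" for f
  proof -
    have "db.ord (D f) + db.ord (c b) \<le> Suc (db.ord (d b f))"
      using db.ord_mult[of "D f" "c b"] f cb c by (simp add: d_eq[OF f(1) b] D.d_closed ZS)
    moreover have "db.ord (d b f) < db.ord f"
      using db.ord_derivative[of f] f cb by (simp add: d_eq[OF f(1) b] ZS)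
    moreover have "db.ord (c b) > 0" using db.ord_pos cb c by simp
    ultimately show ?thesis by linarith
  qed
  obtain w where w: "w \<in> Z" "D w \<noteq> 0" and w_min: "\<And>f. f \<in> Z \<Longrightarrow> D f \<noteq> 0 \<Longrightarrow> db.ord w \<le> db.ord f"
    using ex_has_least_nat[of "\<lambda>f. f \<in> Z \<and> D f \<noteq> 0" f0 db.ord] f0 Df0 by blast
  have "D (D w) = 0"
    using w_min[of "D w"] ord_D[OF w] DZ[OF w(1)] by linarith
  then have DwK: "D w \<in> K" using D_kernel DZ w by blast
  then obtain \<kappa> where \<kappa>: "\<kappa> \<in> K" "D w * \<kappa> = 1" using K_inverse w by blast
  have "\<exists>c'\<in>K. of_nat (Suc i) * c' = 1" for i
    using K_inverse[OF K.of_nat, of "Suc i"] by (simp del: of_nat_Suc)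
  then obtain iv where iv: "\<And>i. iv i \<in> K" "\<And>i. of_nat (Suc i) * iv i = 1" by metis
  have "\<exists>N q. (\<forall>i. q i \<in> K) \<and> f = (\<Sum>i<N. q i * w ^ i)" if "f \<in> Z" for f
    using that
  proof (induction "db.ord f" arbitrary: f rule: less_induct)
    case less
    show ?case
    proof (cases "D f = 0")
      case True
      then show ?thesis
        using D_kernel less.prems by (intro exI[of _ 1] exI[of _ "\<lambda>_. f"]) simp
    next
      case False
      with less obtain N q where q: "\<And>i. q i \<in> K" and Df: "D f = (\<Sum>i<N. q i * w ^ i)"
        using ord_D[OF less.prems] DZ[OF less.prems] by metis
      define h where "h = (\<Sum>i<N. iv i * \<kappa> * q i * w ^ Suc i)"
      have cK: "iv i * \<kappa> * q i \<in> K" for i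
        by (intro K.mult iv \<kappa> q)
      have hZ: "h \<in> Z"
        unfolding h_def using cK w KZ by (intro Z.sum Z.mult[OF _ Z.power]) blast+
      have "D h = (\<Sum>i<N. D (iv i * \<kappa> * q i * w ^ Suc i))"
        unfolding h_def using cK w KZ ZS by (intro D.d_sum S.mult[OF _ S.power]) blast+
      also have "\<dots> = (\<Sum>i<N. q i * w ^ i)"
      proof (intro sum.cong refl)
        fix i
        have "D (iv i * \<kappa> * q i * w ^ Suc i) = iv i * \<kappa> * q i * D (w ^ Suc i)"
          using cK[of i] w KZ ZS DK by (subst D.d_mult) (auto intro: S.mult S.power)
        also have "\<dots> = (of_nat (Suc i) * iv i) * (D w * \<kappa>) * (q i * w ^ i)"
          using w ZS by (simp add: D.d_power mult_ac del: of_nat_Suc power_Suc)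
        finally show "D (iv i * \<kappa> * q i * w ^ Suc i) = q i * w ^ i" by (simp add: iv \<kappa> del: of_nat_Suc)
      qed
      finally have "D (f - h) = 0" using Df less.prems hZ ZS by (simp add: D.d_diff)
      then have fh: "f - h \<in> K" using D_kernel Z.diff[OF less.prems hZ] by blast
      have "f = (\<Sum>i<Suc N. (case i of 0 \<Rightarrow> f - h | Suc i \<Rightarrow> iv i * \<kappa> * q i) * w ^ i)"
        by (subst sum.lessThan_Suc_shift) (simp add: h_def)
      moreover have "(case i of 0 \<Rightarrow> f - h | Suc i \<Rightarrow> iv i * \<kappa> * q i) \<in> K" for i
        using fh cK by (auto split: nat.split)
      ultimately show ?thesis by blast
    qed
  qed
  with w show ?thesis using that by blast
qed

section \<open>Homogeneous components and the Euler derivation\<close>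

lemma pvar_mult_pderiv_var:
  "pvar c * pderiv_var i p =
    (\<Sum>m\<in>keys p. single (single c 1 + (m - single i 1)) (of_nat (lookup m i) * lookup p m))"
  by (simp add: pderiv_var_def pvar_def sum_distrib_left mult_single)

lemma lookup_euler: "lookup (pvar i * pderiv_var i p) m = of_nat (lookup m i) * lookup p m"
proof -
  have *: "single i 1 + (m' - single i 1) = m'" if "lookup m' i \<noteq> 0" for m' :: "nat \<Rightarrow>\<^sub>0 nat"
    using that by (intro poly_mapping_eqI) (auto simp: lookup_add lookup_minus lookup_single when_def)
  have "pvar i * pderiv_var i p = (\<Sum>m'\<in>keys p. single m' (of_nat (lookup m' i) * lookup p m'))"
    unfolding pvar_mult_pderiv_var
  proof (rule sum.cong)
    fix m' show "single (single i 1 + (m' - single i 1)) (of_nat (lookup m' i) * lookup p m') =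
      single m' (of_nat (lookup m' i) * lookup p m')"
    proof (cases "lookup m' i = 0")
      case False
      show ?thesis by (simp only: *[OF False])
    qed simp
  qed simp
  then show ?thesis
    by (auto simp: lookup_sum lookup_single when_def in_keys_iff)
qed

lemma single_sum: "single m (sum f I) = (\<Sum>i\<in>I. single m (f i))"
  by (induction I rule: infinite_finite_induct) (auto simp: single_add)

definition weight :: "nat \<Rightarrow> (nat \<Rightarrow>\<^sub>0 nat) \<Rightarrow> nat" where
  "weight n m = (\<Sum>i<n. lookup m i)"

definition homog_comp :: "nat \<Rightarrow> nat \<Rightarrow> 'a::comm_ring_1 mpol \<Rightarrow> 'a mpol" where
  "homog_comp n j p = (\<Sum>m\<in>keys p. if weight n m = j then single m (lookup p m) else 0)"

definition euler :: "nat \<Rightarrow> 'a::comm_ring_1 mpol \<Rightarrow> 'a mpol" where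
  "euler n p = (\<Sum>i<n. pvar i * pderiv_var i p)"

lemma lookup_homog_comp: "lookup (homog_comp n j p) m = (if weight n m = j then lookup p m else 0)"
proof -
  have "lookup (homog_comp n j p) m =
      (\<Sum>m'\<in>keys p. if m' = m then (if weight n m = j then lookup p m else 0) else 0)"
    unfolding homog_comp_def lookup_sum by (intro sum.cong) (auto simp: lookup_single when_def)
  then show ?thesis by (auto simp: in_keys_iff)
qed

lemma homog_comp_0 [simp]: "homog_comp n j 0 = 0"
  by (simp add: homog_comp_def)

lemma homog_comp_add: "homog_comp n j (p + q) = homog_comp n j p + homog_comp n j q"
  by (rule poly_mapping_eqI) (simp add: lookup_homog_comp lookup_add)

lemma homog_comp_sum: "homog_comp n j (sum f I) = (\<Sum>i\<in>I. homog_comp n j (f i))"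
  by (induction I rule: infinite_finite_induct) (auto simp: homog_comp_add)

lemma homog_comp_pconst_mult: "homog_comp n j (pconst c * p) = pconst c * homog_comp n j p"
  by (rule poly_mapping_eqI) (simp add: lookup_homog_comp lookup_pconst_mult)

lemma homog_comp_single: "homog_comp n j (single m c) = (if weight n m = j then single m c else 0)"
  by (rule poly_mapping_eqI) (auto simp: lookup_homog_comp lookup_single when_def)

lemma homog_comp_mpols: "p \<in> mpols C n \<Longrightarrow> 0 \<in> C \<Longrightarrow> homog_comp n j p \<in> mpols C n"
  by (auto simp: mpols_def lookup_homog_comp in_keys_iff split: if_splits)

lemma euler_homog_comp: "euler n (homog_comp n j p) = of_nat j * homog_comp n j p"
proof (rule poly_mapping_eqI)
  fix m
  have "lookup (euler n (homog_comp n j p)) m = of_nat (weight n m) * lookup (homog_comp n j p) m"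
    by (simp add: euler_def lookup_sum lookup_euler weight_def sum_distrib_right)
  also have "\<dots> = of_nat j * lookup (homog_comp n j p) m"
    by (simp add: lookup_homog_comp)
  finally show "lookup (euler n (homog_comp n j p)) m = lookup (of_nat j * homog_comp n j p) m"
    by (simp add: lookup_pconst_mult flip: pconst_of_nat)
qed

lemma sum_homog_comps:
  obtains N where "p = (\<Sum>j<N. homog_comp n j p)"
proof
  define N where "N = Suc (\<Sum>m\<in>keys p. weight n m)"
  show "p = (\<Sum>j<N. homog_comp n j p)"
  proof (rule poly_mapping_eqI)
    fix m
    have "weight n m < N" if "lookup p m \<noteq> 0"
      unfolding N_def less_Suc_eq_le using that by (intro member_le_sum) (auto simp: in_keys_iff)
    then show "lookup p m = lookup (\<Sum>j<N. homog_comp n j p) m"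
      by (auto simp: lookup_sum lookup_homog_comp)
  qed
qed

lemma homog_comp_pvar_mult_pderiv_var:
  assumes "i < n" "c < n"
  shows "homog_comp n j (pvar c * pderiv_var i p) = pvar c * pderiv_var i (homog_comp n j p)"
proof -
  have w: "weight n (single c 1 + (m - single i 1)) = weight n m" if "lookup m i \<noteq> 0" for m
  proof -
    have "single c 1 + (m - single i 1) + single i 1 = m + single c 1"
      using that by (intro poly_mapping_eqI) (auto simp: lookup_add lookup_minus lookup_single when_def)
    then have "weight n (single c 1 + (m - single i 1) + single i 1) = weight n (m + single c 1)" by simp
    then show ?thesis
      using assms by (simp add: weight_def lookup_add sum.distrib lookup_single when_def)
  qed
  have s: "homog_comp n j (pvar c * pderiv_var i (single m a)) = pvar c * pderiv_var i (homog_comp n j (single m a))"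
    for m and a :: 'a
  proof (cases "lookup m i = 0")
    case False
    then show ?thesis
      by (simp add: pderiv_var_single pvar_def mult_single homog_comp_single w[unfolded One_nat_def])
  qed (simp add: pderiv_var_single homog_comp_single)
  have "homog_comp n j (pvar c * pderiv_var i (\<Sum>m\<in>keys p. single m (lookup p m))) =
      pvar c * pderiv_var i (homog_comp n j (\<Sum>m\<in>keys p. single m (lookup p m)))"
    by (simp only: pderiv_var_sum sum_distrib_left homog_comp_sum s)
  then show ?thesis by (simp only: sum_monomials)
qed

lemma lookup_mult_max:
  fixes p q :: "'a::comm_ring_1 mpol"
  assumes "\<And>m. m \<in> keys p \<Longrightarrow> m \<le> M" "\<And>m. m \<in> keys q \<Longrightarrow> m \<le> M'"
  shows "lookup (p * q) (M + M') = lookup p M * lookup q M'"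
proof -
  have *: "m + m' = M + M' \<longleftrightarrow> m = M \<and> m' = M'" if "m \<in> keys p" "m' \<in> keys q" for m m'
    using assms(1)[OF that(1)] assms(2)[OF that(2)]
    by (metis add_le_less_mono add_less_le_mono order_le_less order_less_irrefl)
  have "lookup (p * q) (M + M') = (\<Sum>m\<in>keys p. \<Sum>m'\<in>keys q.
      if m = M then if m' = M' then lookup p M * lookup q M' else 0 else 0)"
    unfolding sum_monomials_mult[of p q] lookup_sum
    by (intro sum.cong refl) (auto simp: lookup_single when_def *)
  also have "\<dots> = (\<Sum>m\<in>keys p. if m = M then (\<Sum>m'\<in>keys q. if m' = M' then lookup p M * lookup q M' else 0) else 0)"
    by (intro sum.cong) auto
  also have "\<dots> = lookup p M * lookup q M'"
    by (auto simp: in_keys_iff)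
  finally show ?thesis .
qed

text \<open>Compare the leading monomials of \<open>f\<close> and of \<open>g - c f\<close>, with \<open>c\<close> chosen to kill the former.\<close>
lemma proportional_if_equal_log_derivatives:
  fixes f g :: "'k::field_char_0 mpol"
  assumes f: "f \<in> mpols UNIV n" "f \<noteq> 0" and g: "g \<in> mpols UNIV n"
    and eq: "\<And>i. i < n \<Longrightarrow> g * pderiv_var i f = f * pderiv_var i g"
  obtains c where "g = pconst c * f"
proof -
  interpret U: subring_set "UNIV :: 'k set" by (rule subring_set_UNIV)
  interpret R: subring_set "mpols UNIV n :: 'k mpol set" by (rule U.mpols_subring)
  define M where "M = Max (keys f)"
  have keys_f: "keys f \<noteq> {}" using f by simp
  then have M: "M \<in> keys f" and M_max: "\<And>m. m \<in> keys f \<Longrightarrow> m \<le> M"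
    by (simp_all add: M_def)
  define h where "h = g - pconst (lookup g M / lookup f M) * f"
  have hM: "lookup h M = 0"
    using M by (simp add: h_def lookup_minus lookup_pconst_mult in_keys_iff)
  have hR: "h \<in> mpols UNIV n"
    unfolding h_def by (intro R.diff g R.mult U.pconst_mpols f UNIV_I)
  have h: "h * pderiv_var i f = f * pderiv_var i h" if "i < n" for i
    unfolding h_def diff_conv_add_uminus pderiv_var_add pderiv_var_uminus pderiv_var_pconst_mult
    using eq[OF that] by (simp add: algebra_simps)
  have "h = 0"
  proof (rule ccontr)
    assume "h \<noteq> 0"
    define M' where "M' = Max (keys h)"
    have "keys h \<noteq> {}" using \<open>h \<noteq> 0\<close> by simp
    then have M': "M' \<in> keys h" and M'_max: "\<And>m. m \<in> keys h \<Longrightarrow> m \<le> M'"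
      by (simp_all add: M'_def)
    have "lookup M i = lookup M' i" for i
    proof (cases "i < n")
      case True
      have keys_sub: "keys (pvar i * pderiv_var i p) \<subseteq> keys p" for p :: "'k mpol"
        by (auto simp: in_keys_iff lookup_euler)
      have "h * (pvar i * pderiv_var i f) = pvar i * (h * pderiv_var i f)" by (simp add: ac_simps)
      also have "\<dots> = f * (pvar i * pderiv_var i h)" by (simp only: h[OF True] ac_simps)
      finally have "lookup (h * (pvar i * pderiv_var i f)) (M' + M) = lookup (f * (pvar i * pderiv_var i h)) (M + M')"
        by (simp only: add.commute)
      moreover have "lookup (h * (pvar i * pderiv_var i f)) (M' + M) = lookup h M' * lookup (pvar i * pderiv_var i f) M"
        by (rule lookup_mult_max) (use M_max M'_max keys_sub in blast)+
      moreover have "lookup (f * (pvar i * pderiv_var i h)) (M + M') = lookup f M * lookup (pvar i * pderiv_var i h) M'"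
        by (rule lookup_mult_max) (use M_max M'_max keys_sub in blast)+
      ultimately have "lookup h M' * (of_nat (lookup M i) * lookup f M) = lookup f M * (of_nat (lookup M' i) * lookup h M')"
        by (simp only: lookup_euler)
      then show ?thesis using M M' by (simp add: in_keys_iff)
    next
      case False
      with M M' f(1) hR have "i \<notin> keys M" "i \<notin> keys M'" by (auto simp: mpols_def)
      then show ?thesis by (simp add: in_keys_iff)
    qed
    then have "M = M'" by (rule poly_mapping_eqI)
    with hM M' show False by (simp add: in_keys_iff)
  qed
  then show thesis using that unfolding h_def by simp
qed

lemma nonzero_coefficients_of_inner_product:
  fixes x y :: "nat \<Rightarrow> 'a::comm_ring_1 mpol"
  assumes "(\<Sum>a<n. x a * y a) \<noteq> 0"
  obtains \<beta> \<gamma> where "(\<Sum>a<n. lookup (x a) \<beta> * lookup (y a) \<gamma>) \<noteq> 0"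
proof (rule ccontr)
  assume "\<not> thesis"
  with that have 0: "(\<Sum>a<n. lookup (x a) \<beta> * lookup (y a) \<gamma>) = 0" for \<beta> \<gamma> by blast
  define F where "F = (\<Union>a<n. keys (x a) \<union> keys (y a))"
  have F: "finite F" by (simp add: F_def)
  have "x a * y a = (\<Sum>\<beta>\<in>F. \<Sum>\<gamma>\<in>F. single (\<beta> + \<gamma>) (lookup (x a) \<beta> * lookup (y a) \<gamma>))" if "a < n" for a
  proof -
    have "x a = (\<Sum>\<beta>\<in>F. single \<beta> (lookup (x a) \<beta>))" "y a = (\<Sum>\<beta>\<in>F. single \<beta> (lookup (y a) \<beta>))"
      using that F by (subst sum_monomials[symmetric], intro sum.mono_neutral_left,
          auto simp: F_def in_keys_iff)+
    then have "x a * y a = (\<Sum>\<beta>\<in>F. single \<beta> (lookup (x a) \<beta>)) * (\<Sum>\<beta>\<in>F. single \<beta> (lookup (y a) \<beta>))"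
      by simp
    then show ?thesis by (simp add: sum_product mult_single)
  qed
  then have "(\<Sum>a<n. x a * y a) =
      (\<Sum>a<n. \<Sum>\<beta>\<in>F. \<Sum>\<gamma>\<in>F. single (\<beta> + \<gamma>) (lookup (x a) \<beta> * lookup (y a) \<gamma>))"
    by simp
  also have "\<dots> = (\<Sum>\<beta>\<in>F. \<Sum>\<gamma>\<in>F. single (\<beta> + \<gamma>) (\<Sum>a<n. lookup (x a) \<beta> * lookup (y a) \<gamma>))"
    unfolding single_sum by (subst sum.swap, intro sum.cong refl, rule sum.swap)
  finally show False using assms by (simp add: 0)
qed

section \<open>Linear Poisson brackets in at most three variables\<close>

locale linear_bracket =
  fixes n :: nat and C :: "nat \<Rightarrow> nat \<Rightarrow> nat \<Rightarrow> 'k::field_char_0"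
  assumes alternating: "C a b c = - C b a c"
    and n_le_3: "n \<le> 3"
    and nonabelian: "\<exists>a<n. \<exists>b<n. \<exists>c<n. C a b c \<noteq> 0"
begin

definition \<pi> :: "nat \<Rightarrow> nat \<Rightarrow> 'k mpol" where
  "\<pi> a b = (\<Sum>c<n. pconst (C a b c) * pvar c)"

definition br :: "'k mpol \<Rightarrow> 'k mpol \<Rightarrow> 'k mpol" where
  "br p q = (\<Sum>i<n. \<Sum>j<n. pderiv_var i p * pderiv_var j q * \<pi> i j)"

definition hamilton :: "nat \<Rightarrow> 'k mpol \<Rightarrow> 'k mpol" where
  "hamilton b p = (\<Sum>a<n. pderiv_var a p * \<pi> a b)"

definition casimirs :: "'k mpol set" where
  "casimirs = {p \<in> mpols UNIV n. \<forall>b<n. hamilton b p = 0}"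

sublocale U: subring_set "UNIV :: 'k set" by (rule subring_set_UNIV)

sublocale A: subring_set "mpols UNIV n :: 'k mpol set" by (rule U.mpols_subring)

lemma \<pi>_alternating: "\<pi> a b = - \<pi> b a"
proof -
  have "pconst (C a b c) = - pconst (C b a c)" for c
    by (subst alternating) (simp add: pconst_uminus)
  then show ?thesis by (simp add: \<pi>_def sum_negf)
qed

lemma \<pi>_self: "\<pi> a a = 0"
proof -
  have "C a a c = 0" for c using alternating[of a a c] by simp
  then show ?thesis by (simp add: \<pi>_def)
qed

lemma \<pi>_mpols: "\<pi> a b \<in> mpols UNIV n"
  unfolding \<pi>_def by (intro A.sum A.mult U.pconst_mpols U.pvar_mpols) auto

lemma pderiv_\<pi>: "c < n \<Longrightarrow> pderiv_var c (\<pi> a b) = pconst (C a b c)"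
  unfolding \<pi>_def pderiv_var_sum pderiv_var_pconst_mult pderiv_var_pvar
  by (simp add: if_distrib[of "\<lambda>x. _ * x"] cong: if_cong)

lemma \<pi>_nonzero: obtains a b where "a < n" "b < n" "a \<noteq> b" "\<pi> a b \<noteq> 0"
proof -
  from nonabelian obtain a b c where abc: "a < n" "b < n" "c < n" "C a b c \<noteq> 0" by blast
  then have "\<pi> a b \<noteq> 0" using pderiv_\<pi>[of c a b] by auto
  moreover from this have "a \<noteq> b" using \<pi>_self by auto
  ultimately show thesis using abc that by blast
qed

lemma br_alt: "br p q = (\<Sum>j<n. pderiv_var j q * hamilton j p)"
  unfolding br_def hamilton_def sum_distrib_left
  by (subst sum.swap) (simp add: ac_simps)

lemma br_pvar: "b < n \<Longrightarrow> br p (pvar b) = hamilton b p"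
  unfolding br_alt pderiv_var_pvar by (simp add: if_distrib[of "\<lambda>x. x * _"] cong: if_cong)

lemma br_pvar_pvar: "a < n \<Longrightarrow> b < n \<Longrightarrow> br (pvar a) (pvar b) = \<pi> a b"
  unfolding br_pvar hamilton_def pderiv_var_pvar by (simp add: if_distrib[of "\<lambda>x. x * _"] cong: if_cong)

lemma br_0 [simp]: "br 0 p = 0" "br p 0 = 0"
  by (simp_all add: br_def)

lemma br_closed: "p \<in> mpols UNIV n \<Longrightarrow> q \<in> mpols UNIV n \<Longrightarrow> br p q \<in> mpols UNIV n"
  unfolding br_def by (intro A.sum A.mult U.pderiv_var_mpols \<pi>_mpols)

lemma lookup_br_0: "lookup (br p q) 0 = 0"
proof -
  have z: "lookup (r * pvar c) 0 = 0" for r :: "'k mpol" and c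
  proof -
    have "r * pvar c = (\<Sum>m\<in>keys r. single (m + single c 1) (lookup r m))"
      by (subst sum_monomials[of r, symmetric]) (simp add: pvar_def sum_distrib_right mult_single)
    moreover have "m + single c 1 \<noteq> 0" for m :: "nat \<Rightarrow>\<^sub>0 nat"
      by (auto simp: poly_mapping_eq_iff fun_eq_iff lookup_add lookup_single when_def)
    ultimately show ?thesis by (simp add: lookup_sum lookup_single when_def)
  qed
  show ?thesis
    unfolding br_def \<pi>_def sum_distrib_left lookup_sum mult.assoc[symmetric] by (simp add: z)
qed

lemma casimirs_iff: "p \<in> mpols UNIV n \<Longrightarrow> p \<in> casimirs \<longleftrightarrow> (\<forall>q\<in>mpols UNIV n. br p q = 0)"
  using br_pvar U.pvar_mpols by (auto simp: casimirs_def br_alt) metis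

lemma hamilton_add: "hamilton b (p + q) = hamilton b p + hamilton b q"
  by (simp add: hamilton_def pderiv_var_add distrib_right sum.distrib)

lemma hamilton_mult: "hamilton b (p * q) = p * hamilton b q + hamilton b p * q"
  by (simp add: hamilton_def pderiv_var_mult algebra_simps sum.distrib sum_distrib_left)

lemma hamilton_pconst [simp]: "hamilton b (pconst c) = 0"
  by (simp add: hamilton_def)

sublocale Z: subring_set casimirs
proof
  show "0 \<in> casimirs" "1 \<in> casimirs"
    using hamilton_pconst[of _ 0] hamilton_pconst[of _ 1] by (auto simp: casimirs_def A.zero A.one)
  show "- x \<in> casimirs" if "x \<in> casimirs" for x
    using that by (auto simp: casimirs_def A.uminus hamilton_def pderiv_var_uminus sum_negf)
qed (auto simp: casimirs_def A.add A.mult hamilton_add hamilton_mult)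

lemma pconst_casimirs: "pconst c \<in> casimirs"
  by (simp add: casimirs_def U.pconst_mpols)

lemma casimirs_mpols: "p \<in> casimirs \<Longrightarrow> p \<in> mpols UNIV n"
  by (simp add: casimirs_def)

text \<open>The structure matrix has rank at least two, so its kernel has rank at most one.\<close>
lemma casimirs_parallel_gradients:
  assumes p: "p \<in> casimirs" and q: "q \<in> casimirs" and ij: "i < n" "j < n"
  shows "pderiv_var i p * pderiv_var j q = pderiv_var j p * pderiv_var i q"
proof -
  obtain a b where ab: "a < n" "b < n" "a \<noteq> b" and nz: "\<pi> a b \<noteq> 0" by (rule \<pi>_nonzero)
  have "\<exists>c w. \<forall>r\<in>casimirs. \<forall>i<n. \<pi> a b * pderiv_var i r = pderiv_var c r * w i"
  proof (cases "n = 3")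
    case True
    then obtain c where c: "{..<n} = {a, b, c}" "c \<noteq> a" "c \<noteq> b"
    proof -
      have "card ({..<n} - {a, b}) = 1" using ab True by (simp add: card_Diff_subset)
      then obtain c where "{..<n} - {a, b} = {c}" by (auto simp: card_1_singleton_iff)
      then show thesis using ab by (intro that[of c]) auto
    qed
    define w where "w i = (if i = a then \<pi> b c else if i = b then \<pi> c a else \<pi> a b)" for i
    have "\<pi> a b * pderiv_var i r = pderiv_var c r * w i" if r: "r \<in> casimirs" and "i < n" for r i
    proof -
      have "hamilton b r = 0" "hamilton a r = 0" using r ab by (auto simp: casimirs_def)
      then have "pderiv_var a r * \<pi> a b + pderiv_var c r * \<pi> c b = 0"
        "pderiv_var b r * \<pi> b a + pderiv_var c r * \<pi> c a = 0"
        unfolding hamilton_def c(1) using ab c by (simp_all add: \<pi>_self)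
      then show ?thesis
        using \<open>i < n\<close> c \<pi>_alternating[of b a] \<pi>_alternating[of c b]
        by (auto simp: w_def algebra_simps add_eq_0_iff lessThan_iff[symmetric] simp del: lessThan_iff)
    qed
    then show ?thesis by blast
  next
    case False
    then have n: "{..<n} = {a, b}"
      using n_le_3 ab by auto
    have "pderiv_var i r = 0" if r: "r \<in> casimirs" and "i < n" for r i
    proof -
      have "hamilton b r = 0" "hamilton a r = 0" using r ab by (auto simp: casimirs_def)
      then have "pderiv_var a r = 0" "pderiv_var b r = 0"
        using ab nz \<pi>_alternating[of a b] unfolding hamilton_def n by (auto simp: \<pi>_self)
      moreover have "i = a \<or> i = b" using \<open>i < n\<close> n by auto
      ultimately show ?thesis by auto
    qed
    then show ?thesis by auto
  qed
  then obtain c w where w: "\<And>r i. r \<in> casimirs \<Longrightarrow> i < n \<Longrightarrow> \<pi> a b * pderiv_var i r = pderiv_var c r * w i"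
    by blast
  have "(\<pi> a b * pderiv_var i p) * (\<pi> a b * pderiv_var j q) = (\<pi> a b * pderiv_var j p) * (\<pi> a b * pderiv_var i q)"
    unfolding w[OF p ij(1)] w[OF q ij(2)] w[OF p ij(2)] w[OF q ij(1)] by (simp only: ac_simps)
  then have "(\<pi> a b * \<pi> a b) * (pderiv_var i p * pderiv_var j q) = (\<pi> a b * \<pi> a b) * (pderiv_var j p * pderiv_var i q)"
    by (simp only: ac_simps)
  then show ?thesis using nz by (metis mult_left_cancel mult_eq_0_iff)
qed

lemma homogeneous_casimirs_proportional:
  assumes p: "p \<in> casimirs" "euler n p = of_nat d * p" and q: "q \<in> casimirs" "euler n q = of_nat d * q"
    and "d > 0" "p \<noteq> 0"
  obtains c where "q = pconst c * p"
proof (rule proportional_if_equal_log_derivatives[of p n q])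
  show "q * pderiv_var i p = p * pderiv_var i q" if i: "i < n" for i
  proof -
    have "of_nat d * (q * pderiv_var i p) = euler n q * pderiv_var i p"
      by (simp add: q)
    also have "\<dots> = (\<Sum>j<n. pvar j * (pderiv_var j q * pderiv_var i p))"
      by (simp add: euler_def sum_distrib_left sum_distrib_right ac_simps)
    also have "\<dots> = (\<Sum>j<n. pvar j * (pderiv_var j p * pderiv_var i q))"
      using casimirs_parallel_gradients[OF p(1) q(1) i] by (simp add: ac_simps)
    also have "\<dots> = euler n p * pderiv_var i q"
      by (simp add: euler_def sum_distrib_left sum_distrib_right ac_simps)
    also have "\<dots> = of_nat d * (p * pderiv_var i q)"
      by (simp add: p)
    finally show ?thesis using \<open>d > 0\<close> by simp
  qed
qed (use assms in \<open>auto simp: casimirs_def\<close>)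

lemma homog_comp_casimirs:
  assumes "p \<in> casimirs"
  shows "homog_comp n j p \<in> casimirs"
proof -
  have h: "hamilton b r = (\<Sum>a<n. \<Sum>c<n. pconst (C a b c) * (pvar c * pderiv_var a r))" for b r
    by (simp add: hamilton_def \<pi>_def sum_distrib_left ac_simps)
  have "hamilton b (homog_comp n j p) = homog_comp n j (hamilton b p)" for b
    unfolding h homog_comp_sum homog_comp_pconst_mult
    by (intro sum.cong refl) (simp add: homog_comp_pvar_mult_pderiv_var)
  then show ?thesis
    using assms by (auto simp: casimirs_def homog_comp_mpols)
qed

lemma euler_mult: "euler n (p * q) = p * euler n q + euler n p * q"
  by (simp add: euler_def pderiv_var_mult algebra_simps sum.distrib sum_distrib_left)

lemma euler_power:
  fixes p :: "'k mpol"
  assumes "euler n p = of_nat d * p"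
  shows "euler n (p ^ k) = of_nat (k * d) * p ^ k"
proof (induction k)
  case 0
  have "pderiv_var i (1 :: 'k mpol) = 0" for i
    using pderiv_var_pconst[of i 1] by (simp del: pderiv_var_pconst)
  then show ?case by (simp add: euler_def)
qed (simp add: euler_mult assms algebra_simps)

lemma homogeneous_casimir_powers:
  assumes p: "p \<in> casimirs" "euler n p = of_nat d * p" and q: "q \<in> casimirs" "euler n q = of_nat e * q"
    and "d > 0" "e > 0" "p \<noteq> 0"
  obtains c where "q ^ d = pconst c * p ^ e"
proof (rule homogeneous_casimirs_proportional[of "p ^ e" "e * d" "q ^ d"])
  show "euler n (q ^ d) = of_nat (e * d) * q ^ d"
    using euler_power[OF q(2), of d] by (simp add: mult.commute)
qed (use assms euler_power[OF p(2), of e] in \<open>auto intro: Z.power\<close>)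

lemma nonconstant_casimir_homogeneous:
  assumes p: "p \<in> casimirs" "p \<noteq> pconst (lookup p 0)"
  obtains f d where "f \<in> casimirs" "f \<noteq> 0" "d > 0" "euler n f = of_nat d * f"
proof -
  obtain m where m: "m \<noteq> 0" "lookup p m \<noteq> 0"
    using p(2) by (metis lookup_pconst poly_mapping_eqI)
  obtain i where i: "lookup m i \<noteq> 0" using m(1) by (metis poly_mapping_eqI lookup_zero)
  moreover have "i < n"
    using i m(2) casimirs_mpols[OF p(1)] by (auto simp: mpols_def in_keys_iff subset_iff)
  ultimately have "weight n m > 0" unfolding weight_def by (auto intro: sum_pos2)
  moreover have "homog_comp n (weight n m) p \<noteq> 0"
    using m(2) by (metis lookup_homog_comp lookup_zero)
  ultimately show thesis
    using that homog_comp_casimirs[OF p(1)] euler_homog_comp by blast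
qed

definition central_summand :: "(nat \<Rightarrow> 'k) \<Rightarrow> (nat \<Rightarrow> 'k) \<Rightarrow> bool" where
  "central_summand v l \<longleftrightarrow> (\<forall>b<n. \<forall>c<n. (\<Sum>a<n. v a * C a b c) = 0) \<and>
     (\<forall>a<n. \<forall>b<n. (\<Sum>c<n. C a b c * l c) = 0) \<and> (\<Sum>a<n. v a * l a) = 1"

text \<open>
  A character not vanishing at a homogeneous casimir \<open>f\<close> yields a central element, the differential
  of \<open>f\<close> there, which is not in the derived algebra.
\<close>
lemma character_nonzero_imp_central_summand:
  fixes \<eta> :: "'k mpol \<Rightarrow> 'k mpol mpol"
  assumes f: "f \<in> casimirs" "d > 0" "euler n f = of_nat d * f"
    and \<eta>_add: "\<And>p q. p \<in> mpols UNIV n \<Longrightarrow> q \<in> mpols UNIV n \<Longrightarrow> \<eta> (p + q) = \<eta> p + \<eta> q"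
    and \<eta>_mult: "\<And>p q. p \<in> mpols UNIV n \<Longrightarrow> q \<in> mpols UNIV n \<Longrightarrow> \<eta> (p * q) = \<eta> p * \<eta> q"
    and \<eta>_const: "\<And>c. \<eta> (pconst c) = pconst (pconst c)"
    and \<eta>_\<pi>: "\<And>a b. a < n \<Longrightarrow> b < n \<Longrightarrow> \<eta> (\<pi> a b) = 0"
    and nz: "\<eta> f \<noteq> 0"
  obtains v l where "central_summand v l"
proof -
  have \<eta>_0: "\<eta> 0 = 0" using \<eta>_const[of 0] by simp
  have \<eta>_sum: "\<eta> (\<Sum>i\<in>I. g i) = (\<Sum>i\<in>I. \<eta> (g i))" if "\<And>i. i \<in> I \<Longrightarrow> g i \<in> mpols UNIV n" for I :: "nat set" and g
    using that by (induction I rule: infinite_finite_induct) (auto simp: \<eta>_0 \<eta>_add A.sum)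
  have fA: "f \<in> mpols UNIV n" using f(1) by (rule casimirs_mpols)
  note closed = fA A.mult U.pderiv_var_mpols \<pi>_mpols U.pvar_mpols U.pconst_mpols
  define V where "V a = \<eta> (pderiv_var a f)" for a
  define L where "L a = \<eta> (pvar a)" for a
  have VC: "(\<Sum>a<n. pconst (pconst (C a b c)) * V a) = 0" if "b < n" "c < n" for b c
  proof -
    have "0 = \<eta> (pderiv_var c (hamilton b f))"
      using f(1) that by (simp add: casimirs_def \<eta>_0)
    also have "\<dots> = \<eta> (\<Sum>a<n. pderiv_var a f * pconst (C a b c) + pderiv_var c (pderiv_var a f) * \<pi> a b)"
      using that by (simp add: hamilton_def pderiv_var_sum pderiv_var_mult pderiv_\<pi>)
    also have "\<dots> = (\<Sum>a<n. pconst (pconst (C a b c)) * V a)"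
      using that by (subst \<eta>_sum) (auto simp: \<eta>_add \<eta>_mult closed A.add \<eta>_const \<eta>_\<pi> V_def ac_simps)
    finally show ?thesis by simp
  qed
  have LC: "(\<Sum>c<n. pconst (pconst (C a b c)) * L c) = 0" if "a < n" "b < n" for a b
    using \<eta>_\<pi>[OF that] unfolding \<pi>_def
    by (subst (asm) \<eta>_sum) (auto simp: \<eta>_mult closed \<eta>_const L_def)
  have "(\<Sum>a<n. V a * L a) = \<eta> (euler n f)"
    unfolding euler_def V_def L_def by (subst \<eta>_sum) (auto simp: \<eta>_mult closed ac_simps)
  also have "\<dots> = of_nat d * \<eta> f"
    unfolding f(3) using \<eta>_mult[OF U.pconst_mpols[OF UNIV_I] fA, of "of_nat d"] \<eta>_const[of "of_nat d"]
    by (simp only: pconst_of_nat)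
  finally have "(\<Sum>a<n. V a * L a) \<noteq> 0"
    using nz f(2) by (simp only: mult_eq_0_iff of_nat_eq_0_iff) blast
  then obtain \<beta> \<gamma> where nz1: "(\<Sum>a<n. lookup (V a) \<beta> * lookup (L a) \<gamma>) \<noteq> 0"
    by (rule nonzero_coefficients_of_inner_product[of V L n])
  obtain \<beta>' \<gamma>' where nz': "(\<Sum>a<n. lookup (lookup (V a) \<beta>) \<beta>' * lookup (lookup (L a) \<gamma>) \<gamma>') \<noteq> 0"
    using nonzero_coefficients_of_inner_product[of "\<lambda>a. lookup (V a) \<beta>" "\<lambda>a. lookup (L a) \<gamma>" n] nz1 by blast
  define x y where "x a = lookup (lookup (V a) \<beta>) \<beta>'" and "y a = lookup (lookup (L a) \<gamma>) \<gamma>'" for a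
  define \<kappa> where "\<kappa> = (\<Sum>a<n. x a * y a)"
  have \<kappa>: "\<kappa> \<noteq> 0" using nz' by (simp add: \<kappa>_def x_def y_def)
  show thesis
  proof (rule that[of "\<lambda>a. x a / \<kappa>" y], unfold central_summand_def, intro conjI allI impI)
    show "(\<Sum>a<n. x a / \<kappa> * C a b c) = 0" if "b < n" "c < n" for b c
    proof -
      have "(\<Sum>a<n. x a / \<kappa> * C a b c) = (\<Sum>a<n. C a b c * x a) / \<kappa>"
        unfolding sum_divide_distrib by (intro sum.cong) auto
      also have "(\<Sum>a<n. C a b c * x a) = lookup (lookup (\<Sum>a<n. pconst (pconst (C a b c)) * V a) \<beta>) \<beta>'"
        by (simp add: lookup_sum lookup_pconst_mult x_def)
      also have "\<dots> = 0" by (simp add: VC[OF that])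
      finally show ?thesis by simp
    qed
    show "(\<Sum>c<n. C a b c * y c) = 0" if "a < n" "b < n" for a b
    proof -
      have "(\<Sum>c<n. C a b c * y c) = lookup (lookup (\<Sum>c<n. pconst (pconst (C a b c)) * L c) \<gamma>) \<gamma>'"
        by (simp add: lookup_sum lookup_pconst_mult y_def)
      also have "\<dots> = 0" by (simp add: LC[OF that])
      finally show ?thesis .
    qed
    have "(\<Sum>a<n. x a / \<kappa> * y a) = \<kappa> / \<kappa>"
      unfolding \<kappa>_def sum_divide_distrib by (intro sum.cong) auto
    then show "(\<Sum>a<n. x a / \<kappa> * y a) = 1" using \<kappa> by simp
  qed
qed

end

section \<open>Coefficientwise maps and substitution\<close>

lemma lookup_mult_0: "lookup (p * q :: 'a::comm_ring_1 mpol) 0 = lookup p 0 * lookup q 0"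
proof -
  have *: "m + m' = 0 \<longleftrightarrow> m = 0 \<and> m' = 0" for m m' :: "nat \<Rightarrow>\<^sub>0 nat"
    by (auto simp: poly_mapping_eq_iff fun_eq_iff lookup_add)
  have "lookup (p * q) 0 = (\<Sum>m\<in>keys p. \<Sum>m'\<in>keys q.
      if m = 0 then if m' = 0 then lookup p 0 * lookup q 0 else 0 else 0)"
    unfolding sum_monomials_mult[of p q] lookup_sum
    by (intro sum.cong refl) (auto simp: lookup_single when_def *)
  also have "\<dots> = (\<Sum>m\<in>keys p. if m = 0 then (\<Sum>m'\<in>keys q. if m' = 0 then lookup p 0 * lookup q 0 else 0) else 0)"
    by (intro sum.cong) auto
  also have "\<dots> = lookup p 0 * lookup q 0"
    by (auto simp: in_keys_iff)
  finally show ?thesis .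
qed

lemma lookup_map_zero: "h 0 = 0 \<Longrightarrow> lookup (Poly_Mapping.map h p) m = h (lookup p m)"
  by (auto simp: Poly_Mapping.map.rep_eq when_def)

lemma map_pconst: "h 0 = 0 \<Longrightarrow> Poly_Mapping.map h (pconst c) = pconst (h c)"
  by (rule poly_mapping_eqI) (simp add: lookup_map_zero lookup_pconst)

lemma map_mpols: "h 0 = 0 \<Longrightarrow> (\<And>c. c \<in> C \<Longrightarrow> h c \<in> D) \<Longrightarrow> p \<in> mpols C n \<Longrightarrow> Poly_Mapping.map h p \<in> mpols D n"
proof -
  assume h: "h 0 = 0" "\<And>c. c \<in> C \<Longrightarrow> h c \<in> D" and p: "p \<in> mpols C n"
  have "m \<in> keys p" if "m \<in> keys (Poly_Mapping.map h p)" for m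
    using that h(1) by (auto simp: in_keys_iff lookup_map_zero)
  then show ?thesis
    using h p by (simp add: mpols_def lookup_map_zero)
qed

context
  fixes C :: "'a::comm_ring_1 set" and h :: "'a \<Rightarrow> 'b::comm_ring_1"
  assumes C: "subring_set C" and h_add: "\<And>x y. x \<in> C \<Longrightarrow> y \<in> C \<Longrightarrow> h (x + y) = h x + h y"
begin

interpretation C: subring_set C by (fact C)

lemma additive_zero: "h 0 = 0"
  using h_add[OF C.zero C.zero] by simp

lemma additive_sum: "(\<And>i. i \<in> I \<Longrightarrow> f i \<in> C) \<Longrightarrow> h (sum f I) = (\<Sum>i\<in>I. h (f i))"
  by (induction I rule: infinite_finite_induct) (auto simp: additive_zero h_add C.sum)

lemma map_add: "p \<in> mpols C n \<Longrightarrow> q \<in> mpols C n \<Longrightarrow>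
    Poly_Mapping.map h (p + q) = Poly_Mapping.map h p + Poly_Mapping.map h q"
  by (rule poly_mapping_eqI) (simp add: lookup_map_zero[of h, OF additive_zero] lookup_add h_add C.lookup_mpols)

lemma map_monomials: "p \<in> mpols C n \<Longrightarrow> Poly_Mapping.map h p = (\<Sum>m\<in>keys p. single m (h (lookup p m)))"
  by (rule poly_mapping_eqI)
    (auto simp: lookup_map_zero[of h, OF additive_zero] lookup_sum lookup_single when_def in_keys_iff additive_zero)

lemma map_monomials_mult:
  assumes "p \<in> mpols C n" "q \<in> mpols C n"
  shows "Poly_Mapping.map h (p * q) =
    (\<Sum>m\<in>keys p. \<Sum>m'\<in>keys q. single (m + m') (h (lookup p m * lookup q m')))"
proof (rule poly_mapping_eqI)
  fix k
  have c: "lookup p m * lookup q m' \<in> C" for m m'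
    using assms by (intro C.mult C.lookup_mpols)
  have "lookup (Poly_Mapping.map h (p * q)) k =
      h (\<Sum>m\<in>keys p. \<Sum>m'\<in>keys q. if m + m' = k then lookup p m * lookup q m' else 0)"
    unfolding lookup_map_zero[of h, OF additive_zero] sum_monomials_mult[of p q] lookup_sum
    by (simp add: lookup_single when_def)
  also have "\<dots> = (\<Sum>m\<in>keys p. \<Sum>m'\<in>keys q. if m + m' = k then h (lookup p m * lookup q m') else 0)"
    by (subst additive_sum, force intro!: C.sum simp: c C.zero, rule sum.cong[OF refl])
      (subst additive_sum, auto intro!: sum.cong simp: c C.zero additive_zero)
  finally show "lookup (Poly_Mapping.map h (p * q)) k =
      lookup (\<Sum>m\<in>keys p. \<Sum>m'\<in>keys q. single (m + m') (h (lookup p m * lookup q m'))) k"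
    by (simp add: lookup_sum lookup_single when_def)
qed

lemma map_mult:
  assumes "\<And>x y. x \<in> C \<Longrightarrow> y \<in> C \<Longrightarrow> h (x * y) = h x * h y"
    and p: "p \<in> mpols C n" and q: "q \<in> mpols C n"
  shows "Poly_Mapping.map h (p * q) = Poly_Mapping.map h p * Poly_Mapping.map h q"
  unfolding map_monomials_mult[OF p q] map_monomials[OF p] map_monomials[OF q] sum_product mult_single
  using p q by (simp add: assms(1) C.lookup_mpols)

end

lemma map_derivation:
  assumes "derivation C d"
  shows "derivation (mpols C n) (Poly_Mapping.map d)"
proof -
  interpret derivation C d by (fact assms)
  interpret R: subring_set "mpols C n" by (rule mpols_subring)
  have m: "Poly_Mapping.map d (p * q) = p * Poly_Mapping.map d q + Poly_Mapping.map d p * q"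
    if p: "p \<in> mpols C n" and q: "q \<in> mpols C n" for p q
  proof -
    have "p * Poly_Mapping.map d q + Poly_Mapping.map d p * q =
        (\<Sum>m\<in>keys p. single m (lookup p m)) * (\<Sum>m\<in>keys q. single m (d (lookup q m))) +
        (\<Sum>m\<in>keys p. single m (d (lookup p m))) * (\<Sum>m\<in>keys q. single m (lookup q m))"
      using map_monomials[OF subring_set_axioms d_add p] map_monomials[OF subring_set_axioms d_add q]
      by (simp add: sum_monomials)
    also have "\<dots> = (\<Sum>m\<in>keys p. \<Sum>m'\<in>keys q. single (m + m') (d (lookup p m * lookup q m')))"
      unfolding sum_product mult_single sum.distrib[symmetric] single_add[symmetric]
      using p q by (simp add: d_mult lookup_mpols)
    also have "\<dots> = Poly_Mapping.map d (p * q)"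
      using map_monomials_mult[OF subring_set_axioms d_add p q] by simp
    finally show ?thesis by simp
  qed
  show ?thesis
    by unfold_locales
      (auto simp: map_add[OF subring_set_axioms d_add] m intro!: map_mpols[of d, OF d_zero] d_closed)
qed

lemma (in subring_set) pderiv_var_derivation: "derivation (mpols C n) (pderiv_var i)"
proof -
  interpret R: subring_set "mpols C n" by (rule mpols_subring)
  show ?thesis
    by unfold_locales (auto simp: pderiv_var_mpols pderiv_var_add pderiv_var_mult)
qed

definition subst :: "nat \<Rightarrow> ('a::comm_ring_1 \<Rightarrow> 'b::comm_ring_1) \<Rightarrow> (nat \<Rightarrow> 'b) \<Rightarrow> 'a mpol \<Rightarrow> 'b" where
  "subst n h y p = (\<Sum>m\<in>keys p. h (lookup p m) * (\<Prod>i<n. y i ^ lookup m i))"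

context
  fixes h :: "'a::comm_ring_1 \<Rightarrow> 'b::comm_ring_1"
  assumes h_add: "\<And>x y. h (x + y) = h x + h y" and h_mult: "\<And>x y. h (x * y) = h x * h y"
    and h_one: "h 1 = 1"
begin

lemma hom_zero: "h 0 = 0"
  using h_add[of 0 0] by simp

lemma subst_pconst: "subst n h y (pconst c) = h c"
  by (cases "c = 0") (auto simp: subst_def pconst_def hom_zero)

lemma subst_pvar: "i < n \<Longrightarrow> subst n h y (pvar i) = y i"
proof -
  assume i: "i < n"
  have "(\<Prod>j<n. y j ^ lookup (single i 1) j) = (\<Prod>j<n. if j = i then y i else 1)"
    by (intro prod.cong) (auto simp: lookup_single when_def)
  with i show ?thesis
    by (simp add: subst_def pvar_def h_one)
qed

lemma subst_add: "subst n h y (p + q) = subst n h y p + subst n h y q"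
  unfolding subst_def by (rule setsum_keys_plus_distrib) (auto simp: hom_zero h_add distrib_right)

lemma subst_sum: "subst n h y (sum f I) = (\<Sum>i\<in>I. subst n h y (f i))"
  by (induction I rule: infinite_finite_induct)
    (auto simp: subst_add, auto simp: subst_def)

lemma subst_mult: "subst n h y (p * q) = subst n h y p * subst n h y q"
proof -
  have s: "subst n h y (single m c) = h c * (\<Prod>i<n. y i ^ lookup m i)" for m c
    by (cases "c = 0") (auto simp: subst_def hom_zero)
  have "subst n h y (p * q) =
      (\<Sum>m\<in>keys p. \<Sum>m'\<in>keys q. h (lookup p m * lookup q m') * (\<Prod>i<n. y i ^ lookup (m + m') i))"
    unfolding sum_monomials_mult[of p q] subst_sum s ..
  also have "\<dots> = subst n h y p * subst n h y q"
    unfolding subst_def sum_product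
    by (intro sum.cong refl) (simp add: h_mult lookup_add power_add prod.distrib ac_simps)
  finally show ?thesis .
qed

end

section \<open>The bracket of a polynomial extension\<close>

definition extbr :: "('a::comm_ring_1 \<Rightarrow> 'a \<Rightarrow> 'a) \<Rightarrow> 'a mpol \<Rightarrow> 'a mpol \<Rightarrow> 'a mpol" where
  "extbr \<beta> p q = (\<Sum>m\<in>keys p. \<Sum>m'\<in>keys q. single (m + m') (\<beta> (lookup p m) (lookup q m')))"

lemma poisson_poly_ext_sel:
  "pcarrier (poisson_poly_ext A n) = mpols (pcarrier A) n"
  "pscale (poisson_poly_ext A n) c = Poly_Mapping.map (pscale A c)"
  "pbracket (poisson_poly_ext A n) = extbr (pbracket A)"
  by (simp_all add: poisson_poly_ext_def extbr_def fun_eq_iff)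

context
  fixes D :: "'a::comm_ring_1 set" and \<beta> :: "'a \<Rightarrow> 'a \<Rightarrow> 'a"
  assumes D_zero: "0 \<in> D" and \<beta>_zero: "\<And>x. x \<in> D \<Longrightarrow> \<beta> 0 x = 0" "\<And>x. x \<in> D \<Longrightarrow> \<beta> x 0 = 0"
begin

lemma extbr_pconst_right:
  assumes "b \<in> D" "p \<in> mpols D n"
  shows "lookup (extbr \<beta> p (pconst b)) m = \<beta> (lookup p m) b"
proof -
  have "extbr \<beta> p (pconst b) = (\<Sum>m\<in>keys p. single m (\<beta> (lookup p m) b))"
    using assms by (cases "b = 0") (auto simp: extbr_def pconst_def \<beta>_zero mpols_def intro!: sum.neutral)
  then show ?thesis
    using assms by (auto simp: lookup_sum lookup_single when_def in_keys_iff \<beta>_zero)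
qed

lemma extbr_pconst:
  assumes "a \<in> D" "b \<in> D"
  shows "extbr \<beta> (pconst a) (pconst b) = pconst (\<beta> a b)"
  using assms by (auto simp: extbr_def pconst_def \<beta>_zero)

lemma extbr_eq_0_iff:
  assumes "p \<in> mpols D n"
  shows "(\<forall>q\<in>mpols D n. extbr \<beta> p q = 0) \<longleftrightarrow> (\<forall>m. \<forall>b\<in>D. \<beta> (lookup p m) b = 0)"
proof
  assume *: "\<forall>q\<in>mpols D n. extbr \<beta> p q = 0"
  have "pconst b \<in> mpols D n" if "b \<in> D" for b
    using that by (auto simp: mpols_def pconst_def)
  then show "\<forall>m. \<forall>b\<in>D. \<beta> (lookup p m) b = 0"
    using extbr_pconst_right[OF _ assms] * by (metis lookup_zero)
next
  assume "\<forall>m. \<forall>b\<in>D. \<beta> (lookup p m) b = 0"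
  then show "\<forall>q\<in>mpols D n. extbr \<beta> p q = 0"
    by (auto simp: extbr_def mpols_def intro!: sum.neutral)
qed

lemma lookup_extbr_0:
  assumes "p \<in> mpols D n" "q \<in> mpols D n"
  shows "lookup (extbr \<beta> p q) 0 = \<beta> (lookup p 0) (lookup q 0)"
proof -
  have *: "m + m' = 0 \<longleftrightarrow> m = 0 \<and> m' = 0" for m m' :: "nat \<Rightarrow>\<^sub>0 nat"
    by (auto simp: poly_mapping_eq_iff fun_eq_iff lookup_add)
  have l: "lookup r m \<in> D" if "r \<in> mpols D n" for r m
    using that D_zero by (cases "m \<in> keys r") (auto simp: mpols_def in_keys_iff)
  have "lookup (extbr \<beta> p q) 0 = (\<Sum>m\<in>keys p. \<Sum>m'\<in>keys q.
      if m = 0 then if m' = 0 then \<beta> (lookup p 0) (lookup q 0) else 0 else 0)"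
    unfolding extbr_def lookup_sum
    by (intro sum.cong refl) (auto simp: lookup_single when_def *)
  also have "\<dots> = (\<Sum>m\<in>keys p. if m = 0 then (\<Sum>m'\<in>keys q. if m' = 0 then \<beta> (lookup p 0) (lookup q 0) else 0) else 0)"
    by (intro sum.cong) auto
  also have "\<dots> = \<beta> (lookup p 0) (lookup q 0)"
    using l[OF assms(1), of 0] l[OF assms(2), of 0] by (auto simp: in_keys_iff \<beta>_zero)
  finally show ?thesis .
qed

end

section \<open>Stably isomorphic Poisson algebras\<close>

locale stable_iso = linear_bracket n C + B: poisson_algebra B
  for n and C :: "nat \<Rightarrow> nat \<Rightarrow> nat \<Rightarrow> 'k::field_char_0" and B :: "('k, 'b::comm_ring_1) palg" +
  fixes A :: "('k, 'k mpol) palg" and m :: nat and \<phi> :: "'k mpol mpol \<Rightarrow> 'b mpol"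
  assumes A_sel: "pcarrier A = mpols UNIV n" "pscale A = (\<lambda>c p. pconst c * p)" "pbracket A = br"
    and iso: "poisson_iso (poisson_poly_ext A m) (poisson_poly_ext B m) \<phi>"
begin

abbreviation "carA \<equiv> mpols UNIV n :: 'k mpol set"
abbreviation "R \<equiv> mpols carA m"
abbreviation "RB \<equiv> mpols (pcarrier B) m"
abbreviation "const r \<equiv> pconst (pconst r) :: 'k mpol mpol"

definition centre :: "'b set" where
  "centre = {z \<in> pcarrier B. \<forall>b\<in>pcarrier B. pbracket B z b = 0}"

definition \<iota> :: "'k \<Rightarrow> 'b" where "\<iota> c = pscale B c 1"

sublocale BB: subring_set "pcarrier B"
  by unfold_locales
    (auto simp: B.zero_closed B.one_closed B.add_closed B.mult_closed B.uminus_closed)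

lemma R_subring: "subring_set R"
  by (rule A.mpols_subring)

sublocale R: subring_set R
  by (rule R_subring)

sublocale RB: subring_set RB
  by (rule BB.mpols_subring)

sublocale ZB: subring_set centre
proof
  show "0 \<in> centre" "1 \<in> centre"
    by (auto simp: centre_def BB.zero BB.one B.bracket_zero_left B.bracket_one_left)
  show "- x \<in> centre" if "x \<in> centre" for x
    using that B.bracket_add_left[of x "- x"]
    by (auto simp: centre_def BB.uminus B.bracket_zero_left)
qed (auto simp: centre_def BB.add BB.mult B.bracket_add_left B.bracket_mult_left)

lemma centre_closed: "z \<in> centre \<Longrightarrow> z \<in> pcarrier B"
  by (simp add: centre_def)

lemma \<iota>_closed: "\<iota> c \<in> pcarrier B"
  by (simp add: \<iota>_def B.scale_closed BB.one)

lemma \<iota>_add: "\<iota> (c + d) = \<iota> c + \<iota> d"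
  by (simp add: \<iota>_def B.scale_add_left BB.one)

lemma \<iota>_mult: "\<iota> (c * d) = \<iota> c * \<iota> d"
  by (simp add: \<iota>_def B.scale_mult B.scale_scale B.scale_closed BB.one)

lemma \<iota>_one: "\<iota> 1 = 1"
  by (simp add: \<iota>_def B.scale_one BB.one)

lemma \<iota>_of_nat: "\<iota> (of_nat k) = of_nat k"
  using hom_zero[of \<iota>, OF \<iota>_add \<iota>_mult \<iota>_one] by (induction k) (auto simp: \<iota>_add \<iota>_one)

lemma scale_eq: "b \<in> pcarrier B \<Longrightarrow> pscale B c b = \<iota> c * b"
  by (simp add: \<iota>_def B.scale_mult BB.one)

lemma \<iota>_centre: "\<iota> c \<in> centre"
proof -
  have "pscale B c 0 = 0" using scale_eq[OF BB.zero] by simp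
  then show ?thesis
    using \<iota>_closed
    by (auto simp: centre_def) (simp add: \<iota>_def B.bracket_scale_left BB.one B.bracket_one_left)
qed

lemma torsion_free:
  assumes "b \<in> pcarrier B" "of_nat (Suc k) * b = 0"
  shows "b = 0"
proof -
  have "b = \<iota> (inverse (of_nat (Suc k)) * of_nat (Suc k)) * b"
    by (simp add: \<iota>_one del: of_nat_Suc)
  also have "\<dots> = \<iota> (inverse (of_nat (Suc k))) * (of_nat (Suc k) * b)"
    by (simp only: \<iota>_mult \<iota>_of_nat mult.assoc)
  finally show ?thesis using assms(2) by simp
qed

lemma bij: "bij_betw \<phi> R RB"
  using iso by (simp add: poisson_iso_def poisson_poly_ext_sel A_sel)

lemma \<phi>_closed: "r \<in> R \<Longrightarrow> \<phi> r \<in> RB"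
  using bij by (auto simp: bij_betw_def)

lemma \<phi>_add: "r \<in> R \<Longrightarrow> s \<in> R \<Longrightarrow> \<phi> (r + s) = \<phi> r + \<phi> s"
  and \<phi>_mult: "r \<in> R \<Longrightarrow> s \<in> R \<Longrightarrow> \<phi> (r * s) = \<phi> r * \<phi> s"
  and \<phi>_br: "r \<in> R \<Longrightarrow> s \<in> R \<Longrightarrow> \<phi> (extbr br r s) = extbr (pbracket B) (\<phi> r) (\<phi> s)"
  and \<phi>_one: "\<phi> 1 = 1"
  using iso by (auto simp: poisson_iso_def poisson_poly_ext_sel A_sel)

lemma const_closed: "const c \<in> R"
  by (intro A.pconst_mpols U.pconst_mpols UNIV_I)

lemma \<phi>_const: "\<phi> (const c) = pconst (\<iota> c)"
proof -
  have "\<phi> (Poly_Mapping.map ((*) (pconst c)) 1) = Poly_Mapping.map (pscale B c) (\<phi> 1)"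
    using iso R.one by (auto simp: poisson_iso_def poisson_poly_ext_sel A_sel)
  moreover have "Poly_Mapping.map ((*) (pconst c)) (pconst 1) = const c"
    by (subst map_pconst) auto
  moreover have "Poly_Mapping.map (pscale B c) (pconst 1) = pconst (\<iota> c)"
    using scale_eq[OF BB.zero] by (subst map_pconst) (auto simp: \<iota>_def)
  ultimately show ?thesis by (simp add: \<phi>_one)
qed

definition \<phi>i :: "'b mpol \<Rightarrow> 'k mpol mpol" where "\<phi>i = inv_into R \<phi>"

lemma \<phi>i_closed: "s \<in> RB \<Longrightarrow> \<phi>i s \<in> R"
  using bij by (metis \<phi>i_def bij_betw_def inv_into_into)

lemma \<phi>_\<phi>i: "s \<in> RB \<Longrightarrow> \<phi> (\<phi>i s) = s"
  using bij by (metis \<phi>i_def bij_betw_inv_into_right)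

lemma \<phi>i_\<phi>: "r \<in> R \<Longrightarrow> \<phi>i (\<phi> r) = r"
  using bij by (metis \<phi>i_def bij_betw_inv_into_left)

lemma \<phi>_inj: "r \<in> R \<Longrightarrow> s \<in> R \<Longrightarrow> \<phi> r = \<phi> s \<Longrightarrow> r = s"
  by (metis \<phi>i_\<phi>)

lemma \<phi>i_add: "r \<in> RB \<Longrightarrow> s \<in> RB \<Longrightarrow> \<phi>i (r + s) = \<phi>i r + \<phi>i s"
  by (intro \<phi>_inj) (simp_all add: \<phi>_add \<phi>i_closed \<phi>_\<phi>i R.add RB.add)

lemma \<phi>i_mult: "r \<in> RB \<Longrightarrow> s \<in> RB \<Longrightarrow> \<phi>i (r * s) = \<phi>i r * \<phi>i s"
  by (intro \<phi>_inj) (simp_all add: \<phi>_mult \<phi>i_closed \<phi>_\<phi>i R.mult RB.mult)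

lemma \<phi>i_one: "\<phi>i 1 = 1"
  by (metis \<phi>_one \<phi>i_\<phi> R.one)

lemma \<phi>_zero: "\<phi> 0 = 0"
  using \<phi>_add[OF R.zero R.zero] by simp

lemma \<phi>i_zero: "\<phi>i 0 = 0"
  by (metis \<phi>_zero \<phi>i_\<phi> R.zero)

lemma \<phi>i_pconst_\<iota>: "\<phi>i (pconst (\<iota> c)) = const c"
  by (metis \<phi>_const \<phi>i_\<phi> const_closed)

lemma extbr_R: "r \<in> R \<Longrightarrow> s \<in> R \<Longrightarrow> extbr br r s \<in> R"
  unfolding extbr_def
  by (intro R.sum A.single_mpols br_closed A.lookup_mpols) (auto simp: mpols_def keys_add_nat)

lemma \<phi>_centre_iff: "r \<in> R \<Longrightarrow> \<phi> r \<in> mpols centre m \<longleftrightarrow> r \<in> mpols casimirs m"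
proof -
  assume r: "r \<in> R"
  have "r \<in> mpols casimirs m \<longleftrightarrow> (\<forall>\<beta>. lookup r \<beta> \<in> casimirs)"
    using r by (auto simp: Z.mpols_iff A.mpols_iff)
  also have "\<dots> \<longleftrightarrow> (\<forall>\<beta>. \<forall>b\<in>carA. br (lookup r \<beta>) b = 0)"
    by (simp add: casimirs_iff A.lookup_mpols[OF r])
  also have "\<dots> \<longleftrightarrow> (\<forall>s\<in>R. extbr br r s = 0)"
    using extbr_eq_0_iff[of carA br, OF A.zero br_0(1) br_0(2) r] by simp
  also have "\<dots> \<longleftrightarrow> (\<forall>s\<in>R. extbr (pbracket B) (\<phi> r) (\<phi> s) = 0)"
  proof (intro ball_cong refl)
    fix s assume s: "s \<in> R"
    show "(extbr br r s = 0) = (extbr (pbracket B) (\<phi> r) (\<phi> s) = 0)"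
      using extbr_R[OF r s] \<phi>_br[OF r s] \<phi>_zero \<phi>_inj R.zero by metis
  qed
  also have "\<dots> \<longleftrightarrow> (\<forall>s\<in>RB. extbr (pbracket B) (\<phi> r) s = 0)"
    by (metis \<phi>_closed \<phi>_\<phi>i \<phi>i_closed)
  also have "\<dots> \<longleftrightarrow> (\<forall>\<beta>. \<forall>b\<in>pcarrier B. pbracket B (lookup (\<phi> r) \<beta>) b = 0)"
    using extbr_eq_0_iff[of "pcarrier B" "pbracket B", OF BB.zero B.bracket_zero_left B.bracket_zero_right \<phi>_closed[OF r]] by simp
  also have "\<dots> \<longleftrightarrow> \<phi> r \<in> mpols centre m"
    using \<phi>_closed[OF r] by (simp add: BB.mpols_iff ZB.mpols_iff) (auto simp: centre_def)
  finally show ?thesis by simp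
qed

lemma casimirs_R: "r \<in> mpols casimirs m \<Longrightarrow> r \<in> R"
  using mpols_mono[of casimirs carA m] casimirs_mpols by blast

lemma centre_RB: "s \<in> mpols centre m \<Longrightarrow> s \<in> RB"
  using mpols_mono[of centre "pcarrier B" m] centre_closed by blast

lemma \<phi>i_centre: "s \<in> mpols centre m \<Longrightarrow> \<phi>i s \<in> mpols casimirs m"
  using \<phi>_centre_iff[of "\<phi>i s"] by (simp add: centre_RB \<phi>i_closed \<phi>_\<phi>i)

definition E :: "nat \<Rightarrow> 'k mpol mpol \<Rightarrow> 'k mpol mpol" where
  "E i r = \<phi>i (pderiv_var i (\<phi> r))"

lemma E_\<phi>i: "s \<in> RB \<Longrightarrow> E i (\<phi>i s) = \<phi>i (pderiv_var i s)"
  by (simp add: E_def \<phi>_\<phi>i)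

lemma E_\<phi>i_pconst: "b \<in> pcarrier B \<Longrightarrow> E i (\<phi>i (pconst b)) = 0"
  by (simp add: E_\<phi>i BB.pconst_mpols \<phi>i_zero)

lemma E_const: "E i (const c) = 0"
  using E_\<phi>i_pconst[OF \<iota>_closed] by (simp add: \<phi>i_pconst_\<iota>)

lemma E_\<sigma>: "k < m \<Longrightarrow> E i (\<phi>i (pvar k)) = (if k = i then 1 else 0)"
  by (auto simp: E_\<phi>i BB.pvar_mpols pderiv_var_pvar \<phi>i_one \<phi>i_zero)

lemma E_locally_nilpotent: "locally_nilpotent R (E i)"
proof
  show "E i x \<in> R" if "x \<in> R" for x
    using that by (simp add: E_def \<phi>i_closed BB.pderiv_var_mpols \<phi>_closed)
  show "E i (x + y) = E i x + E i y" "E i (x * y) = x * E i y + E i x * y" if "x \<in> R" "y \<in> R" for x y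
    using that by (simp_all add: E_def \<phi>_add \<phi>_mult pderiv_var_add pderiv_var_mult \<phi>i_add \<phi>i_mult
        \<phi>_closed BB.pderiv_var_mpols RB.mult \<phi>i_\<phi>)
  show "\<exists>k. (E i ^^ k) x = 0" if "x \<in> R" for x
  proof -
    have "(E i ^^ k) x = \<phi>i ((pderiv_var i ^^ k) (\<phi> x)) \<and> (pderiv_var i ^^ k) (\<phi> x) \<in> RB" for k
      using that by (induction k) (simp_all add: \<phi>i_\<phi> \<phi>_closed E_\<phi>i BB.pderiv_var_mpols)
    then show ?thesis using pderiv_var_nilpotent[of i "\<phi> x"] by (metis \<phi>i_zero)
  qed
qed

sublocale E: locally_nilpotent R "E i" for i
  by (rule E_locally_nilpotent)

lemma E_centre: "r \<in> mpols casimirs m \<Longrightarrow> E i r \<in> mpols casimirs m"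
  unfolding E_def
  by (intro \<phi>i_centre ZB.pderiv_var_mpols) (simp add: \<phi>_centre_iff casimirs_R)

lemma E_kernel:
  assumes "r \<in> R" "\<And>i. i < m \<Longrightarrow> E i r = 0"
  shows "\<phi> r = pconst (lookup (\<phi> r) 0)"
proof (rule pderiv_var_eq_0D)
  show "\<phi> r \<in> RB" by (rule \<phi>_closed[OF assms(1)])
  show "pderiv_var i (\<phi> r) = 0" if "i < m" for i
    using assms(2)[OF that] assms(1) \<phi>_\<phi>i[of "pderiv_var i (\<phi> r)"]
    by (simp add: E_def \<phi>_zero BB.pderiv_var_mpols \<phi>_closed)
qed (rule torsion_free)

definition \<psi> :: "'k mpol mpol \<Rightarrow> 'b" where "\<psi> r = lookup (\<phi> r) 0"

lemma \<psi>_closed: "r \<in> R \<Longrightarrow> \<psi> r \<in> pcarrier B"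
  by (simp add: \<psi>_def BB.lookup_mpols[OF \<phi>_closed])

lemma \<psi>_add: "r \<in> R \<Longrightarrow> s \<in> R \<Longrightarrow> \<psi> (r + s) = \<psi> r + \<psi> s"
  and \<psi>_mult: "r \<in> R \<Longrightarrow> s \<in> R \<Longrightarrow> \<psi> (r * s) = \<psi> r * \<psi> s"
  by (simp_all add: \<psi>_def \<phi>_add \<phi>_mult lookup_add lookup_mult_0)

lemma \<psi>_const: "\<psi> (const c) = \<iota> c"
  by (simp add: \<psi>_def \<phi>_const lookup_pconst)

lemma \<psi>_zero: "\<psi> 0 = 0"
  by (simp add: \<psi>_def \<phi>_zero)

lemma \<psi>_sum: "(\<And>i. i \<in> I \<Longrightarrow> f i \<in> R) \<Longrightarrow> \<psi> (sum f I) = (\<Sum>i\<in>I. \<psi> (f i))"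
  by (induction I rule: infinite_finite_induct) (auto simp: \<psi>_zero \<psi>_add R.sum)

lemma \<psi>_centre: "r \<in> mpols casimirs m \<Longrightarrow> \<psi> r \<in> centre"
  unfolding \<psi>_def by (rule ZB.lookup_mpols[of _ m]) (simp add: \<phi>_centre_iff casimirs_R)

lemma \<psi>_br:
  assumes "p \<in> carA" "q \<in> carA"
  shows "pbracket B (\<psi> (pconst p)) (\<psi> (pconst q)) = \<psi> (pconst (br p q))"
proof -
  have "\<psi> (pconst (br p q)) = lookup (\<phi> (extbr br (pconst p) (pconst q))) 0"
    using extbr_pconst[of carA br] assms by (simp add: \<psi>_def A.zero)
  also have "\<dots> = pbracket B (\<psi> (pconst p)) (\<psi> (pconst q))"
    using assms by (simp add: \<phi>_br A.pconst_mpols \<psi>_def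
        lookup_extbr_0[of "pcarrier B" "pbracket B", OF BB.zero B.bracket_zero_left B.bracket_zero_right \<phi>_closed \<phi>_closed])
  finally show ?thesis ..
qed

lemma \<psi>_linear: "\<psi> (pconst (\<Sum>c<n. pconst (a c) * pvar c)) = (\<Sum>c<n. \<iota> (a c) * \<psi> (pconst (pvar c)))"
proof -
  have "pconst (pvar c) \<in> R" if "c < n" for c using that by (intro A.pconst_mpols U.pvar_mpols)
  then show ?thesis
    unfolding pconst_sum pconst_mult
    by (subst \<psi>_sum) (auto intro!: R.mult const_closed sum.cong simp: \<psi>_mult \<psi>_const const_closed)
qed

lemma generated_by_images:
  assumes T: "subring_set T" and \<iota>T: "\<And>c. \<iota> c \<in> T"
    and xT: "\<And>i. i < n \<Longrightarrow> \<psi> (pconst (pvar i)) \<in> T" and tT: "\<And>j. j < m \<Longrightarrow> \<psi> (pvar j) \<in> T"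
  shows "pcarrier B \<subseteq> T"
proof
  interpret T: subring_set T by (fact T)
  fix b assume b: "b \<in> pcarrier B"
  have a: "\<psi> (pconst a) \<in> T" if "a \<in> carA" for a
    using that
  proof (induction rule: U.mpols_induct)
    case (add p q)
    then show ?case by (simp add: pconst_add \<psi>_add A.pconst_mpols T.add)
  next
    case (mult p q)
    then show ?case by (simp add: pconst_mult \<psi>_mult A.pconst_mpols T.mult)
  qed (simp_all add: \<psi>_const \<iota>T xT)
  have "\<psi> r \<in> T" if "r \<in> R" for r
    using that
    by (induction rule: A.mpols_induct) (simp_all add: a tT \<psi>_add \<psi>_mult T.add T.mult)
  from this[of "\<phi>i (pconst b)"] b show "b \<in> T"
    by (simp add: \<psi>_def \<phi>i_closed \<phi>_\<phi>i BB.pconst_mpols lookup_pconst)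
qed

definition partial :: "nat \<Rightarrow> 'k mpol mpol \<Rightarrow> 'k mpol mpol" where
  "partial a = (if a < n then Poly_Mapping.map (pderiv_var a) else pderiv_var (a - n))"

definition gen :: "nat \<Rightarrow> 'k mpol mpol" where
  "gen a = (if a < n then pconst (pvar a) else pvar (a - n))"

lemma partial_derivation: "derivation R (partial a)"
  using map_derivation[OF U.pderiv_var_derivation[of n]] A.pderiv_var_derivation[of m]
  by (simp add: partial_def)

lemma gen_closed: "a < n + m \<Longrightarrow> gen a \<in> R"
  by (auto simp: gen_def intro!: A.pconst_mpols U.pvar_mpols A.pvar_mpols)

lemma partial_gen: "a < n + m \<Longrightarrow> b < n + m \<Longrightarrow> partial a (gen b) = (if a = b then 1 else 0)"
proof -
  have "Poly_Mapping.map (pderiv_var a) (pvar j :: 'k mpol mpol) = 0" for a j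
  proof (rule poly_mapping_eqI)
    fix k
    show "lookup (Poly_Mapping.map (pderiv_var a) (pvar j :: 'k mpol mpol)) k = lookup 0 k"
      using pderiv_var_pconst[of a "1 :: 'k"]
      by (simp add: lookup_map_zero pvar_def lookup_single when_def del: pderiv_var_pconst)
  qed
  then show "a < n + m \<Longrightarrow> b < n + m \<Longrightarrow> partial a (gen b) = (if a = b then 1 else 0)"
    by (auto simp: partial_def gen_def map_pconst pderiv_var_pvar)
qed

text \<open>
  By the chain rule, generators of \<open>A[t\<^sub>1, \<dots>, t\<^sub>m]\<close> in the required number have an invertible
  Jacobian matrix; hence the partial derivatives of a relation between them are relations again.
\<close>
lemma surjective_imp_injective:
  assumes \<theta>_closed: "\<And>p. p \<in> carA \<Longrightarrow> \<theta> p \<in> pcarrier B"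
    and \<theta>_add: "\<And>p q. p \<in> carA \<Longrightarrow> q \<in> carA \<Longrightarrow> \<theta> (p + q) = \<theta> p + \<theta> q"
    and \<theta>_mult: "\<And>p q. p \<in> carA \<Longrightarrow> q \<in> carA \<Longrightarrow> \<theta> (p * q) = \<theta> p * \<theta> q"
    and \<theta>_const: "\<And>c. \<theta> (pconst c) = \<iota> c"
    and surj: "pcarrier B \<subseteq> \<theta> ` carA"
    and f: "f \<in> carA" "\<theta> f = 0"
  shows "f = 0"
proof -
  define \<Theta> where "\<Theta> p = \<phi>i (pconst (\<theta> p))" for p
  have \<Theta>_closed: "\<Theta> p \<in> R" if "p \<in> carA" for p
    using that by (simp add: \<Theta>_def \<phi>i_closed BB.pconst_mpols \<theta>_closed)
  have \<Theta>_add: "\<Theta> (p + q) = \<Theta> p + \<Theta> q" and \<Theta>_mult: "\<Theta> (p * q) = \<Theta> p * \<Theta> q"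
    if "p \<in> carA" "q \<in> carA" for p q
    using that by (simp_all add: \<Theta>_def \<theta>_add \<theta>_mult pconst_add pconst_mult \<phi>i_add \<phi>i_mult
        BB.pconst_mpols \<theta>_closed)
  have \<Theta>_const: "\<Theta> (pconst c) = const c" for c
    by (simp add: \<Theta>_def \<theta>_const \<phi>i_pconst_\<iota>)
  define Y where "Y c = (if c < n then \<Theta> (pvar c) else \<phi>i (pvar (c - n)))" for c
  have Y_closed: "Y c \<in> R" if "c < n + m" for c
    using that by (auto simp: Y_def intro!: \<Theta>_closed U.pvar_mpols \<phi>i_closed BB.pvar_mpols)
  have partial_const: "partial a (const c) = 0" for a c
    by (simp add: partial_def map_pconst)
  have chain_\<Theta>: "partial a (\<Theta> p) = (\<Sum>i<n + m. (if i < n then \<Theta> (pderiv_var i p) else 0) * partial a (Y i))"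
    if p: "p \<in> carA" for a p
  proof -
    interpret P: derivation R "partial a" by (rule partial_derivation)
    have "partial a (\<Theta> p) = (\<Sum>i<n. \<Theta> (pderiv_var i p) * partial a (\<Theta> (pvar i)))"
      by (rule U.chain_rule[OF p, where E = "\<lambda>p. partial a (\<Theta> p)"])
        (use \<Theta>_const[of 1] in \<open>simp_all add: \<Theta>_add \<Theta>_mult \<Theta>_closed P.d_add P.d_mult \<Theta>_const partial_const\<close>)
    also have "\<dots> = (\<Sum>i<n + m. (if i < n then \<Theta> (pderiv_var i p) else 0) * partial a (Y i))"
      by (rule sum.mono_neutral_cong_left) (auto simp: Y_def)
    finally show ?thesis .
  qed
  have span: "\<exists>F. \<forall>a<n + m. partial a (\<phi>i s) = (\<Sum>c<n + m. F c * partial a (Y c))" if "s \<in> RB" for s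
    using that
  proof (induction rule: BB.mpols_induct)
    case (const b)
    then obtain p where "p \<in> carA" "b = \<theta> p" using surj by blast
    then show ?case
      using chain_\<Theta>[of p] unfolding \<Theta>_def
      by (intro exI[of _ "\<lambda>i. if i < n then \<phi>i (pconst (\<theta> (pderiv_var i p))) else 0"]) simp
  next
    case (var j)
    have "(\<Sum>c<n + m. (if c = n + j then 1 else 0) * partial a (Y c)) = partial a (Y (n + j))" for a
      using var by (simp add: if_distrib[of "\<lambda>x. x * _"] cong: if_cong)
    then show ?case
      by (intro exI[of _ "\<lambda>c. if c = n + j then 1 else 0"]) (simp add: Y_def)
  next
    case (add p q)
    then obtain F G where "\<And>a. a < n + m \<Longrightarrow> partial a (\<phi>i p) = (\<Sum>c<n + m. F c * partial a (Y c))"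
      "\<And>a. a < n + m \<Longrightarrow> partial a (\<phi>i q) = (\<Sum>c<n + m. G c * partial a (Y c))" by blast
    with add.hyps show ?case
      by (intro exI[of _ "\<lambda>c. F c + G c"])
        (simp add: \<phi>i_add \<phi>i_closed derivation.d_add[OF partial_derivation] distrib_right sum.distrib)
  next
    case (mult p q)
    then obtain F G where "\<And>a. a < n + m \<Longrightarrow> partial a (\<phi>i p) = (\<Sum>c<n + m. F c * partial a (Y c))"
      "\<And>a. a < n + m \<Longrightarrow> partial a (\<phi>i q) = (\<Sum>c<n + m. G c * partial a (Y c))" by blast
    with mult.hyps show ?case
      by (intro exI[of _ "\<lambda>c. \<phi>i p * G c + \<phi>i q * F c"])
        (simp add: \<phi>i_mult \<phi>i_closed derivation.d_mult[OF partial_derivation] algebra_simps sum.distrib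
          sum_distrib_left)
  qed
  have "\<exists>F. \<forall>a<n + m. partial a (gen b) = (\<Sum>c<n + m. F c * partial a (Y c))" if "b \<in> {..<n + m}" for b
    using span[OF \<phi>_closed[OF gen_closed]] that by (simp add: \<phi>i_\<phi> gen_closed)
  then obtain F where F: "\<And>b a. b < n + m \<Longrightarrow> a < n + m \<Longrightarrow> partial a (gen b) = (\<Sum>c<n + m. F b c * partial a (Y c))"
    using bchoice[of "{..<n + m}" "\<lambda>b F. \<forall>a<n + m. partial a (gen b) = (\<Sum>c<n + m. F c * partial a (Y c))"] by blast
  have kernel: "\<theta> (pderiv_var i p) = 0" if p: "p \<in> carA" "\<theta> p = 0" and i: "i < n" for p i
  proof -
    have "(if i < n then \<Theta> (pderiv_var i p) else 0) = 0"
    proof (rule right_inverse_kernel[where P = "\<lambda>a c. partial a (Y c)" and Q = "\<lambda>c b. F b c" and N = "n + m"])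
      show "(\<Sum>c<n + m. partial a (Y c) * F b c) = (if a = b then 1 else 0)" if "a < n + m" "b < n + m" for a b
        using F[OF that(2,1)] partial_gen[OF that] by (simp add: mult.commute)
      show "(\<Sum>c<n + m. partial a (Y c) * (if c < n then \<Theta> (pderiv_var c p) else 0)) = 0" if "a < n + m" for a
      proof -
        have "\<Theta> p = 0" using p(2) by (simp add: \<Theta>_def \<phi>i_zero)
        then have "partial a (\<Theta> p) = 0" by (simp add: derivation.d_zero[OF partial_derivation])
        then show ?thesis using chain_\<Theta>[OF p(1), of a] by (simp add: mult.commute)
      qed
    qed (use i in simp)
    then have "\<phi> (\<phi>i (pconst (\<theta> (pderiv_var i p)))) = 0" using i by (simp add: \<Theta>_def \<phi>_zero)
    then show ?thesis using p(1) by (simp add: \<phi>_\<phi>i BB.pconst_mpols \<theta>_closed U.pderiv_var_mpols)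
  qed
  have "p = 0" if "p \<in> carA" "\<theta> p = 0" "\<And>k. k \<in> keys p \<Longrightarrow> weight n k < N" for p N
    using that
  proof (induction N arbitrary: p)
    case 0
    then have "keys p = {}" by blast
    then show ?case by simp
  next
    case (Suc N)
    have "pderiv_var i p = 0" if i: "i < n" for i
    proof (rule Suc.IH)
      show "weight n k < N" if "k \<in> keys (pderiv_var i p)" for k
      proof -
        have "k + single i 1 \<in> keys p" using that by (auto simp: in_keys_iff lookup_pderiv_var)
        from Suc.prems(3)[OF this] i show ?thesis
          by (simp add: weight_def lookup_add sum.distrib lookup_single when_def)
      qed
    qed (use Suc.prems kernel i U.pderiv_var_mpols in auto)
    then have p: "p = pconst (lookup p 0)"
      using pderiv_var_eq_0D[OF Suc.prems(1)] by (simp del: of_nat_Suc)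
    then have "\<iota> (lookup p 0) = 0" using Suc.prems(2) \<theta>_const by metis
    then have "const (lookup p 0) = 0"
      using \<phi>i_pconst_\<iota>[of "lookup p 0"] \<phi>i_zero by simp
    then show ?case using p by simp
  qed
  moreover have "weight n k < Suc (\<Sum>k\<in>keys f. weight n k)" if "k \<in> keys f" for k
    unfolding less_Suc_eq_le using that by (intro member_le_sum) auto
  ultimately show ?thesis using f by blast
qed

lemma bracket_antisym:
  assumes "a \<in> pcarrier B" "b \<in> pcarrier B"
  shows "pbracket B a b = - pbracket B b a"
proof -
  have "pbracket B (a + b) (a + b) = pbracket B a a + pbracket B b b + (pbracket B a b + pbracket B b a)"
    using assms by (simp add: B.bracket_add_left B.bracket_add_right BB.add ac_simps)
  then show ?thesis
    using assms by (simp add: B.bracket_self BB.add eq_neg_iff_add_eq_0)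
qed

lemmas subst_\<iota> = subst_pconst[of \<iota>, OF \<iota>_add \<iota>_mult \<iota>_one] subst_pvar[of \<iota>, OF \<iota>_add \<iota>_mult \<iota>_one]
  subst_add[of \<iota>, OF \<iota>_add \<iota>_mult \<iota>_one] subst_mult[of \<iota>, OF \<iota>_add \<iota>_mult \<iota>_one]
  subst_sum[of \<iota>, OF \<iota>_add \<iota>_mult \<iota>_one]

lemma subst_image_subring: "subring_set (subst n \<iota> y ` carA)"
proof
  show "0 \<in> subst n \<iota> y ` carA"
    by (rule image_eqI[of _ _ 0]) (simp_all add: subst_def A.zero)
  show "1 \<in> subst n \<iota> y ` carA"
    using subst_\<iota>(1)[of n y 1] by (intro image_eqI[of _ _ 1]) (simp_all add: \<iota>_one A.one)
  show "- x \<in> subst n \<iota> y ` carA" if "x \<in> subst n \<iota> y ` carA" for x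
  proof -
    from that obtain p where p: "p \<in> carA" "x = subst n \<iota> y p" by blast
    have "subst n \<iota> y p + subst n \<iota> y (- p) = 0"
      unfolding subst_\<iota>(3)[symmetric] by (simp add: subst_def)
    then have "- x = subst n \<iota> y (- p)" unfolding p(2) by (rule minus_unique)
    then show ?thesis using p(1) A.uminus by blast
  qed
  fix x x' assume "x \<in> subst n \<iota> y ` carA" "x' \<in> subst n \<iota> y ` carA"
  then obtain p q where "p \<in> carA" "x = subst n \<iota> y p" "q \<in> carA" "x' = subst n \<iota> y q" by blast
  then show "x + x' \<in> subst n \<iota> y ` carA" "x * x' \<in> subst n \<iota> y ` carA"
    using A.add A.mult by (metis subst_\<iota>(3) image_eqI, metis subst_\<iota>(4) image_eqI)
qed

lemma subst_image_\<iota>: "\<iota> c \<in> subst n \<iota> y ` carA"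
  by (rule image_eqI[of _ _ "pconst c"]) (simp_all add: subst_\<iota> U.pconst_mpols)

lemma subst_image_gen: "i < n \<Longrightarrow> y i \<in> subst n \<iota> y ` carA"
  by (rule image_eqI[of _ _ "pvar i"]) (simp_all add: subst_\<iota> U.pvar_mpols)

lemma poisson_isomorphic_if_surjective:
  assumes y: "\<And>i. i < n \<Longrightarrow> y i \<in> pcarrier B"
    and y_br: "\<And>i j. i < n \<Longrightarrow> j < n \<Longrightarrow> pbracket B (y i) (y j) = (\<Sum>c<n. \<iota> (C i j c) * y c)"
    and surj: "pcarrier B \<subseteq> subst n \<iota> y ` carA"
  shows "poisson_isomorphic A B"
proof -
  define \<theta> where "\<theta> = subst n \<iota> y"
  note hom = subst_\<iota>[where n = n and y = y, folded \<theta>_def]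
  have closed: "\<theta> p \<in> pcarrier B" if "p \<in> carA" for p
    using that by (induction rule: U.mpols_induct) (simp_all add: hom \<iota>_closed y BB.add BB.mult)
  have \<theta>1: "\<theta> 1 = 1" using hom(1)[of 1] by (simp add: \<iota>_one)
  have inj: "inj_on \<theta> carA"
  proof (rule inj_onI)
    fix p q assume pq: "p \<in> carA" "q \<in> carA" "\<theta> p = \<theta> q"
    have "\<theta> (q + (p - q)) = \<theta> q + \<theta> (p - q)" by (rule hom)
    then have "\<theta> (p - q) = 0" using pq by simp
    then have "p - q = 0"
      using surj pq by (intro surjective_imp_injective[of \<theta>] closed hom A.diff) (simp_all add: \<theta>_def)
    then show "p = q" by simp
  qed
  have left: "pbracket B (\<theta> p) b = (\<Sum>i<n. \<theta> (pderiv_var i p) * pbracket B (y i) b)"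
    if p: "p \<in> carA" and b: "b \<in> pcarrier B" for p b
  proof -
    have "pbracket B (\<theta> p) b = (\<Sum>i<n. \<theta> (pderiv_var i p) * pbracket B (\<theta> (pvar i)) b)"
      using p by (rule U.chain_rule)
        (use b \<iota>_centre in \<open>simp_all add: \<theta>1 hom closed B.bracket_add_left B.bracket_mult_left centre_def\<close>)
    also have "\<dots> = (\<Sum>i<n. \<theta> (pderiv_var i p) * pbracket B (y i) b)"
      by (intro sum.cong refl) (simp add: hom)
    finally show ?thesis .
  qed
  have right: "pbracket B b (\<theta> q) = (\<Sum>j<n. \<theta> (pderiv_var j q) * pbracket B b (y j))"
    if q: "q \<in> carA" and b: "b \<in> pcarrier B" for q b
    unfolding bracket_antisym[OF b closed[OF q]] left[OF q b] sum_negf[symmetric]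
    by (intro sum.cong refl) (simp add: bracket_antisym[OF y b])
  have br: "\<theta> (br p q) = pbracket B (\<theta> p) (\<theta> q)" if p: "p \<in> carA" and q: "q \<in> carA" for p q
  proof -
    have "pbracket B (\<theta> p) (\<theta> q) = (\<Sum>i<n. \<Sum>j<n. \<theta> (pderiv_var i p) * (\<theta> (pderiv_var j q) * pbracket B (y i) (y j)))"
      unfolding left[OF p closed[OF q]] by (intro sum.cong refl) (simp add: right[OF q y] sum_distrib_left)
    also have "\<dots> = (\<Sum>i<n. \<Sum>j<n. \<theta> (pderiv_var i p * pderiv_var j q * \<pi> i j))"
      by (intro sum.cong refl) (simp add: hom y_br \<pi>_def mult.assoc)
    also have "\<dots> = \<theta> (br p q)"
      by (simp add: br_def hom(5))
    finally show ?thesis by simp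
  qed
  have "poisson_iso A B \<theta>"
    unfolding poisson_iso_def A_sel
  proof (intro conjI ballI allI)
    show "bij_betw \<theta> carA (pcarrier B)"
      using inj surj closed unfolding bij_betw_def \<theta>_def by blast
  qed (use closed in \<open>simp_all add: \<theta>1 hom br scale_eq\<close>)
  then show ?thesis by (auto simp: poisson_isomorphic_def)
qed

lemma \<psi>_gen_br:
  assumes "i < n" "j < n"
  shows "pbracket B (\<psi> (pconst (pvar i))) (\<psi> (pconst (pvar j))) = (\<Sum>c<n. \<iota> (C i j c) * \<psi> (pconst (pvar c)))"
  using assms by (simp add: \<psi>_br U.pvar_mpols br_pvar_pvar) (simp add: \<pi>_def \<psi>_linear)

lemma gen_R: "i < n \<Longrightarrow> pconst (pvar i) \<in> R"
  by (intro A.pconst_mpols U.pvar_mpols)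

text \<open>
  The Jacobian matrices of the \<open>t\<^sub>j\<close> with respect to the \<open>s\<^sub>i\<close>, and conversely, are inverse to each
  other, so that central elements of \<open>B\<close> have coefficients in \<open>A\<close>.
\<close>
lemma poisson_isomorphic_if_casimirs_fixed:
  assumes EZ: "\<And>i z. i < m \<Longrightarrow> z \<in> casimirs \<Longrightarrow> E i (pconst z) = 0"
  shows "poisson_isomorphic A B"
proof (rule poisson_isomorphic_if_surjective)
  define y where "y i = \<psi> (pconst (pvar i))" for i
  let ?T = "subst n \<iota> y ` carA"
  have \<theta>: "subst n \<iota> y p = \<psi> (pconst p)" if "p \<in> carA" for p
    using that
    by (induction rule: U.mpols_induct)
      (simp_all add: subst_\<iota> \<psi>_const y_def pconst_add pconst_mult \<psi>_add \<psi>_mult A.pconst_mpols)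
  have chain: "E i c = (\<Sum>j<m. pderiv_var j c * E i (pvar j))" if c: "c \<in> mpols casimirs m" and i: "i < m" for c i
    using c by (rule Z.chain_rule[where \<Theta> = "\<lambda>c. c"])
      (simp_all add: casimirs_R E.d_add E.d_mult EZ i)
  have "b \<in> ?T" if b: "b \<in> centre" for b
  proof -
    define c where "c = \<phi>i (pconst b)"
    have c: "c \<in> mpols casimirs m"
      unfolding c_def by (intro \<phi>i_centre ZB.pconst_mpols b)
    have "pderiv_var j c = 0" if "j < m" for j
    proof (rule right_inverse_kernel[where P = "\<lambda>i j. E i (pvar j)" and N = m
          and Q = "\<lambda>j k. pderiv_var j (\<phi>i (pvar k))"])
      show "(\<Sum>j<m. E i (pvar j) * pderiv_var j (\<phi>i (pvar k))) = (if i = k then 1 else 0)"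
        if "i < m" "k < m" for i k
        using chain[OF \<phi>i_centre[OF ZB.pvar_mpols[OF that(2)]] that(1)] E_\<sigma>[OF that(2), of i]
        by (auto simp: mult.commute)
      show "(\<Sum>j<m. E i (pvar j) * pderiv_var j c) = 0" if "i < m" for i
        using chain[OF c that] E_\<phi>i_pconst[OF centre_closed[OF b]] by (simp add: c_def mult.commute)
    qed (fact that)
    then have c0: "c = pconst (lookup c 0)"
      using pderiv_var_eq_0D[OF c] by (simp del: of_nat_Suc)
    have "b = \<psi> c"
      using b by (simp add: c_def \<psi>_def \<phi>_\<phi>i BB.pconst_mpols centre_closed lookup_pconst)
    also have "\<dots> = subst n \<iota> y (lookup c 0)"
      using \<theta> casimirs_mpols Z.lookup_mpols[OF c] c0 by metis
    finally show "b \<in> ?T" using casimirs_mpols Z.lookup_mpols[OF c] by blast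
  qed
  then show "pcarrier B \<subseteq> ?T"
    using subst_image_gen[of _ y]
    by (intro generated_by_images subst_image_subring subst_image_\<iota>)
      (auto simp: y_def intro!: \<psi>_centre Z.pvar_mpols)
  show "y i \<in> pcarrier B" if "i < n" for i
    using that by (simp add: y_def \<psi>_closed gen_R)
  show "pbracket B (y i) (y j) = (\<Sum>c<n. \<iota> (C i j c) * y c)" if "i < n" "j < n" for i j
    using that by (simp add: y_def \<psi>_gen_br)
qed


definition rad :: "'k mpol \<Rightarrow> 'k mpol mpol set" where
  "rad f = {r \<in> R. \<exists>K. \<exists>V\<in>R. r ^ K = pconst f * V}"

lemma rad_mult: "s \<in> R \<Longrightarrow> r \<in> rad f \<Longrightarrow> s * r \<in> rad f"
proof -
  assume s: "s \<in> R" and "r \<in> rad f"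
  then obtain K V where r: "r \<in> R" and V: "V \<in> R" "r ^ K = pconst f * V" by (auto simp: rad_def)
  have "(s * r) ^ K = pconst f * (s ^ K * V)"
    by (simp add: power_mult_distrib V)
  then show ?thesis using r s V by (auto simp: rad_def R.mult intro: R.mult R.power)
qed

lemma rad_zero: "0 \<in> rad f"
  unfolding rad_def using R.zero by (auto intro!: exI[of _ 1] bexI[of _ 0])

lemma rad_add:
  assumes "r \<in> rad f" "s \<in> rad f"
  shows "r + s \<in> rad f"
proof -
  from assms obtain K V L W where r: "r \<in> R" "V \<in> R" "r ^ K = pconst f * V"
    and s: "s \<in> R" "W \<in> R" "s ^ L = pconst f * W"
    by (auto simp: rad_def)
  define G where "G k = of_nat ((K + L) choose k) *
     (if K \<le> k then V * r ^ (k - K) * s ^ (K + L - k) else r ^ k * W * s ^ (K - k))" for k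
  have "(r + s) ^ (K + L) = (\<Sum>k\<le>K + L. of_nat ((K + L) choose k) * r ^ k * s ^ (K + L - k))"
    by (rule binomial_ring)
  also have "\<dots> = (\<Sum>k\<le>K + L. pconst f * G k)"
  proof (rule sum.cong)
    fix k assume "k \<in> {..K + L}"
    show "of_nat ((K + L) choose k) * r ^ k * s ^ (K + L - k) = pconst f * G k"
    proof (cases "K \<le> k")
      case True
      then have "r ^ k = pconst f * V * r ^ (k - K)"
        by (metis r(3) le_add_diff_inverse power_add)
      then show ?thesis using True by (simp add: G_def ac_simps)
    next
      case False
      then have "K + L - k = L + (K - k)" by simp
      then have "s ^ (K + L - k) = pconst f * W * s ^ (K - k)"
        by (simp only: power_add s(3))
      then show ?thesis using False by (simp add: G_def ac_simps)
    qed
  qed simp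
  also have "\<dots> = pconst f * (\<Sum>k\<le>K + L. G k)"
    by (simp add: sum_distrib_left)
  finally have "(r + s) ^ (K + L) = pconst f * (\<Sum>k\<le>K + L. G k)" .
  moreover have "(\<Sum>k\<le>K + L. G k) \<in> R"
    unfolding G_def using r s by (auto intro!: R.sum R.mult R.of_nat R.power)
  ultimately show ?thesis
    using r s by (auto simp: rad_def R.add)
qed

lemma rad_sum: "(\<And>i. i \<in> I \<Longrightarrow> g i \<in> rad f) \<Longrightarrow> sum g I \<in> rad f"
  by (induction I rule: infinite_finite_induct) (auto simp: rad_zero rad_add)

lemma homog_comp_0_eq:
  assumes "p \<in> carA"
  shows "homog_comp n 0 p = pconst (lookup p 0)"
proof (rule poly_mapping_eqI)
  fix k
  have "k = 0" if "k \<in> keys p" "weight n k = 0"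
  proof (rule poly_mapping_eqI)
    fix i
    show "lookup k i = lookup 0 i"
      using that assms by (cases "i < n") (auto simp: weight_def mpols_def in_keys_iff subset_iff)
  qed
  then show "lookup (homog_comp n 0 p) k = lookup (pconst (lookup p 0)) k"
    by (auto simp: lookup_homog_comp lookup_pconst in_keys_iff weight_def)
qed

lemma casimir_coefficients_rad:
  assumes f: "f \<in> casimirs" "f \<noteq> 0" "d > 0" "euler n f = of_nat d * f"
    and U: "U \<in> mpols casimirs m" "\<And>\<beta>. lookup (lookup U \<beta>) 0 = 0"
  shows "U \<in> rad f"
proof -
  have comp: "pconst (homog_comp n j (lookup U \<beta>)) \<in> rad f" for j \<beta>
  proof (cases "j = 0")
    case True
    have z: "lookup U \<beta> \<in> carA" using Z.lookup_mpols[OF U(1)] by (rule casimirs_mpols)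
    then have "homog_comp n j (lookup U \<beta>) = 0"
      using True U(2) by (simp add: homog_comp_0_eq)
    then show ?thesis by (simp add: rad_zero)
  next
    case False
    define g where "g = homog_comp n j (lookup U \<beta>)"
    have g: "g \<in> casimirs" "euler n g = of_nat j * g"
      using homog_comp_casimirs[OF Z.lookup_mpols[OF U(1)]] by (auto simp: g_def euler_homog_comp)
    obtain c where "g ^ d = pconst c * f ^ j"
      using homogeneous_casimir_powers[OF f(1,4) g f(3) _ f(2)] False by blast
    then have "g ^ d = f * (pconst c * f ^ (j - 1))"
      using False by (cases j) (simp_all add: ac_simps)
    then have "pconst g ^ d = pconst f * pconst (pconst c * f ^ (j - 1))"
      by (metis pconst_mult pconst_power)
    moreover have "pconst (pconst c * f ^ (j - 1)) \<in> R" "pconst g \<in> R"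
      by (intro A.pconst_mpols A.mult U.pconst_mpols UNIV_I A.power casimirs_mpols f(1) g(1))+
    ultimately show ?thesis unfolding rad_def g_def[symmetric] by blast
  qed
  have "pconst (lookup U \<beta>) \<in> rad f" for \<beta>
  proof -
    obtain N where "lookup U \<beta> = (\<Sum>j<N. homog_comp n j (lookup U \<beta>))" by (rule sum_homog_comps)
    then have "pconst (lookup U \<beta>) = (\<Sum>j<N. pconst (homog_comp n j (lookup U \<beta>)))"
      by (metis pconst_sum)
    then show ?thesis using comp by (simp add: rad_sum)
  qed
  then have "single \<beta> 1 * pconst (lookup U \<beta>) \<in> rad f" if "\<beta> \<in> keys U" for \<beta>
    using that U(1) by (intro rad_mult A.single_mpols A.one) (auto simp: mpols_def)
  then have "(\<Sum>\<beta>\<in>keys U. single \<beta> 1 * pconst (lookup U \<beta>)) \<in> rad f"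
    by (rule rad_sum)
  also have "(\<Sum>\<beta>\<in>keys U. single \<beta> 1 * pconst (lookup U \<beta>)) = U"
    by (simp add: pconst_def mult_single sum_monomials)
  finally show ?thesis .
qed

lemma \<phi>i_br: "r \<in> RB \<Longrightarrow> s \<in> RB \<Longrightarrow> extbr (pbracket B) r s \<in> RB \<and> \<phi>i (extbr (pbracket B) r s) = extbr br (\<phi>i r) (\<phi>i s)"
  using \<phi>_br[of "\<phi>i r" "\<phi>i s"] extbr_R[of "\<phi>i r" "\<phi>i s"]
  by (metis \<phi>_\<phi>i \<phi>i_\<phi> \<phi>i_closed \<phi>_closed)

text \<open>
  The characters of \<open>B\<close> obtained by setting \<open>x = 0\<close> in \<open>A[t\<^sub>1, \<dots>, t\<^sub>m]\<close> have values in \<open>k[t\<^sub>1, \<dots>, t\<^sub>m]\<close>;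
  extending them to \<open>B[s\<^sub>1, \<dots>, s\<^sub>m]\<close> and restricting to \<open>A\<close> gives characters of \<open>A\<close> at which \<open>f\<close> vanishes.
\<close>
lemma E_homogeneous_casimir:
  assumes f: "f \<in> casimirs" "f \<noteq> 0" "d > 0" "euler n f = of_nat d * f" and i: "i < m"
    and no_summand: "\<And>v l. \<not> central_summand v l"
  shows "E i (pconst f) = 0"
proof -
  define \<chi> :: "'k mpol mpol \<Rightarrow> 'k mpol" where "\<chi> = Poly_Mapping.map (\<lambda>a. lookup a 0)"
  define \<chi>B where "\<chi>B b = \<chi> (\<phi>i (pconst b))" for b
  define \<eta> where "\<eta> p = Poly_Mapping.map \<chi>B (\<phi> (pconst p))" for p
  have fA: "f \<in> carA" using f(1) by (rule casimirs_mpols)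
  have \<chi>_add: "\<chi> (r + s) = \<chi> r + \<chi> s" and \<chi>_mult: "\<chi> (r * s) = \<chi> r * \<chi> s" if "r \<in> R" "s \<in> R" for r s
    unfolding \<chi>_def using that
    by (simp_all add: map_add[OF A.subring_set_axioms] map_mult[OF A.subring_set_axioms] lookup_add lookup_mult_0)
  have \<chi>_pconst: "\<chi> (pconst a) = pconst (lookup a 0)" for a
    by (simp add: \<chi>_def map_pconst)
  have \<chi>_br: "\<chi> (extbr br r s) = 0" if "r \<in> R" "s \<in> R" for r s
  proof (rule poly_mapping_eqI)
    fix k
    have "lookup (lookup (extbr br r s) k) 0 = 0"
      unfolding extbr_def lookup_sum
      by (intro sum.neutral ballI) (auto simp: lookup_single when_def lookup_br_0)
    then show "lookup (\<chi> (extbr br r s)) k = lookup 0 k"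
      by (simp add: \<chi>_def lookup_map_zero)
  qed
  have \<chi>B_add: "\<chi>B (a + b) = \<chi>B a + \<chi>B b" and \<chi>B_mult: "\<chi>B (a * b) = \<chi>B a * \<chi>B b"
    if "a \<in> pcarrier B" "b \<in> pcarrier B" for a b
    using that by (simp_all add: \<chi>B_def pconst_add pconst_mult \<phi>i_add \<phi>i_mult BB.pconst_mpols \<chi>_add \<chi>_mult \<phi>i_closed)
  have \<chi>B_\<iota>: "\<chi>B (\<iota> c) = pconst c" for c
    by (simp add: \<chi>B_def \<phi>i_pconst_\<iota> \<chi>_pconst lookup_pconst)
  have \<chi>B_br: "\<chi>B (pbracket B a b) = 0" if "a \<in> pcarrier B" "b \<in> pcarrier B" for a b
  proof -
    have "pconst (pbracket B a b) = extbr (pbracket B) (pconst a) (pconst b)"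
      using extbr_pconst[of "pcarrier B" "pbracket B", OF BB.zero B.bracket_zero_left B.bracket_zero_right] that by simp
    then have "\<chi>B (pbracket B a b) = \<chi> (extbr br (\<phi>i (pconst a)) (\<phi>i (pconst b)))"
      using \<phi>i_br[OF BB.pconst_mpols BB.pconst_mpols] that by (simp add: \<chi>B_def)
    then show ?thesis using that by (simp add: \<chi>_br \<phi>i_closed BB.pconst_mpols)
  qed
  have \<chi>B_0: "\<chi>B 0 = 0" using \<chi>B_add[OF BB.zero BB.zero] by simp
  have \<chi>B_sum: "\<chi>B (sum g I) = (\<Sum>j\<in>I. \<chi>B (g j))" if "\<And>j. j \<in> I \<Longrightarrow> g j \<in> pcarrier B" for g and I :: "(nat \<Rightarrow>\<^sub>0 nat) set"
    by (rule additive_sum[of "pcarrier B" \<chi>B I g, OF BB.subring_set_axioms \<chi>B_add that])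
  have "\<eta> f = 0"
  proof (rule ccontr)
    assume nz: "\<eta> f \<noteq> 0"
    have \<phi>p: "\<phi> (pconst p) \<in> RB" if "p \<in> carA" for p
      using that by (intro \<phi>_closed A.pconst_mpols)
    have \<eta>_add: "\<eta> (p + q) = \<eta> p + \<eta> q" and \<eta>_mult: "\<eta> (p * q) = \<eta> p * \<eta> q"
      if "p \<in> carA" "q \<in> carA" for p q
      unfolding \<eta>_def using that
      by (simp_all add: pconst_add pconst_mult \<phi>_add \<phi>_mult A.pconst_mpols
          map_add[OF BB.subring_set_axioms \<chi>B_add \<phi>p \<phi>p]
          map_mult[OF BB.subring_set_axioms \<chi>B_add \<chi>B_mult \<phi>p \<phi>p])
    have \<eta>_const: "\<eta> (pconst c) = const c" for c
      by (simp add: \<eta>_def \<phi>_const map_pconst \<chi>B_0 \<chi>B_\<iota>)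
    have \<eta>_\<pi>: "\<eta> (\<pi> a b) = 0" if ab: "a < n" "b < n" for a b
    proof (rule poly_mapping_eqI)
      fix k
      define r s where "r = \<phi> (pconst (pvar a))" and "s = \<phi> (pconst (pvar b))"
      have rs: "r \<in> RB" "s \<in> RB" using ab by (simp_all add: r_def s_def \<phi>p U.pvar_mpols)
      have "\<phi> (pconst (\<pi> a b)) = \<phi> (extbr br (pconst (pvar a)) (pconst (pvar b)))"
        using extbr_pconst[of carA br] ab by (simp add: br_pvar_pvar A.zero U.pvar_mpols)
      also have "\<dots> = extbr (pbracket B) r s"
        using ab by (simp add: \<phi>_br gen_R r_def s_def)
      finally have "lookup (\<eta> (\<pi> a b)) k = \<chi>B (lookup (extbr (pbracket B) r s) k)"
        by (simp add: \<eta>_def lookup_map_zero \<chi>B_0)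
      also have "\<dots> = (\<Sum>\<mu>\<in>keys r. \<Sum>\<nu>\<in>keys s. \<chi>B (if \<mu> + \<nu> = k then pbracket B (lookup r \<mu>) (lookup s \<nu>) else 0))"
        unfolding extbr_def lookup_sum lookup_single when_def
        by (subst \<chi>B_sum, force intro!: BB.sum simp: BB.zero B.bracket_closed BB.lookup_mpols[OF rs(1)] BB.lookup_mpols[OF rs(2)],
            rule sum.cong[OF refl], subst \<chi>B_sum)
          (auto simp: BB.zero B.bracket_closed BB.lookup_mpols[OF rs(1)] BB.lookup_mpols[OF rs(2)])
      also have "\<dots> = 0"
        using \<chi>B_br \<chi>B_0 BB.lookup_mpols[OF rs(1)] BB.lookup_mpols[OF rs(2)]
        by (intro sum.neutral ballI) auto
      finally show "lookup (\<eta> (\<pi> a b)) k = lookup 0 k" by simp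
    qed
    obtain v l where "central_summand v l"
      by (rule character_nonzero_imp_central_summand[OF f(1,3,4) \<eta>_add \<eta>_mult \<eta>_const \<eta>_\<pi> nz])
    with no_summand show False by blast
  qed
  have fR: "pconst f \<in> mpols casimirs m" using f(1) by (rule Z.pconst_mpols)
  have "\<phi> (pconst f) \<noteq> 0"
    using \<phi>_inj[OF casimirs_R[OF fR] R.zero] f(2) by (auto simp: \<phi>_zero)
  then obtain \<gamma> where \<gamma>: "lookup (\<phi> (pconst f)) \<gamma> \<noteq> 0"
    by (metis poly_mapping_eqI lookup_zero)
  define u where "u = lookup (\<phi> (pconst f)) \<gamma>"
  define U where "U = \<phi>i (pconst u)"
  have u: "u \<in> centre"
    unfolding u_def using fR by (intro ZB.lookup_mpols[of _ m]) (simp add: \<phi>_centre_iff casimirs_R)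
  have UZ: "U \<in> mpols casimirs m"
    unfolding U_def by (intro \<phi>i_centre ZB.pconst_mpols u)
  have UR: "U \<in> R" using UZ by (rule casimirs_R)
  have "U \<noteq> 0"
    using \<gamma> \<phi>_\<phi>i[OF BB.pconst_mpols[OF centre_closed[OF u]]] by (auto simp: U_def u_def[symmetric] \<phi>_zero)
  have "\<chi> U = lookup (\<eta> f) \<gamma>"
    unfolding \<eta>_def lookup_map_zero[of \<chi>B, OF \<chi>B_0] by (simp add: U_def \<chi>B_def u_def)
  with \<open>\<eta> f = 0\<close> have "\<chi> U = 0" by simp
  then have "lookup (lookup U \<beta>) 0 = 0" for \<beta>
    by (metis (no_types, lifting) \<chi>_def lookup_map_zero lookup_zero)
  then have "U \<in> rad f" using casimir_coefficients_rad[OF f UZ] by blast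
  then obtain K V where V: "V \<in> R" "U ^ K = pconst f * V" by (auto simp: rad_def)
  have "E i U = 0"
    using E_\<phi>i_pconst[OF centre_closed[OF u]] by (simp add: U_def)
  then have "E i (U ^ K) = 0"
    using E.d_power[OF UR] E.d_one by (cases K) (simp_all del: power_Suc)
  then have "E i (pconst f * V) = 0" by (simp only: V(2))
  moreover have "V \<noteq> 0"
  proof
    assume "V = 0"
    then have "U ^ K = 0" using V(2) by simp
    with \<open>U \<noteq> 0\<close> show False by (metis power_not_zero)
  qed
  moreover have "pconst f \<noteq> (0 :: 'k mpol mpol)" using f(2) by simp
  ultimately show ?thesis
    using E.kernel_factorially_closed[OF casimirs_R[OF fR] V(1)] by blast
qed

lemma E_casimirs:
  assumes f: "f \<in> casimirs" "f \<noteq> 0" "d > 0" "euler n f = of_nat d * f" and Ef: "E i (pconst f) = 0"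
    and z: "z \<in> casimirs"
  shows "E i (pconst z) = 0"
proof -
  obtain j where j: "j < n" "pderiv_var j f \<noteq> 0"
  proof (rule ccontr)
    assume "\<not> thesis"
    with that have "euler n f = 0" unfolding euler_def by (intro sum.neutral) auto
    with f show False by simp
  qed
  have chain: "E i (pconst p) = (\<Sum>a<n. pconst (pderiv_var a p) * E i (pconst (pvar a)))" if "p \<in> carA" for p
    using that by (rule U.chain_rule[where E = "\<lambda>p. E i (pconst p)"])
      (simp_all add: pconst_add pconst_mult A.pconst_mpols E.d_add E.d_mult E_const)
  have "pconst (pderiv_var j f) * E i (pconst z) =
      (\<Sum>a<n. pconst (pderiv_var j f * pderiv_var a z) * E i (pconst (pvar a)))"
    unfolding chain[OF casimirs_mpols[OF z]] by (simp add: sum_distrib_left pconst_mult mult.assoc)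
  also have "\<dots> = (\<Sum>a<n. pconst (pderiv_var j z * pderiv_var a f) * E i (pconst (pvar a)))"
    using casimirs_parallel_gradients[OF f(1) z j(1)]
    by (intro sum.cong refl) (simp add: mult.commute)
  also have "\<dots> = pconst (pderiv_var j z) * E i (pconst f)"
    unfolding chain[OF casimirs_mpols[OF f(1)]] by (simp add: sum_distrib_left pconst_mult mult.assoc)
  finally show ?thesis using j Ef by simp
qed

text \<open>
  If the Lie algebra is \<open>\<hh> \<oplus> k v\<close>, with \<open>l\<close> vanishing on \<open>\<hh>\<close> and \<open>l v = 1\<close>, then the centre of
  \<open>A[t\<^sub>1, \<dots>, t\<^sub>m]\<close> is \<open>k[v, t\<^sub>1, \<dots>, t\<^sub>m]\<close>, so the centre of \<open>B\<close> is some \<open>k[w]\<close>, and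
  \<open>x \<mapsto> \<psi> x + l x * (w - \<psi> v)\<close> is an isomorphism.
\<close>
lemma poisson_isomorphic_if_central_summand:
  assumes "central_summand v l"
  shows "poisson_isomorphic A B"
proof -
  have vC: "(\<Sum>a<n. v a * C a b c) = 0" if "b < n" "c < n" for b c
    using assms that by (simp add: central_summand_def)
  have Cl: "(\<Sum>c<n. C a b c * l c) = 0" if "a < n" "b < n" for a b
    using assms that by (simp add: central_summand_def)
  have vl: "(\<Sum>a<n. v a * l a) = 1"
    using assms by (simp add: central_summand_def)
  define V where "V = (\<Sum>a<n. pconst (v a) * pvar a)"
  define Dv :: "'k mpol \<Rightarrow> 'k mpol" where "Dv p = (\<Sum>a<n. pconst (l a) * pderiv_var a p)" for p
  have dV: "pderiv_var a V = pconst (v a)" if "a < n" for a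
    using that unfolding V_def pderiv_var_sum pderiv_var_pconst_mult pderiv_var_pvar
    by (simp add: if_distrib[of "\<lambda>x. _ * x"] cong: if_cong)
  have V: "V \<in> casimirs"
  proof -
    have "hamilton b V = 0" if "b < n" for b
    proof -
      have "hamilton b V = (\<Sum>a<n. \<Sum>c<n. pconst (v a * C a b c) * pvar c)"
        unfolding hamilton_def \<pi>_def sum_distrib_left
        by (intro sum.cong refl) (simp add: dV pconst_mult mult.assoc)
      also have "\<dots> = (\<Sum>c<n. pconst (\<Sum>a<n. v a * C a b c) * pvar c)"
        unfolding pconst_sum sum_distrib_right by (rule sum.swap)
      also have "\<dots> = 0" using vC that by simp
      finally show ?thesis .
    qed
    moreover have "V \<in> carA"
      unfolding V_def by (intro A.sum A.mult U.pconst_mpols U.pvar_mpols) auto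
    ultimately show ?thesis by (simp add: casimirs_def)
  qed
  have DvV: "Dv V = 1"
  proof -
    have "Dv V = pconst (\<Sum>a<n. v a * l a)"
      unfolding Dv_def pconst_sum by (intro sum.cong refl) (simp add: dV pconst_mult mult.commute)
    then show ?thesis by (simp add: vl)
  qed
  have Dv_pconst: "Dv (pconst c) = 0" for c by (simp add: Dv_def)
  have Dv0: "Dv 0 = 0" by (simp add: Dv_def)
  have Dv_casimirs: "Dv p \<in> casimirs" if p: "p \<in> casimirs" for p
  proof -
    have "hamilton b (Dv p) = 0" if b: "b < n" for b
    proof -
      have e: "(\<Sum>a<n. pderiv_var e (pderiv_var a p) * \<pi> a b) = - (\<Sum>a<n. pderiv_var a p * pconst (C a b e))"
        if e: "e < n" for e
      proof -
        have "0 = pderiv_var e (hamilton b p)"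
          using p b by (simp add: casimirs_def)
        also have "\<dots> = (\<Sum>a<n. pderiv_var a p * pconst (C a b e)) + (\<Sum>a<n. pderiv_var e (pderiv_var a p) * \<pi> a b)"
          using e by (simp add: hamilton_def pderiv_var_sum pderiv_var_mult pderiv_\<pi> sum.distrib)
        finally show ?thesis by (rule minus_unique[symmetric, OF sym])
      qed
      have "hamilton b (Dv p) = (\<Sum>a<n. \<Sum>e<n. pconst (l e) * (pderiv_var e (pderiv_var a p) * \<pi> a b))"
        unfolding hamilton_def Dv_def pderiv_var_sum pderiv_var_pconst_mult sum_distrib_right
        by (intro sum.cong refl) (subst pderiv_var_commute, simp only: mult.assoc)
      also have "\<dots> = (\<Sum>e<n. pconst (l e) * (\<Sum>a<n. pderiv_var e (pderiv_var a p) * \<pi> a b))"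
        unfolding sum_distrib_left by (rule sum.swap)
      also have "\<dots> = (\<Sum>e<n. - (\<Sum>a<n. pderiv_var a p * pconst (C a b e * l e)))"
      proof (intro sum.cong refl)
        fix i assume "i \<in> {..<n}"
        then show "pconst (l i) * (\<Sum>a<n. pderiv_var i (pderiv_var a p) * \<pi> a b) =
            - (\<Sum>a<n. pderiv_var a p * pconst (C a b i * l i))"
          by (simp add: e sum_distrib_left pconst_mult ac_simps)
      qed
      also have "\<dots> = - (\<Sum>a<n. pderiv_var a p * pconst (\<Sum>e<n. C a b e * l e))"
        unfolding sum_negf pconst_sum sum_distrib_left by (subst sum.swap) rule
      also have "\<dots> = 0" using Cl b by simp
      finally show ?thesis .
    qed
    moreover have "Dv p \<in> carA"
      unfolding Dv_def using casimirs_mpols[OF p]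
      by (intro A.sum A.mult U.pconst_mpols U.pderiv_var_mpols) auto
    ultimately show ?thesis by (simp add: casimirs_def)
  qed
  interpret Dv: derivation casimirs Dv
  proof
    show "Dv (p + q) = Dv p + Dv q" "Dv (p * q) = p * Dv q + Dv p * q" for p q
      by (simp_all add: Dv_def pderiv_var_add pderiv_var_mult algebra_simps sum.distrib sum_distrib_left)
  qed (rule Dv_casimirs)
  have "V \<noteq> 0" using DvV Dv0 by auto
  have euler_V: "euler n V = of_nat 1 * V"
  proof -
    have "euler n V = (\<Sum>a<n. pvar a * pconst (v a))"
      unfolding euler_def by (intro sum.cong refl) (simp add: dV)
    then show ?thesis by (simp add: V_def mult.commute)
  qed
  have casimirs_V: "\<exists>N c. z = (\<Sum>j<N. pconst (c j) * V ^ j)" if z: "z \<in> casimirs" for z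
  proof -
    have "\<exists>c. homog_comp n j z = pconst c * V ^ j" for j
    proof (cases "j = 0")
      case True
      then show ?thesis
        using homog_comp_0_eq[OF casimirs_mpols[OF z]] by auto
    next
      case False
      show ?thesis
      proof (rule homogeneous_casimirs_proportional[of "V ^ j" j "homog_comp n j z"])
        show "euler n (V ^ j) = of_nat j * V ^ j"
          using euler_power[OF euler_V, of j] by simp
      qed (use False V \<open>V \<noteq> 0\<close> z in \<open>auto intro: Z.power homog_comp_casimirs simp: euler_homog_comp\<close>)
    qed
    then obtain c where c: "\<And>j. homog_comp n j z = pconst (c j) * V ^ j" by metis
    obtain N where "z = (\<Sum>j<N. homog_comp n j z)" by (rule sum_homog_comps)
    then show ?thesis unfolding c by blast
  qed
  let ?S = "mpols casimirs m"
  interpret S: subring_set ?S by (rule Z.mpols_subring)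
  have constS: "const c \<in> ?S" for c by (intro Z.pconst_mpols pconst_casimirs)
  have WS: "pconst V \<in> ?S" by (intro Z.pconst_mpols V)
  define d where "d a = (case a of 0 \<Rightarrow> Poly_Mapping.map Dv | Suc j \<Rightarrow> pderiv_var j)" for a
  define X where "X a = (case a of 0 \<Rightarrow> pconst V | Suc j \<Rightarrow> pvar j)" for a
  interpret mDv: derivation ?S "Poly_Mapping.map Dv"
    by (rule map_derivation[OF Dv.derivation_axioms])
  have Dv_pvar: "Poly_Mapping.map Dv (pvar j) = 0" for j
    by (rule poly_mapping_eqI) (use Dv_pconst[of 1] in \<open>simp add: lookup_map_zero Dv0 pvar_def lookup_single when_def\<close>)
  have nilpotent: "locally_nilpotent ?S (Poly_Mapping.map Dv)"
  proof
    fix r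
    have *: "\<exists>\<mu>'. weight n \<mu>' = weight n \<mu> + k \<and> lookup (lookup r \<beta>) \<mu>' \<noteq> 0"
      if "lookup (lookup ((Poly_Mapping.map Dv ^^ k) r) \<beta>) \<mu> \<noteq> 0" for k \<beta> \<mu>
      using that
    proof (induction k arbitrary: \<mu>)
      case (Suc k)
      have "lookup (Dv (lookup ((Poly_Mapping.map Dv ^^ k) r) \<beta>)) \<mu> \<noteq> 0"
        using Suc.prems by (simp add: lookup_map_zero Dv0)
      then obtain a where a: "a < n" "lookup (lookup ((Poly_Mapping.map Dv ^^ k) r) \<beta>) (\<mu> + single a 1) \<noteq> 0"
        unfolding Dv_def lookup_sum
        by (metis (no_types, lifting) lessThan_iff lookup_pconst_mult lookup_pderiv_var mult_zero_right sum.neutral)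
      moreover have "weight n (\<mu> + single a 1) = Suc (weight n \<mu>)"
        using a(1) by (simp add: weight_def lookup_add sum.distrib lookup_single when_def)
      ultimately show ?case using Suc.IH by fastforce
    qed auto
    define k where "k = Suc (\<Sum>\<beta>\<in>keys r. \<Sum>\<mu>\<in>keys (lookup r \<beta>). weight n \<mu>)"
    have bound: "weight n \<mu> < k" if "lookup (lookup r \<beta>) \<mu> \<noteq> 0" for \<beta> \<mu>
    proof -
      have \<beta>: "\<beta> \<in> keys r" and \<mu>: "\<mu> \<in> keys (lookup r \<beta>)" using that by (auto simp: in_keys_iff)
      have "weight n \<mu> \<le> (\<Sum>\<mu>\<in>keys (lookup r \<beta>). weight n \<mu>)"
        using \<mu> by (intro member_le_sum) auto
      also have "\<dots> \<le> (\<Sum>\<beta>\<in>keys r. \<Sum>\<mu>\<in>keys (lookup r \<beta>). weight n \<mu>)"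
        using \<beta> by (intro member_le_sum[of \<beta>]) auto
      finally show ?thesis by (simp add: k_def)
    qed
    have "(Poly_Mapping.map Dv ^^ k) r = 0"
    proof (intro poly_mapping_eqI)
      fix \<beta> \<mu>
      show "lookup (lookup ((Poly_Mapping.map Dv ^^ k) r) \<beta>) \<mu> = lookup (lookup 0 \<beta>) \<mu>"
        using *[of k \<beta> \<mu>] bound by fastforce
    qed
    then show "\<exists>k. (Poly_Mapping.map Dv ^^ k) r = 0" ..
  qed
  have chain: "D f = (\<Sum>a<Suc m. d a f * D (X a))"
    if D: "derivation ?S D" and DK: "\<And>c. c \<in> range const \<Longrightarrow> D c = 0" and f: "f \<in> ?S" for D f
  proof -
    interpret D: derivation ?S D by (fact D)
    have D_pow: "D (pconst V ^ j) = pconst (Dv (V ^ j)) * D (pconst V)" for j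
    proof (cases j)
      case 0
      then show ?thesis by (simp add: D.d_one Dv.d_one)
    next
      case (Suc k)
      then show ?thesis
        by (simp only: D.d_power[OF WS] Dv.d_power[OF V] DvV pconst_mult pconst_power pconst_of_nat mult_1_right)
    qed
    have D_casimir: "D (pconst z) = pconst (Dv z) * D (pconst V)" if z: "z \<in> casimirs" for z
    proof -
      obtain N c where z: "z = (\<Sum>j<N. pconst (c j) * V ^ j)" using casimirs_V[OF z] by blast
      have "D (pconst z) = (\<Sum>j<N. D (const (c j) * pconst V ^ j))"
        unfolding z pconst_sum pconst_mult pconst_power
        by (intro D.d_sum S.mult constS S.power WS)
      also have "\<dots> = (\<Sum>j<N. pconst (pconst (c j) * Dv (V ^ j)) * D (pconst V))"
        by (intro sum.cong refl) (simp add: D.d_mult constS S.power WS DK D_pow pconst_mult mult.assoc)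
      also have "\<dots> = pconst (\<Sum>j<N. Dv (pconst (c j) * V ^ j)) * D (pconst V)"
        by (simp add: pconst_sum sum_distrib_right Dv.d_mult pconst_casimirs Z.power V Dv_pconst)
      also have "(\<Sum>j<N. Dv (pconst (c j) * V ^ j)) = Dv z"
        unfolding z by (intro Dv.d_sum[symmetric] Z.mult pconst_casimirs Z.power V)
      finally show ?thesis .
    qed
    define D' where "D' g = D g - Poly_Mapping.map Dv g * D (pconst V)" for g
    have "D' f = (\<Sum>j<m. pderiv_var j f * D' (pvar j))"
      using f
      by (rule Z.chain_rule[where \<Theta> = "\<lambda>g. g"])
        (simp_all add: D'_def D.d_add D.d_mult mDv.d_add mDv.d_mult D_casimir map_pconst Dv0 algebra_simps)
    then have "D f = Poly_Mapping.map Dv f * D (pconst V) + (\<Sum>j<m. pderiv_var j f * D (pvar j))"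
      by (simp add: D'_def Dv_pvar algebra_simps)
    then show ?thesis
      by (subst sum.lessThan_Suc_shift) (simp add: d_def X_def)
  qed
  have LN_d: "locally_nilpotent ?S (d a)" for a
  proof (cases a)
    case 0
    then show ?thesis using nilpotent by (simp add: d_def)
  next
    case (Suc j)
    have "locally_nilpotent ?S (pderiv_var j)"
      unfolding locally_nilpotent_def locally_nilpotent_axioms_def
      using Z.pderiv_var_derivation pderiv_var_nilpotent by blast
    then show ?thesis using Suc by (simp add: d_def)
  qed
  have LN_E: "locally_nilpotent ?S (E i)" for i
    by unfold_locales
      (use casimirs_R in \<open>auto simp: E_centre E.d_add E.d_mult intro: E.nilpotent\<close>)
  have d_kernel: "f \<in> range const" if f: "f \<in> ?S" and 0: "\<And>a. a < Suc m \<Longrightarrow> d a f = 0" for f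
  proof -
    have "pderiv_var j f = 0" if "j < m" for j
      using 0[of "Suc j"] that by (simp add: d_def)
    then have f0: "f = pconst (lookup f 0)"
      using pderiv_var_eq_0D[OF f] by (simp del: of_nat_Suc)
    define z where "z = lookup f 0"
    have z: "z \<in> casimirs" unfolding z_def by (rule Z.lookup_mpols[OF f])
    have "Poly_Mapping.map Dv (pconst z) = 0"
      using 0[of 0] f0 by (simp add: d_def z_def)
    then have "Dv z = 0" by (simp add: map_pconst Dv0)
    have "pderiv_var a z = 0" if a: "a < n" for a
    proof -
      have "pderiv_var a z = pderiv_var a z * Dv V" by (simp add: DvV)
      also have "\<dots> = (\<Sum>b<n. pconst (l b) * (pderiv_var a z * pderiv_var b V))"
        by (simp add: Dv_def sum_distrib_left ac_simps)
      also have "\<dots> = (\<Sum>b<n. pconst (l b) * (pderiv_var b z * pderiv_var a V))"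
        by (intro sum.cong refl) (simp add: casimirs_parallel_gradients[OF z V a])
      also have "\<dots> = Dv z * pderiv_var a V"
        by (simp add: Dv_def sum_distrib_right mult.assoc)
      finally show ?thesis using \<open>Dv z = 0\<close> by simp
    qed
    then have "z = pconst (lookup z 0)"
      using pderiv_var_eq_0D[OF casimirs_mpols[OF z]] by (simp del: of_nat_Suc)
    then show ?thesis using f0 by (metis z_def rangeI)
  qed
  have chain_\<sigma>: "D g = (\<Sum>i<m. E i g * D (\<phi>i (pvar i)))"
    if D: "derivation ?S D" and DZ: "\<And>f. f \<in> ?S \<Longrightarrow> (\<And>i. i < m \<Longrightarrow> E i f = 0) \<Longrightarrow> D f = 0" and g: "g \<in> ?S" for D g
  proof -
    interpret D: derivation ?S D by (fact D)
    have "D (\<phi>i (\<phi> g)) = (\<Sum>i<m. \<phi>i (pderiv_var i (\<phi> g)) * D (\<phi>i (pvar i)))"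
    proof (rule ZB.chain_rule[where E = "\<lambda>s. D (\<phi>i s)"])
      show "\<phi> g \<in> mpols centre m" using g by (simp add: \<phi>_centre_iff casimirs_R)
      show "D (\<phi>i (pconst c)) = 0" if "c \<in> centre" for c
        using that by (intro DZ \<phi>i_centre ZB.pconst_mpols E_\<phi>i_pconst centre_closed)
    qed (simp_all add: \<phi>i_add \<phi>i_mult \<phi>i_one centre_RB D.d_add D.d_mult \<phi>i_centre)
    then show ?thesis using g by (simp add: \<phi>i_\<phi> casimirs_R E_def)
  qed
  have K_subring: "subring_set (range const)"
  proof
    show "0 \<in> range const" "1 \<in> range const" by (auto intro: range_eqI[of _ _ 0] range_eqI[of _ _ 1])
    fix x y assume "x \<in> range const" "y \<in> range const"
    then obtain a b where "x = const a" "y = const b" by blast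
    then have "x + y = const (a + b)" "x * y = const (a * b)" "- x = const (- a)"
      by (simp_all add: pconst_add pconst_mult pconst_uminus)
    then show "x + y \<in> range const" "x * y \<in> range const" "- x \<in> range const"
      by blast+
  qed
  have K_inverse: "\<exists>c'\<in>range const. c * c' = 1" if c: "c \<in> range const" "c \<noteq> 0" for c
  proof -
    obtain a where a: "c = const a" using c(1) by blast
    then have "c * const (inverse a) = 1" using c(2) by (simp flip: pconst_mult)
    then show ?thesis by blast
  qed
  have XS: "X a \<in> ?S" if "a < Suc m" for a
    using that WS Z.pvar_mpols by (cases a) (auto simp: X_def)
  have dX: "d a (X b) = (if a = b then 1 else 0)" if "a < Suc m" "b < Suc m" for a b
    by (cases a; cases b) (auto simp: d_def X_def map_pconst Dv0 DvV Dv_pvar pderiv_var_pvar)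
  have dK: "d a c = 0" if "c \<in> range const" for a c
    using that by (cases a) (auto simp: d_def map_pconst Dv0 Dv_pconst)
  obtain w where w: "w \<in> {f \<in> ?S. \<forall>i<m. E i f = 0}"
    and generated: "\<And>f. f \<in> {f \<in> ?S. \<forall>i<m. E i f = 0} \<Longrightarrow>
      \<exists>N q. (\<forall>i. q i \<in> range const) \<and> f = (\<Sum>i<N. q i * w ^ i)"
  proof (rule one_dimensional_kernel_generated[of ?S "range const" m d X E "\<lambda>i. \<phi>i (pvar i)"])
    show "\<phi>i (pvar i) \<in> ?S" if "i < m" for i using that by (intro \<phi>i_centre ZB.pvar_mpols)
    show "range const \<subseteq> ?S" using constS by blast
    show "E i c = 0" if "c \<in> range const" for i c using that E_const by auto
    show "subring_set ?S" by (rule S.subring_set_axioms)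
    show "subring_set (range const)" by (rule K_subring)
    show "\<exists>c'\<in>range const. c * c' = 1" if "c \<in> range const" "c \<noteq> 0" for c using that by (rule K_inverse)
    show "locally_nilpotent ?S (d a)" "locally_nilpotent ?S (E a)" for a by (rule LN_d, rule LN_E)
    show "d a c = 0" if "c \<in> range const" for a c using that by (rule dK)
    show "f \<in> range const" if "f \<in> ?S" "\<And>a. a < Suc m \<Longrightarrow> d a f = 0" for f using that by (rule d_kernel)
    show "X a \<in> ?S" if "a < Suc m" for a using that by (rule XS)
    show "d a (X b) = (if a = b then 1 else 0)" if "a < Suc m" "b < Suc m" for a b using that by (rule dX)
    show "D f = (\<Sum>a<Suc m. d a f * D (X a))"
      if "derivation ?S D" "\<And>c. c \<in> range const \<Longrightarrow> D c = 0" "f \<in> ?S" for D f using that by (rule chain)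
    show "E i (\<phi>i (pvar k)) = (if k = i then 1 else 0)" if "i < m" "k < m" for i k using that(2) by (rule E_\<sigma>)
    show "D g = (\<Sum>i<m. E i g * D (\<phi>i (pvar i)))"
      if "derivation ?S D" "\<And>f. f \<in> ?S \<Longrightarrow> (\<And>i. i < m \<Longrightarrow> E i f = 0) \<Longrightarrow> D f = 0" "g \<in> ?S" for D g
      using that by (rule chain_\<sigma>)
  qed (use that in blast)
  define w' where "w' = \<psi> w"
  have wS: "w \<in> ?S" and wE: "\<And>i. i < m \<Longrightarrow> E i w = 0" using w by auto
  have wR: "w \<in> R" using wS by (rule casimirs_R)
  have \<phi>w: "\<phi> w = pconst w'"
    using E_kernel[OF wR wE] by (simp add: w'_def \<psi>_def)
  have w'Z: "w' \<in> centre" unfolding w'_def by (rule \<psi>_centre[OF wS])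
  have \<psi>V: "\<psi> (pconst V) \<in> centre" by (rule \<psi>_centre[OF WS])
  define x where "x i = \<psi> (pconst (pvar i))" for i
  define \<delta> where "\<delta> = w' - \<psi> (pconst V)"
  define y where "y i = x i + \<iota> (l i) * \<delta>" for i
  have \<delta>: "\<delta> \<in> centre" unfolding \<delta>_def by (intro ZB.diff w'Z \<psi>V)
  have x: "x i \<in> pcarrier B" if "i < n" for i using that by (simp add: x_def \<psi>_closed gen_R)
  let ?T = "subst n \<iota> y ` carA"
  interpret T: subring_set ?T by (rule subst_image_subring)
  show ?thesis
  proof (rule poisson_isomorphic_if_surjective)
    show "y i \<in> pcarrier B" if "i < n" for i
      unfolding y_def using that \<delta> by (intro BB.add BB.mult \<iota>_closed x centre_closed)
    show "pbracket B (y i) (y j) = (\<Sum>c<n. \<iota> (C i j c) * y c)" if ij: "i < n" "j < n" for i j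
    proof -
      have z: "\<iota> (l i) * \<delta> \<in> centre" for i by (intro ZB.mult \<iota>_centre \<delta>)
      have z0: "pbracket B (\<iota> (l i) * \<delta>) b = 0" "pbracket B b (\<iota> (l i) * \<delta>) = 0" if "b \<in> pcarrier B" for i b
        using z[of i] that bracket_antisym[OF that centre_closed[OF z[of i]]] by (auto simp: centre_def)
      have "pbracket B (y i) (y j) = pbracket B (x i) (x j)"
        unfolding y_def using x[OF ij(1)] x[OF ij(2)] centre_closed[OF z]
        by (simp add: B.bracket_add_left B.bracket_add_right BB.add z0)
      also have "\<dots> = (\<Sum>c<n. \<iota> (C i j c) * x c)"
        unfolding x_def by (rule \<psi>_gen_br[OF ij])
      also have "\<dots> = (\<Sum>c<n. \<iota> (C i j c) * x c) + \<iota> (\<Sum>c<n. C i j c * l c) * \<delta>"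
        using hom_zero[of \<iota>, OF \<iota>_add \<iota>_mult \<iota>_one] by (simp add: Cl[OF ij])
      also have "\<iota> (\<Sum>c<n. C i j c * l c) = (\<Sum>c<n. \<iota> (C i j c) * \<iota> (l c))"
        using additive_sum[of UNIV \<iota> "{..<n}" "\<lambda>c. C i j c * l c"] subring_set_UNIV \<iota>_add by (simp add: \<iota>_mult)
      finally show ?thesis
        by (simp add: y_def distrib_left sum.distrib sum_distrib_right mult.assoc)
    qed
    have w'T: "w' \<in> ?T"
    proof -
      have "(\<Sum>a<n. \<iota> (v a) * y a) = (\<Sum>a<n. \<iota> (v a) * x a) + (\<Sum>a<n. \<iota> (v a) * \<iota> (l a)) * \<delta>"
        by (simp add: y_def distrib_left sum.distrib sum_distrib_right mult.assoc)
      also have "(\<Sum>a<n. \<iota> (v a) * x a) = \<psi> (pconst V)"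
        unfolding V_def x_def by (rule \<psi>_linear[symmetric])
      also have "(\<Sum>a<n. \<iota> (v a) * \<iota> (l a)) = 1"
        using additive_sum[of UNIV \<iota> "{..<n}" "\<lambda>a. v a * l a"] subring_set_UNIV \<iota>_add
        by (simp add: \<iota>_mult vl \<iota>_one)
      finally have "w' = (\<Sum>a<n. \<iota> (v a) * y a)" by (simp add: \<delta>_def)
      also have "\<dots> \<in> ?T"
        by (intro T.sum T.mult subst_image_\<iota> subst_image_gen) auto
      finally show ?thesis .
    qed
    have centre_T: "b \<in> ?T" if b: "b \<in> centre" for b
    proof -
      have "\<phi>i (pconst b) \<in> {f \<in> ?S. \<forall>i<m. E i f = 0}"
        using b by (auto intro!: \<phi>i_centre ZB.pconst_mpols E_\<phi>i_pconst centre_closed)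
      from generated[OF this] obtain N q where q: "\<And>i. q i \<in> range const"
        and eq: "\<phi>i (pconst b) = (\<Sum>i<N. q i * w ^ i)" by blast
      have "\<exists>a. q i = const a" for i using q[of i] by blast
      then obtain c where c: "\<And>i. q i = const (c i)" by metis
      have \<psi>w: "\<psi> (w ^ i) = w' ^ i" for i
        using wR \<psi>_const[of 1] by (induction i) (simp_all add: \<psi>_mult R.power w'_def \<iota>_one)
      have "b = \<psi> (\<phi>i (pconst b))"
        using b by (simp add: \<psi>_def \<phi>_\<phi>i BB.pconst_mpols centre_closed lookup_pconst)
      also have "\<dots> = (\<Sum>i<N. \<psi> (const (c i) * w ^ i))"
        unfolding eq c by (rule \<psi>_sum) (intro R.mult const_closed R.power wR)
      also have "\<dots> = (\<Sum>i<N. \<iota> (c i) * w' ^ i)"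
        by (intro sum.cong refl) (simp add: \<psi>_mult const_closed R.power wR \<psi>_const \<psi>w)
      also have "\<dots> \<in> ?T"
        by (intro T.sum T.mult subst_image_\<iota> T.power w'T)
      finally show ?thesis .
    qed
    show "pcarrier B \<subseteq> ?T"
    proof (rule generated_by_images)
      show "\<psi> (pconst (pvar i)) \<in> ?T" if i: "i < n" for i
      proof -
        have "\<psi> (pconst (pvar i)) = y i - \<iota> (l i) * \<delta>" by (simp add: y_def x_def)
        also have "\<dots> \<in> ?T"
          using subst_image_gen[OF i] centre_T[OF \<delta>] by (intro T.diff T.mult subst_image_\<iota>)
        finally show ?thesis .
      qed
      show "\<psi> (pvar j) \<in> ?T" if "j < m" for j
        using that by (intro centre_T \<psi>_centre Z.pvar_mpols)
    qed (fact subst_image_subring, fact subst_image_\<iota>)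
  qed
qed

lemma poisson_isomorphic_A_B: "poisson_isomorphic A B"
proof (cases "\<exists>v l. central_summand v l")
  case True
  then show ?thesis using poisson_isomorphic_if_central_summand by blast
next
  case no_summand: False
  show ?thesis
  proof (cases "\<exists>p\<in>casimirs. p \<noteq> pconst (lookup p 0)")
    case True
    then obtain f d where f: "f \<in> casimirs" "f \<noteq> 0" "d > 0" "euler n f = of_nat d * f"
      using nonconstant_casimir_homogeneous by blast
    show ?thesis
      using E_casimirs[OF f] E_homogeneous_casimir[OF f] no_summand
      by (intro poisson_isomorphic_if_casimirs_fixed) blast
  next
    case False
    show ?thesis
    proof (rule poisson_isomorphic_if_casimirs_fixed)
      fix i z assume "z \<in> casimirs"
      with False have "pconst z = const (lookup z 0)" by auto
      then show "E i (pconst z) = 0" by (simp only: E_const)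
    qed
  qed
qed

end

section \<open>The symmetric algebra of a Lie algebra\<close>

theorem theorem3p15:
  fixes scale :: "'k::field_char_0 \<Rightarrow> 'g::ab_group_add \<Rightarrow> 'g"
    and lbr :: "'g \<Rightarrow> 'g \<Rightarrow> 'g"
    and xs :: "'g list"
  assumes "lie_algebra scale lbr"
    and "lie_basis scale xs"
    and "vector_space.dim scale (UNIV :: 'g set) \<le> 3"
    and "\<exists>x y. lbr x y \<noteq> 0"
  shows "strongly_poisson_cancellative TYPE('b::comm_ring_1) (PS scale lbr xs)"
proof -
  interpret lie_algebra scale lbr by (fact assms(1))
  have ind: "independent (set xs)" and span: "span (set xs) = UNIV" and dist: "distinct xs"
    using assms(2) by (auto simp: lie_basis_def)
  have "dim (UNIV :: 'g set) = length xs"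
    using dim_eq_card[of "set xs" UNIV] ind span dist by (simp add: distinct_card)
  with assms(3) have len: "length xs \<le> 3" by simp
  define C where "C a b c = representation (set xs) (lbr (xs ! a) (xs ! b)) (xs ! c)" for a b c
  have alt: "lbr x y = - lbr y x" for x y
  proof -
    have add: "lbr (u + v) z = lbr u z + lbr v z" "lbr z (u + v) = lbr z u + lbr z v" for u v z
      using linear_left[of z] linear_right[of z] by (auto simp: Vector_Spaces.linear_iff)
    have "lbr (x + y) (x + y) = lbr x x + lbr y y + (lbr x y + lbr y x)"
      by (simp add: add ac_simps)
    then show ?thesis by (simp add: lbr_self eq_neg_iff_add_eq_0)
  qed
  interpret linear_bracket "length xs" C
  proof
    show "C a b c = - C b a c" for a b c
      unfolding C_def using representation_neg[OF ind, of "lbr (xs ! b) (xs ! a)"] span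
      by (subst alt) simp
    show "\<exists>a<length xs. \<exists>b<length xs. \<exists>c<length xs. C a b c \<noteq> 0"
    proof (rule ccontr)
      assume *: "\<not> ?thesis"
      have 0: "lbr (xs ! a) (xs ! b) = 0" if "a < length xs" "b < length xs" for a b
      proof -
        have "representation (set xs) (lbr (xs ! a) (xs ! b)) e = 0" if "e \<in> set xs" for e
          using that * \<open>a < length xs\<close> \<open>b < length xs\<close> by (auto simp: C_def in_set_conv_nth)
        moreover have "(\<Sum>e\<in>set xs. scale (representation (set xs) (lbr (xs ! a) (xs ! b)) e) e) = lbr (xs ! a) (xs ! b)"
          using sum_representation_eq[OF ind, of _ "set xs"] span by auto
        ultimately show ?thesis by simp
      qed
      have 1: "lbr x y = 0" if "x \<in> set xs" for x y
      proof -
        have "lbr x ` UNIV \<subseteq> {0}"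
        proof -
          have "y \<in> span (set xs) \<Longrightarrow> lbr x y = 0" for y
            by (rule module_hom.eq_0_on_span[OF linear_right[unfolded linear_iff_module_hom]]) (use that 0 in \<open>auto simp: in_set_conv_nth\<close>)
          then show ?thesis using span by auto
        qed
        then show ?thesis by auto
      qed
      have "lbr x y = 0" for x y
      proof -
        have "x \<in> span (set xs) \<Longrightarrow> lbr x y = 0"
          by (rule module_hom.eq_0_on_span[OF linear_left[unfolded linear_iff_module_hom]]) (use 1 in auto)
        then show ?thesis using span by auto
      qed
      with assms(4) show False by blast
    qed
  qed (fact len)
  have \<pi>: "lie_to_sym scale xs (lbr (xs ! i) (xs ! j)) = \<pi> i j" for i j
    by (simp add: lie_to_sym_def \<pi>_def C_def)
  show ?thesis
    unfolding strongly_poisson_cancellative_def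
  proof (intro allI impI)
    fix m and B :: "('k, 'b) palg"
    assume "poisson_algebra B" and "poisson_isomorphic (poisson_poly_ext (PS scale lbr xs) m) (poisson_poly_ext B m)"
    then obtain \<phi> where iso: "poisson_iso (poisson_poly_ext (PS scale lbr xs) m) (poisson_poly_ext B m) \<phi>"
      by (auto simp: poisson_isomorphic_def)
    interpret B: poisson_algebra B by fact
    interpret stable_iso "length xs" C B "PS scale lbr xs" m \<phi>
    proof
      show "pcarrier (PS scale lbr xs) = mpols UNIV (length xs)"
        and "pscale (PS scale lbr xs) = (\<lambda>c p. pconst c * p)"
        by (simp_all add: PS_def)
      show "pbracket (PS scale lbr xs) = br"
        by (intro ext) (simp add: PS_def br_def \<pi>)
    qed (fact iso)
    show "poisson_isomorphic (PS scale lbr xs) B"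
      by (rule poisson_isomorphic_A_B)
  qed
qed

end
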